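(* Let $G$ be a finitely generated group, let $Q=G/G'$ be the abelianisation of $G$, and consider $W=W(G)<\mathfrak{X}(G)$ as a $\mathbb{Z}Q$-module, the action being induced by conjugation in $\mathfrak{X}(G)$. Then there exists a $\mathbb{Z}Q$-submodule $W_0<W$ such that: (1) $W_0$ is a subquotient of the $\mathbb{Z}Q$-module $M=\big((G'/G'')\otimes_{\mathbb{Z}}(G'/G'')\big)_{Q_0}$; (2) the action of $Q$ on $W/W_0$ is nilpotent.
   Context: For a group $G$, $G'=[G,G]$ and $G''=[G',G']$. Let $\overline{G}$ be a second copy of $G$ with a fixed isomorphism $g\mapsto\overline{g}$. The group $\mathfrak{X}(G)$ is the quotient of the free product $G\ast\overline{G}$ by the normal closure of $\{[g,\overline{g}] : g\in G\}$. Let $D$ be the kernel of the natural surjection $\mathfrak{X}(G)\to G\times\overline{G}$, let $L$ be the kernel of the surjection $\mathfrak{X}(G)\to G$ that sends both $g$ and $\overline{g}$ to $g$, and let $W=W(G)=D\cap L$. It is known (Sidki) that $[D,L]=1$; hence $W$ is abelian and central in $DL$, and the conjugation action of $\mathfrak{X}(G)$ on $W$ factors through $\mathfrak{X}(G)/DL\cong G/G'=Q$. This makes $W$ a $\mathbb{Z}Q$-module. Definition of $M$: the group $(G/G')\times(G/G')$ acts on $(G'/G'')\otimes_{\mathbb{Z}}(G'/G'')$ factorwise, by the conjugation action of $G/G'$ on $G'/G''$. Put $Q_0=\{(q,q^{-1})\mid q\in Q\}\le (G/G')\times(G/G')$; $M$ is the module of $Q_0$-coinvariants. The group $Q$ acts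 on $M$ via conjugation on the first tensor factor and trivially on the second. An action of a group $Q$ on an abelian group $A$ is nilpotent if there is an integer $d$ such that $A\cdot({\rm Aug}(\mathbb{Z}Q))^d=0$, i.e. $a(q_1-1)\cdots(q_d-1)=0$ for all $a\in A$, $q_i\in Q$, where ${\rm Aug}(\mathbb{Z}Q)$ is the augmentation ideal. *)

theory Defs
  imports "HOL-Algebra.Algebra"
begin

definition finitely_generated :: "('a, 'm) monoid_scheme \<Rightarrow> bool" where
  "finitely_generated G \<longleftrightarrow> (\<exists>S. finite S \<and> S \<subseteq> carrier G \<and> generate G S = carrier G)"

definition normal_closure :: "('a, 'm) monoid_scheme \<Rightarrow> 'a set \<Rightarrow> 'a set" where
  "normal_closure G S = generate G (\<Union>g\<in>carrier G. (\<lambda>s. g \<otimes>\<^bsub>G\<^esub> s \<otimes>\<^bsub>G\<^esub> inv\<^bsub>G\<^esub> g) ` S)"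

definition commutator_elem :: "('a, 'm) monoid_scheme \<Rightarrow> 'a \<Rightarrow> 'a \<Rightarrow> 'a" where
  "commutator_elem G x y = x \<otimes>\<^bsub>G\<^esub> y \<otimes>\<^bsub>G\<^esub> inv\<^bsub>G\<^esub> x \<otimes>\<^bsub>G\<^esub> inv\<^bsub>G\<^esub> y"

abbreviation derived_subgroup :: "('a, 'm) monoid_scheme \<Rightarrow> 'a set" where
  "derived_subgroup G \<equiv> derived G (carrier G)"

abbreviation second_derived_subgroup :: "('a, 'm) monoid_scheme \<Rightarrow> 'a set" where
  "second_derived_subgroup G \<equiv> derived G (derived_subgroup G)"

abbreviation abelianization :: "('a, 'm) monoid_scheme \<Rightarrow> 'a set monoid" where
  "abelianization G \<equiv> G Mod derived_subgroup G"

text \<open>If \<open>f\<close> is a homomorphism into \<open>K\<close> that sends a normal subgroup into the normal subgroup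
  \<open>N\<close> of \<open>K\<close>, then \<open>induced_on_cosets K N f\<close> is the induced map of quotient groups. Likewise
  \<open>the_elem (f ` C)\<close> is the value at the class \<open>C\<close> of the map induced by a function \<open>f\<close> that is
  constant on classes.\<close>

definition induced_on_cosets ::
    "('b, 'm) monoid_scheme \<Rightarrow> 'b set \<Rightarrow> ('a \<Rightarrow> 'b) \<Rightarrow> 'a set \<Rightarrow> 'b set" where
  "induced_on_cosets K N f C = the_elem ((\<lambda>x. N #>\<^bsub>K\<^esub> f x) ` C)"

definition free_product_words ::
    "('a, 'm) monoid_scheme \<Rightarrow> ('b, 'n) monoid_scheme \<Rightarrow> ('a + 'b) list set" where
  "free_product_words G H = lists (Inl ` carrier G \<union> Inr ` carrier H)"

inductive_set free_product_rel ::
    "('a, 'm) monoid_scheme \<Rightarrow> ('b, 'n) monoid_scheme \<Rightarrow> (('a + 'b) list \<times> ('a + 'b) list) set"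
  for G H where
    refl: "w \<in> free_product_words G H \<Longrightarrow> (w, w) \<in> free_product_rel G H"
  | sym: "(v, w) \<in> free_product_rel G H \<Longrightarrow> (w, v) \<in> free_product_rel G H"
  | trans: "(u, v) \<in> free_product_rel G H \<Longrightarrow> (v, w) \<in> free_product_rel G H
      \<Longrightarrow> (u, w) \<in> free_product_rel G H"
  | one_left: "u \<in> free_product_words G H \<Longrightarrow> v \<in> free_product_words G H
      \<Longrightarrow> (u @ [Inl \<one>\<^bsub>G\<^esub>] @ v, u @ v) \<in> free_product_rel G H"
  | one_right: "u \<in> free_product_words G H \<Longrightarrow> v \<in> free_product_words G H
      \<Longrightarrow> (u @ [Inr \<one>\<^bsub>H\<^esub>] @ v, u @ v) \<in> free_product_rel G H"
  | mult_left: "u \<in> free_product_words G H \<Longrightarrow> v \<in> free_product_words G H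
      \<Longrightarrow> x \<in> carrier G \<Longrightarrow> y \<in> carrier G
      \<Longrightarrow> (u @ [Inl x, Inl y] @ v, u @ [Inl (x \<otimes>\<^bsub>G\<^esub> y)] @ v) \<in> free_product_rel G H"
  | mult_right: "u \<in> free_product_words G H \<Longrightarrow> v \<in> free_product_words G H
      \<Longrightarrow> x \<in> carrier H \<Longrightarrow> y \<in> carrier H
      \<Longrightarrow> (u @ [Inr x, Inr y] @ v, u @ [Inr (x \<otimes>\<^bsub>H\<^esub> y)] @ v) \<in> free_product_rel G H"

definition free_product_class ::
    "('a, 'm) monoid_scheme \<Rightarrow> ('b, 'n) monoid_scheme \<Rightarrow> ('a + 'b) list \<Rightarrow> ('a + 'b) list set" where
  "free_product_class G H w = free_product_rel G H `` {w}"

definition free_product ::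
    "('a, 'm) monoid_scheme \<Rightarrow> ('b, 'n) monoid_scheme \<Rightarrow> ('a + 'b) list set monoid" where
  "free_product G H =
     \<lparr>carrier = free_product_words G H // free_product_rel G H,
      monoid.mult = (\<lambda>A B. the_elem ((\<lambda>(u, v). free_product_class G H (u @ v)) ` (A \<times> B))),
      one = free_product_class G H []\<rparr>"

text \<open>The homomorphism out of a free product into \<open>K\<close> determined by homomorphisms \<open>f\<close> and \<open>h\<close>
  on the two factors.\<close>

definition eval_word ::
    "('c, 'm) monoid_scheme \<Rightarrow> ('a \<Rightarrow> 'c) \<Rightarrow> ('b \<Rightarrow> 'c) \<Rightarrow> ('a + 'b) list \<Rightarrow> 'c" where
  "eval_word K f h w = foldr (\<lambda>l y. case_sum f h l \<otimes>\<^bsub>K\<^esub> y) w \<one>\<^bsub>K\<^esub>"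

definition free_product_lift ::
    "('c, 'm) monoid_scheme \<Rightarrow> ('a \<Rightarrow> 'c) \<Rightarrow> ('b \<Rightarrow> 'c) \<Rightarrow> ('a + 'b) list set \<Rightarrow> 'c" where
  "free_product_lift K f h C = the_elem (eval_word K f h ` C)"

text \<open>The second copy of \<open>G\<close> is the right-hand factor of the free product of \<open>G\<close> with itself.\<close>

definition weak_comm_relators :: "('a, 'm) monoid_scheme \<Rightarrow> ('a + 'a) list set set" where
  "weak_comm_relators G =
     {commutator_elem (free_product G G) (free_product_class G G [Inl g])
        (free_product_class G G [Inr g]) | g. g \<in> carrier G}"

definition weak_comm :: "('a, 'm) monoid_scheme \<Rightarrow> ('a + 'a) list set set monoid" (\<open>\<XX>\<close>) where
  "\<XX> G = free_product G G Mod normal_closure (free_product G G) (weak_comm_relators G)"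

definition weak_comm_lift ::
    "('c, 'm) monoid_scheme \<Rightarrow> ('a \<Rightarrow> 'c) \<Rightarrow> ('a \<Rightarrow> 'c) \<Rightarrow> ('a + 'a) list set set \<Rightarrow> 'c" where
  "weak_comm_lift K f h C = the_elem (free_product_lift K f h ` C)"

definition weak_comm_to_prod :: "('a, 'm) monoid_scheme \<Rightarrow> ('a + 'a) list set set \<Rightarrow> 'a \<times> 'a" where
  "weak_comm_to_prod G = weak_comm_lift (G \<times>\<times> G) (\<lambda>g. (g, \<one>\<^bsub>G\<^esub>)) (\<lambda>g. (\<one>\<^bsub>G\<^esub>, g))"

definition weak_comm_fold :: "('a, 'm) monoid_scheme \<Rightarrow> ('a + 'a) list set set \<Rightarrow> 'a" where
  "weak_comm_fold G = weak_comm_lift G (\<lambda>g. g) (\<lambda>g. g)"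

definition weak_comm_D :: "('a, 'm) monoid_scheme \<Rightarrow> ('a + 'a) list set set set" where
  "weak_comm_D G = kernel (\<XX> G) (G \<times>\<times> G) (weak_comm_to_prod G)"

definition weak_comm_L :: "('a, 'm) monoid_scheme \<Rightarrow> ('a + 'a) list set set set" where
  "weak_comm_L G = kernel (\<XX> G) G (weak_comm_fold G)"

definition weak_comm_W :: "('a, 'm) monoid_scheme \<Rightarrow> ('a + 'a) list set set set" where
  "weak_comm_W G = weak_comm_D G \<inter> weak_comm_L G"

definition group_ring :: "('q, 'm) monoid_scheme \<Rightarrow> ('q \<Rightarrow>\<^sub>0 int) ring" where
  "group_ring Q =
     \<lparr>carrier = {r. Poly_Mapping.keys r \<subseteq> carrier Q},
      monoid.mult = (\<lambda>r s. frag_extend (\<lambda>p. frag_extend (\<lambda>q. frag_of (p \<otimes>\<^bsub>Q\<^esub> q)) s) r),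
      one = frag_of \<one>\<^bsub>Q\<^esub>,
      ring.zero = 0,
      ring.add = (+)\<rparr>"

text \<open>The module given by a (multiplicatively written) abelian group \<open>A\<close> and an action of \<open>Q\<close> on
  \<open>A\<close> by automorphisms, extended linearly. Modules over \<open>R\<close> are ring records with a scalar
  multiplication; their fields \<open>mult\<close> and \<open>one\<close> play no role.\<close>

definition module_of_action ::
    "('a, 'm) monoid_scheme \<Rightarrow> ('q \<Rightarrow> 'a \<Rightarrow> 'a) \<Rightarrow> ('q \<Rightarrow>\<^sub>0 int, 'a) module" where
  "module_of_action A act =
     \<lparr>carrier = carrier A, monoid.mult = undefined, one = undefined,
      ring.zero = \<one>\<^bsub>A\<^esub>, ring.add = monoid.mult A,
      module.smult = (\<lambda>r a. \<Otimes>\<^bsub>A\<^esub>q\<in>Poly_Mapping.keys r. act q a [^]\<^bsub>A\<^esub> Poly_Mapping.lookup r q)\<rparr>"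

definition quotient_module :: "('r, 'a) module \<Rightarrow> 'a set \<Rightarrow> ('r, 'a set) module" where
  "quotient_module M N =
     \<lparr>carrier = a_rcosets\<^bsub>M\<^esub> N, monoid.mult = undefined, one = undefined,
      ring.zero = N, ring.add = set_add M,
      module.smult = (\<lambda>r. induced_on_cosets (add_monoid M) N (\<lambda>x. r \<odot>\<^bsub>M\<^esub> x))\<rparr>"

definition module_iso ::
    "('r, 'l) ring_scheme \<Rightarrow> ('r, 'a) module \<Rightarrow> ('r, 'b) module \<Rightarrow> ('a \<Rightarrow> 'b) set" where
  "module_iso R M N =
     {f \<in> iso (add_monoid M) (add_monoid N).
        \<forall>r\<in>carrier R. \<forall>x\<in>carrier M. f (r \<odot>\<^bsub>M\<^esub> x) = r \<odot>\<^bsub>N\<^esub> f x}"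

definition is_subquotient ::
    "('r, 'l) ring_scheme \<Rightarrow> ('r, 'a) module \<Rightarrow> ('r, 'b) module \<Rightarrow> bool" where
  "is_subquotient R N M \<longleftrightarrow>
     (\<exists>A B. submodule A R M \<and> submodule B R (M\<lparr>carrier := A\<rparr>) \<and>
        module_iso R N (quotient_module (M\<lparr>carrier := A\<rparr>) B) \<noteq> {})"

definition nilpotent_action ::
    "('q, 'm) monoid_scheme \<Rightarrow> ('q \<Rightarrow>\<^sub>0 int, 'a) module \<Rightarrow> bool" where
  "nilpotent_action Q A \<longleftrightarrow>
     (\<exists>d. \<forall>a\<in>carrier A. \<forall>qs\<in>lists (carrier Q). length qs = d \<longrightarrow>
        foldl (\<lambda>x q. (frag_of q \<ominus>\<^bsub>group_ring Q\<^esub> \<one>\<^bsub>group_ring Q\<^esub>) \<odot>\<^bsub>A\<^esub> x) a qs = \<zero>\<^bsub>A\<^esub>)"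

definition tensor_relations ::
    "('a, 'm) monoid_scheme \<Rightarrow> ('b, 'n) monoid_scheme \<Rightarrow> ('a \<times> 'b \<Rightarrow>\<^sub>0 int) set" where
  "tensor_relations A B =
     generate (free_Abelian_group (carrier A \<times> carrier B))
       ({frag_of (a \<otimes>\<^bsub>A\<^esub> a', b) - frag_of (a, b) - frag_of (a', b) | a a' b.
           a \<in> carrier A \<and> a' \<in> carrier A \<and> b \<in> carrier B} \<union>
        {frag_of (a, b \<otimes>\<^bsub>B\<^esub> b') - frag_of (a, b) - frag_of (a, b') | a b b'.
           a \<in> carrier A \<and> b \<in> carrier B \<and> b' \<in> carrier B})"

definition tensor_product ::
    "('a, 'm) monoid_scheme \<Rightarrow> ('b, 'n) monoid_scheme \<Rightarrow> ('a \<times> 'b \<Rightarrow>\<^sub>0 int) set monoid" where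
  "tensor_product A B = free_Abelian_group (carrier A \<times> carrier B) Mod tensor_relations A B"

text \<open>The endomorphism \<open>f \<otimes> g\<close> of the tensor product of \<open>A\<close> and \<open>B\<close>.\<close>

definition tensor_map ::
    "('a, 'm) monoid_scheme \<Rightarrow> ('b, 'n) monoid_scheme \<Rightarrow> ('a \<Rightarrow> 'a) \<Rightarrow> ('b \<Rightarrow> 'b)
      \<Rightarrow> ('a \<times> 'b \<Rightarrow>\<^sub>0 int) set \<Rightarrow> ('a \<times> 'b \<Rightarrow>\<^sub>0 int) set" where
  "tensor_map A B f g =
     induced_on_cosets (free_Abelian_group (carrier A \<times> carrier B)) (tensor_relations A B)
       (frag_extend (\<lambda>(a, b). frag_of (f a, g b)))"

definition coinvariant_relations ::
    "'p set \<Rightarrow> ('a, 'm) monoid_scheme \<Rightarrow> ('p \<Rightarrow> 'a \<Rightarrow> 'a) \<Rightarrow> 'a set" where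
  "coinvariant_relations P A act =
     generate A {act p a \<otimes>\<^bsub>A\<^esub> inv\<^bsub>A\<^esub> a | p a. p \<in> P \<and> a \<in> carrier A}"

definition coinvariants ::
    "'p set \<Rightarrow> ('a, 'm) monoid_scheme \<Rightarrow> ('p \<Rightarrow> 'a \<Rightarrow> 'a) \<Rightarrow> 'a set monoid" where
  "coinvariants P A act = A Mod coinvariant_relations P A act"

text \<open>An element of the abelianization is a coset \<open>q \<subseteq> carrier G\<close>; it acts on \<open>W\<close> by conjugation
  with any element of \<open>\<XX> G\<close> whose image in \<open>G\<close> lies in \<open>q\<close>.\<close>

definition W_action ::
    "('a, 'm) monoid_scheme \<Rightarrow> 'a set \<Rightarrow> ('a + 'a) list set set \<Rightarrow> ('a + 'a) list set set" where
  "W_action G q w =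
     the_elem {x \<otimes>\<^bsub>\<XX> G\<^esub> w \<otimes>\<^bsub>\<XX> G\<^esub> inv\<^bsub>\<XX> G\<^esub> x | x. x \<in> carrier (\<XX> G) \<and> weak_comm_fold G x \<in> q}"

definition W_module ::
    "('a, 'm) monoid_scheme \<Rightarrow> ('a set \<Rightarrow>\<^sub>0 int, ('a + 'a) list set set) module" where
  "W_module G = module_of_action (\<XX> G\<lparr>carrier := weak_comm_W G\<rparr>) (W_action G)"

definition derived_quotient :: "('a, 'm) monoid_scheme \<Rightarrow> 'a set monoid" where
  "derived_quotient G = G\<lparr>carrier := derived_subgroup G\<rparr> Mod second_derived_subgroup G"

definition derived_quotient_action :: "('a, 'm) monoid_scheme \<Rightarrow> 'a set \<Rightarrow> 'a set \<Rightarrow> 'a set" where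
  "derived_quotient_action G q C =
     the_elem {second_derived_subgroup G #>\<^bsub>G\<^esub> (g \<otimes>\<^bsub>G\<^esub> x \<otimes>\<^bsub>G\<^esub> inv\<^bsub>G\<^esub> g) | g x. g \<in> q \<and> x \<in> C}"

abbreviation derived_tensor ::
    "('a, 'm) monoid_scheme \<Rightarrow> ('a set \<times> 'a set \<Rightarrow>\<^sub>0 int) set monoid" where
  "derived_tensor G \<equiv> tensor_product (derived_quotient G) (derived_quotient G)"

definition derived_tensor_action ::
    "('a, 'm) monoid_scheme \<Rightarrow> 'a set \<times> 'a set
      \<Rightarrow> ('a set \<times> 'a set \<Rightarrow>\<^sub>0 int) set \<Rightarrow> ('a set \<times> 'a set \<Rightarrow>\<^sub>0 int) set" where
  "derived_tensor_action G = (\<lambda>(p, q).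
     tensor_map (derived_quotient G) (derived_quotient G)
       (derived_quotient_action G p) (derived_quotient_action G q))"

definition antidiagonal :: "('q, 'm) monoid_scheme \<Rightarrow> ('q \<times> 'q) set" where
  "antidiagonal Q = {(q, inv\<^bsub>Q\<^esub> q) | q. q \<in> carrier Q}"

definition M_group :: "('a, 'm) monoid_scheme \<Rightarrow> ('a set \<times> 'a set \<Rightarrow>\<^sub>0 int) set set monoid" where
  "M_group G =
     coinvariants (antidiagonal (abelianization G)) (derived_tensor G) (derived_tensor_action G)"

definition M_action ::
    "('a, 'm) monoid_scheme \<Rightarrow> 'a set
      \<Rightarrow> ('a set \<times> 'a set \<Rightarrow>\<^sub>0 int) set set \<Rightarrow> ('a set \<times> 'a set \<Rightarrow>\<^sub>0 int) set set" where
  "M_action G q =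
     induced_on_cosets (derived_tensor G)
       (coinvariant_relations (antidiagonal (abelianization G)) (derived_tensor G)
         (derived_tensor_action G))
       (tensor_map (derived_quotient G) (derived_quotient G) (derived_quotient_action G q) (\<lambda>C. C))"

definition M_module ::
    "('a, 'm) monoid_scheme
      \<Rightarrow> ('a set \<Rightarrow>\<^sub>0 int, ('a set \<times> 'a set \<Rightarrow>\<^sub>0 int) set set) module" where
  "M_module G = module_of_action (M_group G) (M_action G)"

end

theory Submission
  imports Defs
begin

text \<open>
  Write \<open>p, q, \<mu>\<close> for the homomorphisms from \<open>\<XX>(G)\<close> to \<open>G\<close> that kill the second copy of \<open>G\<close>,
  kill the first copy, and fold the two copies; \<open>W\<close> is their common kernel and \<open>L\<close> is the kernel
  of \<open>\<mu>\<close>. Inside \<open>L\<close> let \<open>A\<close> and \<open>B\<close> be the kernels of \<open>q\<close> and \<open>p\<close>; then \<open>p(A) = q(B) = G'\<close> and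
  \<open>A \<inter> B = W\<close>. As \<open>W\<close> is central in \<open>L\<close>, the commutators \<open>[a, b]\<close> define a bilinear map from
  \<open>G'/G'' \<times> G'/G''\<close> to \<open>W\<close>. The first copy of \<open>G\<close> centralises \<open>B\<close> modulo \<open>W\<close> and the second one
  centralises \<open>A\<close> modulo \<open>W\<close>, while both act on \<open>W\<close> in the same way; hence the map is
  \<open>Q\<close>-equivariant in either variable and factors through \<open>M\<close>. Its image \<open>W\<^sub>0 = [A, B]\<close> is a
  quotient of \<open>M\<close>.

  It remains to see that \<open>Q\<close> acts nilpotently on \<open>W/W\<^sub>0\<close>. On the abelian group \<open>L/L'\<close> every
  \<open>g \<in> Q\<close> satisfies \<open>(g - 1)\<^sup>2 = 0\<close>, so finite generation bounds the nilpotency class of \<open>L/L'\<close>. On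
  \<open>W \<inter> L'\<close>, two further steps suffice: \<open>\<XX>(G)\<close> acts trivially on \<open>L'\<close> modulo a product \<open>N\<close> of a
  subgroup of \<open>A\<close> centralised modulo \<open>W\<^sub>0\<close> by the second copy of \<open>G\<close> and a subgroup of \<open>B\<close>
  centralised modulo \<open>W\<^sub>0\<close> by the first copy, and thus \<open>Q\<close> acts trivially on \<open>W \<inter> N\<close> modulo \<open>W\<^sub>0\<close>.
\<close>

section \<open>Weakly commuting copies of a group\<close>

text \<open>The obstacle is that L is larger than AB: already \<open>p (ell g)\<close> is the
  inverse of g, so p maps L onto G, while it maps AB only into G'. Commutators of elements of L
  therefore do not reduce to the pairing directly. But [x, l] with l in L has its image under p in
  G' and so lies in AB; this is why the double commutators [[x, l], m] land in N, and why L/L' has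
  to be treated separately.

  On L/L' the relation (g - 1)^2 = 0 for single elements bounds the class for all of Q only because
  the operators commute: D centralises L, so DL acts trivially on L/L' and the action factors
  through an abelian group. Each generator can then be disposed of in turn by a filtration that
  stays invariant under the others.

  The argument runs in a locale that records only homomorphisms, commutation and generation. These
  assumptions are symmetric in the two copies of G, so half of the statements follow from the other
  half by exchanging the copies.\<close>

context group
begin

lemma mult_inv_cancel_left [simp]:
  "x \<in> carrier G \<Longrightarrow> y \<in> carrier G \<Longrightarrow> x \<otimes> (inv x \<otimes> y) = y"
  by (simp flip: m_assoc)

lemma inv_mult_cancel_left [simp]:
  "x \<in> carrier G \<Longrightarrow> y \<in> carrier G \<Longrightarrow> inv x \<otimes> (x \<otimes> y) = y"
  by (simp flip: m_assoc)

lemma commutator_closed [simp]: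
  "x \<in> carrier G \<Longrightarrow> y \<in> carrier G \<Longrightarrow> commutator_elem G x y \<in> carrier G"
  by (simp add: commutator_elem_def)

lemma commutator_eq_one_iff:
  assumes "x \<in> carrier G" "y \<in> carrier G"
  shows "commutator_elem G x y = \<one> \<longleftrightarrow> x \<otimes> y = y \<otimes> x"
proof -
  have "commutator_elem G x y = (x \<otimes> y) \<otimes> inv (y \<otimes> x)"
    using assms by (simp add: commutator_elem_def m_assoc inv_mult_group)
  then show ?thesis
    using assms by (metis inv_closed inv_equality inv_inv m_closed r_inv)
qed

lemma subgroup_conj_closed:
  assumes "N \<lhd> G" "x \<in> carrier G" "y \<in> N"
  shows "x \<otimes> y \<otimes> inv x \<in> N"
  using assms normal.inv_op_closed2 by metis

text \<open>Invariance under t alone does not give invariance under its inverse when the subgroup is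
  infinite; the closure of T under inverses supplies it.\<close>

lemma generate_normal:
  assumes T: "generate G T = carrier G" and T_inv: "\<And>t. t \<in> T \<Longrightarrow> inv t \<in> T"
    and S: "S \<subseteq> carrier G" and conj: "\<And>t s. t \<in> T \<Longrightarrow> s \<in> S \<Longrightarrow> t \<otimes> s \<otimes> inv t \<in> generate G S"
  shows "generate G S \<lhd> G"
proof -
  have Tc: "t \<in> carrier G" if "t \<in> T" for t
    using generate.incl[OF that, of G] T by simp
  have N: "subgroup (generate G S) G"
    using S by (rule generate_is_subgroup)
  note cl = subgroup.mem_carrier[OF N]
  have conj': "t \<otimes> y \<otimes> inv t \<in> generate G S" if t: "t \<in> T" and "y \<in> generate G S" for t y
    using that(2)
  proof (induction rule: generate.induct)
    case one
    then show ?case using Tc[OF t] by (simp add: generate.one)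
  next
    case (incl h)
    then show ?case by (rule conj[OF t])
  next
    case (inv h)
    have "inv (t \<otimes> h \<otimes> inv t) = t \<otimes> inv h \<otimes> inv t"
      using Tc[OF t] subsetD[OF S inv] by (simp add: inv_mult_group m_assoc)
    then show ?case
      using subgroup.m_inv_closed[OF N conj[OF t inv]] by simp
  next
    case (eng h1 h2)
    have "t \<otimes> (h1 \<otimes> h2) \<otimes> inv t = (t \<otimes> h1 \<otimes> inv t) \<otimes> (t \<otimes> h2 \<otimes> inv t)"
      using Tc[OF t] cl[OF eng(1)] cl[OF eng(2)] by (simp add: m_assoc)
    then show ?case using generate.eng[OF eng(3,4)] by simp
  qed
  have "\<forall>y\<in>generate G S. x \<otimes> y \<otimes> inv x \<in> generate G S" if "x \<in> generate G T" for x
    using that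
  proof (induction rule: generate.induct)
    case one
    then show ?case using cl by simp
  next
    case (incl h)
    then show ?case using conj' by blast
  next
    case (inv h)
    then show ?case using conj'[OF T_inv[OF inv]] by blast
  next
    case (eng h1 h2)
    have c: "h1 \<in> carrier G" "h2 \<in> carrier G"
      using eng(1,2) T by simp_all
    have "(h1 \<otimes> h2) \<otimes> y \<otimes> inv (h1 \<otimes> h2) = h1 \<otimes> (h2 \<otimes> y \<otimes> inv h2) \<otimes> inv h1"
      if "y \<in> generate G S" for y
      using c cl[OF that] by (simp add: m_assoc inv_mult_group)
    then show ?case using eng(3,4) by simp
  qed
  then show ?thesis
    unfolding normal_inv_iff using N T by blast
qed

lemma generate_commute:
  assumes "S \<subseteq> carrier G" "T \<subseteq> carrier G"
    and st: "\<And>s t. s \<in> S \<Longrightarrow> t \<in> T \<Longrightarrow> s \<otimes> t = t \<otimes> s"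
    and "x \<in> generate G S" "y \<in> generate G T"
  shows "x \<otimes> y = y \<otimes> x"
proof -
  have inv_commute: "inv u \<otimes> v = v \<otimes> inv u"
    if "u \<otimes> v = v \<otimes> u" "u \<in> carrier G" "v \<in> carrier G" for u v
  proof -
    have "inv u \<otimes> (u \<otimes> v) \<otimes> inv u = inv u \<otimes> (v \<otimes> u) \<otimes> inv u"
      using that by simp
    then show ?thesis using that(2,3) by (simp add: m_assoc)
  qed
  have one_side: "x \<otimes> t = t \<otimes> x"
    if x: "x \<in> generate G S" and S: "S \<subseteq> carrier G" and t: "t \<in> carrier G"
      and c: "\<And>s. s \<in> S \<Longrightarrow> s \<otimes> t = t \<otimes> s" for x t S
    using x
  proof (induction rule: generate.induct)
    case (inv h)
    then show ?case using inv_commute c S t by auto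
  next
    case (eng h1 h2)
    then have "h1 \<in> carrier G" "h2 \<in> carrier G"
      using generate_in_carrier[OF S] by auto
    then show ?case using eng(3,4) t by (metis m_assoc)
  qed (use c t in auto)
  have xc: "x \<in> carrier G"
    using generate_in_carrier assms by metis
  have "t \<otimes> x = x \<otimes> t" if "t \<in> T" for t
    using one_side[OF assms(4,1), of t] st that assms(2) by force
  then show ?thesis
    using one_side[OF assms(5,2) xc] by simp
qed

end

section \<open>Two weakly commuting copies, the kernels D and L, and [D, L] = 1\<close>

locale weakly_commuting = H: group H + G: group G
  for H (structure) and G :: "('g, 'm) monoid_scheme" +
  fixes \<alpha> \<beta> p q \<mu>
  assumes alpha_hom: "\<alpha> \<in> hom G H" and beta_hom: "\<beta> \<in> hom G H"
    and p_hom: "p \<in> hom H G" and q_hom: "q \<in> hom H G" and mu_hom: "\<mu> \<in> hom H G"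
    and p_alpha [simp]: "g \<in> carrier G \<Longrightarrow> p (\<alpha> g) = g"
    and p_beta [simp]: "g \<in> carrier G \<Longrightarrow> p (\<beta> g) = \<one>\<^bsub>G\<^esub>"
    and q_alpha [simp]: "g \<in> carrier G \<Longrightarrow> q (\<alpha> g) = \<one>\<^bsub>G\<^esub>"
    and q_beta [simp]: "g \<in> carrier G \<Longrightarrow> q (\<beta> g) = g"
    and mu_alpha [simp]: "g \<in> carrier G \<Longrightarrow> \<mu> (\<alpha> g) = g"
    and mu_beta [simp]: "g \<in> carrier G \<Longrightarrow> \<mu> (\<beta> g) = g"
    and alpha_beta_commute: "g \<in> carrier G \<Longrightarrow> \<alpha> g \<otimes> \<beta> g = \<beta> g \<otimes> \<alpha> g"
    and generated: "generate H (\<alpha> ` carrier G \<union> \<beta> ` carrier G) = carrier H"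
begin

sublocale alpha: group_hom G H \<alpha>
  by unfold_locales (rule alpha_hom)
sublocale beta: group_hom G H \<beta>
  by unfold_locales (rule beta_hom)
sublocale p: group_hom H G p
  by unfold_locales (rule p_hom)
sublocale q: group_hom H G q
  by unfold_locales (rule q_hom)
sublocale mu: group_hom H G \<mu>
  by unfold_locales (rule mu_hom)

definition "D = {x \<in> carrier H. p x = \<one>\<^bsub>G\<^esub> \<and> q x = \<one>\<^bsub>G\<^esub>}"
definition "L = {x \<in> carrier H. \<mu> x = \<one>\<^bsub>G\<^esub>}"
definition "W = D \<inter> L"

definition "ell g = \<beta> g \<otimes> inv (\<alpha> g)"

abbreviation "com \<equiv> commutator_elem H"

text \<open>Inverses need no case of their own: the inverse of \<open>\<alpha> g\<close> is the
  image under \<alpha> of the inverse of g, and likewise for \<beta>.\<close>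

lemma induct_word [consumes 1, case_names one alpha beta]:
  assumes "x \<in> carrier H" and one: "P \<one>"
    and alpha: "\<And>g x. g \<in> carrier G \<Longrightarrow> x \<in> carrier H \<Longrightarrow> P x \<Longrightarrow> P (\<alpha> g \<otimes> x)"
    and beta: "\<And>g x. g \<in> carrier G \<Longrightarrow> x \<in> carrier H \<Longrightarrow> P x \<Longrightarrow> P (\<beta> g \<otimes> x)"
  shows "P x"
proof -
  have "\<forall>y\<in>carrier H. P y \<longrightarrow> P (x \<otimes> y)"
    using assms(1) unfolding generated[symmetric]
  proof (induction rule: generate.induct)
    case (inv h)
    then show ?case
      using alpha beta by (auto simp: generated simp flip: alpha.hom_inv beta.hom_inv)
  next
    case (eng h1 h2)
    then show ?case by (simp add: generated H.m_assoc)
  qed (use alpha beta in \<open>auto simp: generated\<close>)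
  from this[rule_format, of \<one>] show ?thesis
    using assms(1) one by simp
qed

text \<open>Both sides come from expanding the relation \<open>[gh, \<beta>(gh)] = 1\<close>.\<close>

lemma swap:
  assumes g: "g \<in> carrier G" and h: "h \<in> carrier G"
  shows "com (\<beta> g) (\<alpha> h) = com (\<alpha> g) (\<beta> h)"
proof -
  \<comment> \<open>The relation is expanded for the product of the inverse of g with h: after
    cancellation the left-hand side is then [\<beta> g, \<alpha> h] and the right-hand side
    [\<alpha> g, \<beta> h].\<close>
  define a a' b b' where "a = \<alpha> (inv\<^bsub>G\<^esub> g)" and "a' = \<beta> (inv\<^bsub>G\<^esub> g)" and "b = \<alpha> h" and "b' = \<beta> h"
  have c [simp]: "a \<in> carrier H" "a' \<in> carrier H" "b \<in> carrier H" "b' \<in> carrier H"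
    using g h by (auto simp: a_def a'_def b_def b'_def)
  have aa: "a \<otimes> a' = a' \<otimes> a" and bb: "b \<otimes> b' = b' \<otimes> b"
    unfolding a_def a'_def b_def b'_def using alpha_beta_commute g h by (meson G.inv_closed)+
  have "(a \<otimes> b) \<otimes> (a' \<otimes> b') = (a' \<otimes> b') \<otimes> (a \<otimes> b)"
    using alpha_beta_commute[of "inv\<^bsub>G\<^esub> g \<otimes>\<^bsub>G\<^esub> h"] g h
    by (simp add: a_def a'_def b_def b'_def del: alpha.hom_inv beta.hom_inv)
  moreover have "inv a' \<otimes> inv a = inv a \<otimes> inv a'" "inv b' \<otimes> inv b = inv b \<otimes> inv b'"
    using aa bb H.inv_mult_group c by metis+
  ultimately have "(inv a' \<otimes> inv a) \<otimes> ((a \<otimes> b) \<otimes> (a' \<otimes> b')) \<otimes> (inv b' \<otimes> inv b)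
      = (inv a \<otimes> inv a') \<otimes> ((a' \<otimes> b') \<otimes> (a \<otimes> b)) \<otimes> (inv b \<otimes> inv b')"
    by metis
  then have "inv a' \<otimes> b \<otimes> a' \<otimes> inv b = inv a \<otimes> b' \<otimes> a \<otimes> inv b'"
    by (simp add: H.m_assoc)
  then show ?thesis
    using g h by (simp add: commutator_elem_def a_def a'_def b_def b'_def)
qed

text \<open>Expanding \<open>[\<alpha>(gk), \<beta> h]\<close> and the equal commutator \<open>[\<beta>(gk), \<alpha> h]\<close> shows that \<open>\<alpha> g\<close> and
  \<open>\<beta> g\<close> act in the same way on the generators of \<open>D\<close>.\<close>

lemma conj_com:
  assumes "g \<in> carrier G" "k \<in> carrier G" "h \<in> carrier G"
  shows "\<alpha> g \<otimes> com (\<alpha> k) (\<beta> h) \<otimes> inv (\<alpha> g) = com (\<alpha> (g \<otimes>\<^bsub>G\<^esub> k)) (\<beta> h) \<otimes> inv (com (\<alpha> g) (\<beta> h))"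
    and "\<beta> g \<otimes> com (\<alpha> k) (\<beta> h) \<otimes> inv (\<beta> g) = com (\<alpha> (g \<otimes>\<^bsub>G\<^esub> k)) (\<beta> h) \<otimes> inv (com (\<alpha> g) (\<beta> h))"
proof -
  show "\<alpha> g \<otimes> com (\<alpha> k) (\<beta> h) \<otimes> inv (\<alpha> g) = com (\<alpha> (g \<otimes>\<^bsub>G\<^esub> k)) (\<beta> h) \<otimes> inv (com (\<alpha> g) (\<beta> h))"
    using assms by (simp add: commutator_elem_def H.m_assoc H.inv_mult_group)
  show "\<beta> g \<otimes> com (\<alpha> k) (\<beta> h) \<otimes> inv (\<beta> g) = com (\<alpha> (g \<otimes>\<^bsub>G\<^esub> k)) (\<beta> h) \<otimes> inv (com (\<alpha> g) (\<beta> h))"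
    unfolding swap[OF assms(2,3), symmetric] swap[OF assms(1,3), symmetric]
      swap[OF G.m_closed[OF assms(1,2)] assms(3), symmetric]
    using assms by (simp add: commutator_elem_def H.m_assoc H.inv_mult_group)
qed

lemma ell_closed [simp]: "g \<in> carrier G \<Longrightarrow> ell g \<in> carrier H"
  by (simp add: ell_def)

lemma ell_in_L: "g \<in> carrier G \<Longrightarrow> ell g \<in> L"
  by (simp add: ell_def L_def)

text \<open>A crossed homomorphism identity. It expresses conjugates of \<open>ell h\<close> by
  \<open>\<beta> g\<close> through further values of \<open>ell\<close>, and modulo L' it becomes
  the additive cocycle rule behind \<open>com_com_L\<close>.\<close>

lemma ell_mult:
  assumes "g \<in> carrier G" "h \<in> carrier G"
  shows "ell (g \<otimes>\<^bsub>G\<^esub> h) = \<beta> g \<otimes> ell h \<otimes> inv (\<beta> g) \<otimes> ell g"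
  using assms by (simp add: ell_def H.m_assoc H.inv_mult_group)

text \<open>By \<open>conj_com\<close> the elements \<open>\<alpha> g\<close> and
  \<open>\<beta> g\<close> conjugate [\<alpha> k, \<beta> h] in the same way, so their quotient
  \<open>ell g\<close> centralises it.\<close>

lemma ell_commute_com:
  assumes "g \<in> carrier G" "k \<in> carrier G" "h \<in> carrier G"
  shows "ell g \<otimes> com (\<alpha> k) (\<beta> h) = com (\<alpha> k) (\<beta> h) \<otimes> ell g"
proof -
  define c where "c = com (\<alpha> k) (\<beta> h)"
  have [simp]: "c \<in> carrier H"
    using assms by (simp add: c_def)
  have "inv (\<alpha> g) \<otimes> c \<otimes> \<alpha> g = inv (\<beta> g) \<otimes> c \<otimes> \<beta> g"
    using conj_com[of "inv\<^bsub>G\<^esub> g" k h] assms by (simp add: c_def)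
  then have "\<beta> g \<otimes> (inv (\<alpha> g) \<otimes> c \<otimes> \<alpha> g) \<otimes> inv (\<alpha> g) = \<beta> g \<otimes> (inv (\<beta> g) \<otimes> c \<otimes> \<beta> g) \<otimes> inv (\<alpha> g)"
    by simp
  then show ?thesis
    using assms by (simp add: ell_def H.m_assoc flip: c_def)
qed

lemma generators_inv_closed:
  "t \<in> \<alpha> ` carrier G \<union> \<beta> ` carrier G \<Longrightarrow> inv t \<in> \<alpha> ` carrier G \<union> \<beta> ` carrier G"
  by (auto simp flip: alpha.hom_inv beta.hom_inv)

text \<open>In both cases the generated subgroup N is normal and every x has a normal form modulo N:
  \<open>\<alpha> (\<mu> x)\<close> once \<open>\<alpha> g\<close> and \<open>\<beta> g\<close> are
  identified, and \<open>\<alpha> (p x) \<otimes> \<beta> (q x)\<close> once the two copies commute.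
  For x in the kernel the normal form is trivial, so x lies in N.\<close>

lemma L_eq_generate: "L = generate H (ell ` carrier G)"
  and D_eq_generate: "D = generate H {com (\<alpha> k) (\<beta> h) | k h. k \<in> carrier G \<and> h \<in> carrier G}"
proof -
  define N where "N = generate H (ell ` carrier G)"
  have ell_N: "ell g \<in> N" if "g \<in> carrier G" for g
    unfolding N_def using that by (auto intro: generate.incl)
  have subN: "subgroup N H"
    unfolding N_def by (rule H.generate_is_subgroup) auto
  have "N \<lhd> H"
    unfolding N_def
  proof (rule H.generate_normal[OF generated generators_inv_closed])
    fix t s
    assume t: "t \<in> \<alpha> ` carrier G \<union> \<beta> ` carrier G" and "s \<in> ell ` carrier G"
    then obtain h where h: "h \<in> carrier G" "s = ell h"
      by auto
    have beta_conj: "\<beta> g \<otimes> ell h \<otimes> inv (\<beta> g) \<in> N" if g: "g \<in> carrier G" for g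
    proof -
      have "\<beta> g \<otimes> ell h \<otimes> inv (\<beta> g) = ell (g \<otimes>\<^bsub>G\<^esub> h) \<otimes> inv (ell g)"
        using g h by (simp add: ell_mult H.m_assoc)
      then show ?thesis
        using g h subN ell_N by (simp add: subgroup.m_closed subgroup.m_inv_closed)
    qed
    have "\<alpha> g \<otimes> ell h \<otimes> inv (\<alpha> g) \<in> N" if g: "g \<in> carrier G" for g
    proof -
      have "\<alpha> g \<otimes> ell h \<otimes> inv (\<alpha> g) = inv (ell g) \<otimes> (\<beta> g \<otimes> ell h \<otimes> inv (\<beta> g)) \<otimes> ell g"
        using g h by (simp add: ell_def H.m_assoc H.inv_mult_group)
      then show ?thesis
        using g h subN ell_N beta_conj by (simp add: subgroup.m_closed subgroup.m_inv_closed)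
    qed
    then show "t \<otimes> s \<otimes> inv t \<in> generate H (ell ` carrier G)"
      using t h beta_conj by (auto simp: N_def)
  qed auto
  then have N_conj: "x \<otimes> y \<otimes> inv x \<in> N" if "x \<in> carrier H" "y \<in> N" for x y
    using H.subgroup_conj_closed that by blast
  note N_carrier = subgroup.mem_carrier[OF subN]
  have decomp: "\<exists>l\<in>N. x = l \<otimes> \<alpha> (\<mu> x)" if "x \<in> carrier H" for x
    using that
  proof (induction rule: induct_word)
    case one
    then show ?case by (intro bexI[of _ \<one>]) (auto simp: subgroup.one_closed[OF subN])
  next
    case (alpha g x)
    then obtain l where l: "l \<in> N" "x = l \<otimes> \<alpha> (\<mu> x)"
      by blast
    have "\<alpha> g \<otimes> x = (\<alpha> g \<otimes> l \<otimes> inv (\<alpha> g)) \<otimes> \<alpha> (\<mu> (\<alpha> g \<otimes> x))"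
      using alpha N_carrier[OF l(1)] by (subst l(2)) (simp add: H.m_assoc)
    then show ?case
      by (rule bexI) (rule N_conj[OF alpha.hom_closed[OF alpha(1)] l(1)])
  next
    case (beta g x)
    then obtain l where l: "l \<in> N" "x = l \<otimes> \<alpha> (\<mu> x)"
      by blast
    \<comment> \<open>Replacing \<open>\<beta> g\<close> by \<open>\<alpha> g\<close> in the normal
      form costs exactly the factor \<open>ell g\<close>.\<close>
    have "\<beta> g \<otimes> x = ((\<beta> g \<otimes> l \<otimes> inv (\<beta> g)) \<otimes> ell g) \<otimes> \<alpha> (\<mu> (\<beta> g \<otimes> x))"
      using beta N_carrier[OF l(1)] by (subst l(2)) (simp add: H.m_assoc ell_def)
    then show ?case
      by (rule bexI)
        (intro subgroup.m_closed[OF subN] N_conj[OF beta.hom_closed[OF beta(1)] l(1)] ell_N[OF beta(1)])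
  qed
  have "L \<subseteq> N"
    using decomp N_carrier by (fastforce simp: L_def)
  moreover have "N \<subseteq> L"
  proof -
    have "subgroup (kernel H G \<mu>) H"
      by (rule mu.subgroup_kernel)
    moreover have "ell ` carrier G \<subseteq> kernel H G \<mu>"
      by (auto simp: kernel_def ell_def)
    ultimately have "N \<subseteq> kernel H G \<mu>"
      unfolding N_def using H.generate_subgroup_incl by blast
    then show ?thesis
      by (simp add: L_def kernel_def)
  qed
  ultimately show "L = generate H (ell ` carrier G)"
    by (simp add: N_def)
next
  define S where "S = {com (\<alpha> k) (\<beta> h) | k h. k \<in> carrier G \<and> h \<in> carrier G}"
  define N where "N = generate H S"
  have S_carrier: "S \<subseteq> carrier H"
    by (auto simp: S_def)
  have com_N: "com (\<alpha> k) (\<beta> h) \<in> N" if "k \<in> carrier G" "h \<in> carrier G" for k h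
    unfolding N_def using that by (auto intro!: generate.incl simp: S_def)
  have subN: "subgroup N H"
    unfolding N_def using S_carrier by (rule H.generate_is_subgroup)
  have "N \<lhd> H"
    unfolding N_def
  proof (rule H.generate_normal[OF generated generators_inv_closed S_carrier])
    fix t s
    assume t: "t \<in> \<alpha> ` carrier G \<union> \<beta> ` carrier G" and "s \<in> S"
    then obtain k h where kh: "k \<in> carrier G" "h \<in> carrier G" "s = com (\<alpha> k) (\<beta> h)"
      by (auto simp: S_def)
    have "com (\<alpha> (g \<otimes>\<^bsub>G\<^esub> k)) (\<beta> h) \<otimes> inv (com (\<alpha> g) (\<beta> h)) \<in> N" if "g \<in> carrier G" for g
      by (rule subgroup.m_closed[OF subN com_N subgroup.m_inv_closed[OF subN com_N]])
        (use kh that in auto)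
    then show "t \<otimes> s \<otimes> inv t \<in> generate H S"
      using t kh conj_com by (fold N_def) auto
  qed
  then have N_conj: "x \<otimes> y \<otimes> inv x \<in> N" if "x \<in> carrier H" "y \<in> N" for x y
    using H.subgroup_conj_closed that by blast
  note N_carrier = subgroup.mem_carrier[OF subN]
  have decomp: "\<exists>d\<in>N. x = d \<otimes> (\<alpha> (p x) \<otimes> \<beta> (q x))" if "x \<in> carrier H" for x
    using that
  proof (induction rule: induct_word)
    case one
    then show ?case by (intro bexI[of _ \<one>]) (auto simp: subgroup.one_closed[OF subN])
  next
    case (alpha g x)
    then obtain d where d: "d \<in> N" "x = d \<otimes> (\<alpha> (p x) \<otimes> \<beta> (q x))"
      by blast
    have "\<alpha> g \<otimes> x = (\<alpha> g \<otimes> d \<otimes> inv (\<alpha> g)) \<otimes> (\<alpha> (p (\<alpha> g \<otimes> x)) \<otimes> \<beta> (q (\<alpha> g \<otimes> x)))"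
      using alpha N_carrier[OF d(1)] by (subst d(2)) (simp add: H.m_assoc)
    then show ?case
      by (rule bexI) (rule N_conj[OF alpha.hom_closed[OF alpha(1)] d(1)])
  next
    case (beta g x)
    then obtain d where d: "d \<in> N" "x = d \<otimes> (\<alpha> (p x) \<otimes> \<beta> (q x))"
      by blast
    have "\<beta> g \<otimes> x = ((\<beta> g \<otimes> d \<otimes> inv (\<beta> g)) \<otimes> com (\<beta> g) (\<alpha> (p x)))
        \<otimes> (\<alpha> (p (\<beta> g \<otimes> x)) \<otimes> \<beta> (q (\<beta> g \<otimes> x)))"
      using beta N_carrier[OF d(1)]
      by (subst d(2)) (simp add: H.m_assoc commutator_elem_def)
    \<comment> \<open>Moving \<open>\<beta> g\<close> past \<open>\<alpha> (p x)\<close> costs a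
      commutator with the copies in the wrong order; \<open>swap\<close> turns it into one of the
      generators.\<close>
    moreover have "com (\<beta> g) (\<alpha> (p x)) \<in> N"
      using swap beta com_N by simp
    then have "(\<beta> g \<otimes> d \<otimes> inv (\<beta> g)) \<otimes> com (\<beta> g) (\<alpha> (p x)) \<in> N"
      by (rule subgroup.m_closed[OF subN N_conj[OF beta.hom_closed[OF beta(1)] d(1)]])
    ultimately show ?case
      by (rule bexI)
  qed
  have "D \<subseteq> N"
    using decomp N_carrier by (fastforce simp: D_def)
  moreover have "N \<subseteq> D"
  proof -
    have "subgroup (kernel H G p \<inter> kernel H G q) H"
      by (intro H.subgroups_Inter_pair p.subgroup_kernel q.subgroup_kernel)
    moreover have "S \<subseteq> kernel H G p \<inter> kernel H G q"
      by (auto simp: kernel_def S_def commutator_elem_def)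
    ultimately have "N \<subseteq> kernel H G p \<inter> kernel H G q"
      unfolding N_def using H.generate_subgroup_incl by blast
    then show ?thesis
      by (auto simp add: D_def kernel_def)
  qed
  ultimately show "D = generate H {com (\<alpha> k) (\<beta> h) | k h. k \<in> carrier G \<and> h \<in> carrier G}"
    by (simp add: N_def S_def)
qed

text \<open>Sidki's theorem: the generating sets found above commute elementwise by
  \<open>ell_commute_com\<close>.\<close>

lemma D_L_commute:
  assumes "d \<in> D" "l \<in> L"
  shows "d \<otimes> l = l \<otimes> d"
proof -
  have "l \<otimes> d = d \<otimes> l"
    by (rule H.generate_commute[OF _ _ _ assms(2)[unfolded L_eq_generate] assms(1)[unfolded D_eq_generate]])
      (auto simp: ell_commute_com)
  then show ?thesis ..
qed

end

text \<open>In additive notation, with \<open>S\<close> and \<open>T\<close> the actions of \<open>g\<close> and \<open>h\<close> on \<open>L/L'\<close> and \<open>u, v\<close> the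
  classes of \<open>\<beta> g \<alpha> g\<^sup>-\<^sup>1\<close> and \<open>\<beta> h \<alpha> h\<^sup>-\<^sup>1\<close>: the class \<open>S v + u\<close> belongs to \<open>gh\<close>, so it is fixed by
  \<open>S T\<close>, which gives \<open>S (S - 1) v = - (T - 1) u\<close>, and \<open>S - 1\<close> kills the right-hand side.\<close>

lemma (in comm_group) square_zero_aux:
  assumes S: "S \<in> hom G G" and T: "T \<in> hom G G" and inj: "inj_on S (carrier G)"
    and ST: "\<And>w. w \<in> carrier G \<Longrightarrow> S (T w) = T (S w)"
    and u: "u \<in> carrier G" "S u = u" and v: "v \<in> carrier G" "T v = v"
    and uv: "S (T (S v \<otimes> u)) = S v \<otimes> u"
  shows "S (S v) \<otimes> v = S v \<otimes> S v"
proof -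
  have [simp]: "S w \<in> carrier G" "T w \<in> carrier G" if "w \<in> carrier G" for w
    using S T that by (auto simp: hom_in_carrier)
  have mult: "S (w \<otimes> w') = S w \<otimes> S w'" "T (w \<otimes> w') = T w \<otimes> T w'"
    if "w \<in> carrier G" "w' \<in> carrier G" for w w'
    using S T that by (auto simp: hom_mult)
  have STu: "S (T u) = T u" and STSv: "S (T (S v)) = S (S v)"
    using ST[OF u(1)] ST[OF v(1)] u(2) v(2) by simp_all
  have 1: "S (S v) \<otimes> T u = S v \<otimes> u"
    using uv u v by (simp add: mult STu STSv)
  then have 2: "S (S (S v)) \<otimes> T u = S (S v) \<otimes> u"
  proof -
    have "S (S (S v) \<otimes> T u) = S (S v \<otimes> u)"
      by (simp only: 1)
    then show ?thesis
      using u v by (simp add: mult STu)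
  qed
  have "(S (S (S v)) \<otimes> S v) \<otimes> (T u \<otimes> u) = (S (S (S v)) \<otimes> T u) \<otimes> (S v \<otimes> u)"
    using u(1) v(1) by (simp add: m_ac)
  also have "\<dots> = (S (S v) \<otimes> u) \<otimes> (S (S v) \<otimes> T u)"
    by (simp only: 1 2)
  also have "\<dots> = (S (S v) \<otimes> S (S v)) \<otimes> (T u \<otimes> u)"
    using u(1) v(1) by (simp add: m_ac)
  finally have "S (S (S v) \<otimes> v) = S (S v \<otimes> S v)"
    using u(1) v(1) by (simp add: mult)
  then show ?thesis
    using inj v(1) by (simp add: inj_on_eq_iff)
qed

section \<open>Commutator identities and derived subgroups\<close>

context group
begin

lemma commutator_mult_left:
  "\<lbrakk>x \<in> carrier G; y \<in> carrier G; z \<in> carrier G\<rbrakk> \<Longrightarrow>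
    commutator_elem G (x \<otimes> y) z = x \<otimes> commutator_elem G y z \<otimes> inv x \<otimes> commutator_elem G x z"
  by (simp add: commutator_elem_def m_assoc inv_mult_group)

lemma commutator_mult_right:
  "\<lbrakk>x \<in> carrier G; y \<in> carrier G; z \<in> carrier G\<rbrakk> \<Longrightarrow>
    commutator_elem G x (y \<otimes> z) = commutator_elem G x y \<otimes> (y \<otimes> commutator_elem G x z \<otimes> inv y)"
  by (simp add: commutator_elem_def m_assoc inv_mult_group)

lemma commutator_conj:
  "\<lbrakk>x \<in> carrier G; y \<in> carrier G; z \<in> carrier G\<rbrakk> \<Longrightarrow>
    x \<otimes> commutator_elem G y z \<otimes> inv x = commutator_elem G (x \<otimes> y \<otimes> inv x) (x \<otimes> z \<otimes> inv x)"
  by (simp add: commutator_elem_def m_assoc inv_mult_group)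

lemma inv_commutator:
  "\<lbrakk>x \<in> carrier G; y \<in> carrier G\<rbrakk> \<Longrightarrow> inv (commutator_elem G x y) = commutator_elem G y x"
  by (simp add: commutator_elem_def m_assoc inv_mult_group)

lemma commutator_inv_left:
  "\<lbrakk>x \<in> carrier G; y \<in> carrier G\<rbrakk> \<Longrightarrow>
    commutator_elem G (inv x) y = inv x \<otimes> commutator_elem G y x \<otimes> x"
  by (simp add: commutator_elem_def m_assoc inv_mult_group)

lemma commutator_inv_right:
  "\<lbrakk>x \<in> carrier G; y \<in> carrier G\<rbrakk> \<Longrightarrow>
    commutator_elem G x (inv y) = inv y \<otimes> commutator_elem G y x \<otimes> y"
  by (simp add: commutator_elem_def m_assoc inv_mult_group)

lemma conj_eq_commutator_mult:
  "\<lbrakk>x \<in> carrier G; y \<in> carrier G\<rbrakk> \<Longrightarrow> x \<otimes> y \<otimes> inv x = commutator_elem G x y \<otimes> y"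
  by (simp add: commutator_elem_def m_assoc)

lemma commutator_eq_one:
  "\<lbrakk>x \<in> carrier G; y \<in> carrier G; x \<otimes> y = y \<otimes> x\<rbrakk> \<Longrightarrow> commutator_elem G x y = \<one>"
  by (simp add: commutator_eq_one_iff)

lemma commutator_in_derived:
  "\<lbrakk>x \<in> N; y \<in> N\<rbrakk> \<Longrightarrow> commutator_elem G x y \<in> derived G N"
  unfolding derived_def commutator_elem_def by (rule generate.incl) blast

text \<open>No case for inverses arises, because the inverse of [x, y] is [y, x].\<close>

lemma derived_induct [consumes 2, case_names one commutator mult]:
  assumes "y \<in> derived G N" "N \<lhd> G" "P \<one>"
    and comm: "\<And>x y. x \<in> N \<Longrightarrow> y \<in> N \<Longrightarrow> P (commutator_elem G x y)"
    and "\<And>x y. x \<in> derived G N \<Longrightarrow> y \<in> derived G N \<Longrightarrow> P x \<Longrightarrow> P y \<Longrightarrow> P (x \<otimes> y)"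
  shows "P y"
  using assms(1) unfolding derived_def
proof (induction rule: generate.induct)
  case (incl h)
  then show ?case
    using comm by (auto simp: commutator_elem_def)
next
  case (inv h)
  then obtain x y where xy: "x \<in> N" "y \<in> N" "h = commutator_elem G x y"
    by (auto simp: commutator_elem_def)
  then have "inv h = commutator_elem G y x"
    using inv_commutator normal_imp_subgroup[OF assms(2)] subgroup.mem_carrier by metis
  then show ?case
    using comm xy by simp
qed (use assms in \<open>auto simp: derived_def\<close>)

lemma commutator_normal_closed:
  assumes "N \<lhd> G" "x \<in> carrier G" "y \<in> N"
  shows "commutator_elem G x y \<in> N" "commutator_elem G y x \<in> N"
proof -
  have N: "subgroup N G" and y: "y \<in> carrier G"
    using assms normal_imp_subgroup subgroup.mem_carrier by metis+
  show "commutator_elem G x y \<in> N"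
    unfolding commutator_elem_def
    by (rule subgroup.m_closed[OF N subgroup_conj_closed[OF assms] subgroup.m_inv_closed[OF N assms(3)]])
  then have "inv (commutator_elem G x y) \<in> N"
    by (rule subgroup.m_inv_closed[OF N])
  then show "commutator_elem G y x \<in> N"
    using y assms(2) by (simp add: inv_commutator)
qed

end

section \<open>Conjugation on L and W, and the subgroups A, B and [A, B]\<close>

context weakly_commuting
begin

abbreviation "G' \<equiv> derived G (carrier G)"
abbreviation "L' \<equiv> derived H L"

text \<open>Exchanging the copies fixes \<mu> and swaps p with q, hence A with B; together with
  \<open>flipped_simps\<close> it turns results about A into results about B.\<close>

lemma flipped: "weakly_commuting H G \<beta> \<alpha> q p \<mu>"
  by unfold_locales
    (simp_all add: alpha_hom beta_hom p_hom q_hom mu_hom alpha_beta_commute generated Un_commute)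

lemma L_normal: "L \<lhd> H" and D_normal: "D \<lhd> H"
proof -
  have "L = kernel H G \<mu>" "D = kernel H G p \<inter> kernel H G q"
    by (auto simp: L_def D_def kernel_def)
  then show "L \<lhd> H" "D \<lhd> H"
    using mu.normal_kernel p.normal_kernel q.normal_kernel H.normal_subgroup_intersect by auto
qed

lemma W_normal: "W \<lhd> H"
  unfolding W_def using D_normal L_normal by (rule H.normal_subgroup_intersect)

lemma L'_normal: "L' \<lhd> H"
  using L_normal by (rule H.derived_is_normal)

lemmas L_subgroup = normal_imp_subgroup[OF L_normal]
lemmas D_subgroup = normal_imp_subgroup[OF D_normal]
lemmas W_subgroup = normal_imp_subgroup[OF W_normal]
lemmas L'_subgroup = normal_imp_subgroup[OF L'_normal]

lemma L_carrier [simp]: "x \<in> L \<Longrightarrow> x \<in> carrier H"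
  and W_carrier [simp]: "x \<in> W \<Longrightarrow> x \<in> carrier H"
  and D_carrier [simp]: "x \<in> D \<Longrightarrow> x \<in> carrier H"
  by (auto simp: L_def W_def D_def)

lemmas carriers = L_carrier W_carrier D_carrier

lemma L'_subset_L: "L' \<subseteq> L"
  using L_subgroup by (intro H.derived_incl) auto

lemma W_L_commute: "w \<in> W \<Longrightarrow> l \<in> L \<Longrightarrow> w \<otimes> l = l \<otimes> w"
  using D_L_commute by (auto simp: W_def)

lemma W_conj_L: "w \<in> W \<Longrightarrow> l \<in> L \<Longrightarrow> l \<otimes> w \<otimes> inv l = w"
  using W_L_commute[of w l, symmetric] by (simp add: H.m_assoc)

lemma G'_normal: "G' \<lhd> G"
  by (rule G.derived_self_is_normal)

lemmas G'_subgroup = normal_imp_subgroup[OF G'_normal]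

lemma G'_carrier [simp]: "c \<in> G' \<Longrightarrow> c \<in> carrier G"
  by (rule subgroup.mem_carrier[OF G'_subgroup])

text \<open>The preimage of G' under \<mu> is DL, since [\<alpha> g, \<beta> h] lies in D and \<mu>
  maps it to [g, h]. This is the identification of the quotient by DL with Q.\<close>

lemma factor_D_L:
  assumes x: "x \<in> carrier H" "\<mu> x \<in> G'"
  obtains d l where "d \<in> D" "l \<in> L" "x = d \<otimes> l"
proof -
  have "\<exists>d\<in>D. \<mu> d = c" if "c \<in> G'" for c
    using that G.normal_self
  proof (induction rule: G.derived_induct)
    case one
    then show ?case using subgroup.one_closed[OF D_subgroup] by force
  next
    case (commutator g h)
    then show ?case
      by (intro bexI[of _ "com (\<alpha> g) (\<beta> h)"]) (auto simp: D_def commutator_elem_def simp del: carriers)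
  next
    case (mult g h)
    then show ?case
      by (metis D_carrier D_subgroup mu.hom_mult subgroup.m_closed)
  qed
  then obtain d where d: "d \<in> D" "\<mu> d = \<mu> x"
    using x by blast
  have [simp]: "d \<in> carrier H"
    using d by simp
  show thesis
  proof
    show "d \<in> D" by fact
    show "x = d \<otimes> (inv d \<otimes> x)"
      using x by simp
    show "inv d \<otimes> x \<in> L"
      unfolding L_def using d x by simp
  qed
qed

text \<open>In the factorisation x = d l the factor d does nothing, because D centralises L. It
  follows that such an x acts trivially on L/L' and on W, which is central in L.\<close>

lemma conj_L_eq:
  assumes "x \<in> carrier H" "\<mu> x \<in> G'"
  obtains l where "l \<in> L" "\<And>y. y \<in> L \<Longrightarrow> x \<otimes> y \<otimes> inv x = l \<otimes> y \<otimes> inv l"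
proof -
  obtain d l where dl: "d \<in> D" "l \<in> L" "x = d \<otimes> l"
    using factor_D_L assms .
  show thesis
  proof
    show "l \<in> L" by fact
    fix y assume y: "y \<in> L"
    have "l \<otimes> y \<otimes> inv l \<in> L"
      using H.subgroup_conj_closed[OF L_normal] dl y by simp
    then have "d \<otimes> (l \<otimes> y \<otimes> inv l) = (l \<otimes> y \<otimes> inv l) \<otimes> d"
      using D_L_commute dl by blast
    then have "d \<otimes> (l \<otimes> y \<otimes> inv l) \<otimes> inv d = (l \<otimes> y \<otimes> inv l) \<otimes> d \<otimes> inv d"
      by simp
    then show "x \<otimes> y \<otimes> inv x = l \<otimes> y \<otimes> inv l"
      using dl y by (simp add: H.m_assoc H.inv_mult_group)
  qed
qed

lemma conj_W_eq:
  assumes "x \<in> carrier H" "\<mu> x \<in> G'" "w \<in> W"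
  shows "x \<otimes> w \<otimes> inv x = w"
  using conj_L_eq[OF assms(1,2)] assms(3) W_conj_L by (metis IntD2 W_def)

text \<open>\<open>x \<otimes> inv y\<close> acts trivially by \<open>conj_W_eq\<close>; this makes
  the action of Q on W well defined.\<close>

lemma conj_W_cong:
  assumes "x \<in> carrier H" "y \<in> carrier H" "\<mu> x \<otimes>\<^bsub>G\<^esub> inv\<^bsub>G\<^esub> (\<mu> y) \<in> G'" "w \<in> W"
  shows "x \<otimes> w \<otimes> inv x = y \<otimes> w \<otimes> inv y"
proof -
  have "(x \<otimes> inv y) \<otimes> (y \<otimes> w \<otimes> inv y) \<otimes> inv (x \<otimes> inv y) = y \<otimes> w \<otimes> inv y"
    using assms H.subgroup_conj_closed[OF W_normal] by (intro conj_W_eq) auto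
  then show ?thesis
    using assms by (simp add: H.m_assoc H.inv_mult_group)
qed

lemma com_L_in_L':
  assumes "x \<in> carrier H" "\<mu> x \<in> G'" "y \<in> L"
  shows "com x y \<in> L'"
proof -
  obtain l where l: "l \<in> L" "x \<otimes> y \<otimes> inv x = l \<otimes> y \<otimes> inv l"
    using conj_L_eq[OF assms(1,2)] assms(3) by metis
  then have "com x y = com l y"
    by (simp add: commutator_elem_def)
  then show ?thesis
    using H.commutator_in_derived l assms(3) by simp
qed

text \<open>After abelianising G, the product of p and q agrees with \<mu> on both copies. On L the
  values of p and q are therefore inverse to each other modulo G', which forces p(A) and q(B) into
  G'.\<close>

lemma p_q_mu: "x \<in> carrier H \<Longrightarrow> p x \<otimes>\<^bsub>G\<^esub> q x \<otimes>\<^bsub>G\<^esub> inv\<^bsub>G\<^esub> (\<mu> x) \<in> G'"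
proof (induction rule: induct_word)
  case one
  then show ?case by (simp add: subgroup.one_closed[OF G'_subgroup])
next
  case (alpha g x)
  then have "g \<otimes>\<^bsub>G\<^esub> (p x \<otimes>\<^bsub>G\<^esub> q x \<otimes>\<^bsub>G\<^esub> inv\<^bsub>G\<^esub> (\<mu> x)) \<otimes>\<^bsub>G\<^esub> inv\<^bsub>G\<^esub> g \<in> G'"
    using G.subgroup_conj_closed[OF G'_normal] by blast
  then show ?case
    using alpha by (simp add: G.m_assoc G.inv_mult_group)
next
  case (beta g x)
  then have "commutator_elem G (p x) g \<otimes>\<^bsub>G\<^esub>
      (g \<otimes>\<^bsub>G\<^esub> (p x \<otimes>\<^bsub>G\<^esub> q x \<otimes>\<^bsub>G\<^esub> inv\<^bsub>G\<^esub> (\<mu> x)) \<otimes>\<^bsub>G\<^esub> inv\<^bsub>G\<^esub> g) \<in> G'"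
    by (intro subgroup.m_closed[OF G'_subgroup G.commutator_in_derived G.subgroup_conj_closed[OF G'_normal]]) auto
  then show ?case
    using beta by (simp add: G.m_assoc G.inv_mult_group commutator_elem_def)
qed

definition "A = {x \<in> L. q x = \<one>\<^bsub>G\<^esub>}"
definition "B = {x \<in> L. p x = \<one>\<^bsub>G\<^esub>}"

lemma flipped_simps:
  "weakly_commuting.D H G q p = D"
  "weakly_commuting.W H G q p \<mu> = W"
  "weakly_commuting.A H G p \<mu> = B" "weakly_commuting.B H G q \<mu> = A"
  by (auto simp: weakly_commuting.A_def[OF flipped] weakly_commuting.B_def[OF flipped]
      weakly_commuting.W_def[OF flipped] weakly_commuting.L_def[OF flipped]
      weakly_commuting.D_def[OF flipped] A_def B_def W_def L_def D_def simp del: carriers)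

lemma A_normal: "A \<lhd> H"
proof -
  have "A = L \<inter> kernel H G q"
    by (auto simp: A_def L_def kernel_def simp del: carriers)
  then show ?thesis
    using L_normal q.normal_kernel H.normal_subgroup_intersect by auto
qed

lemmas B_normal = weakly_commuting.A_normal[OF flipped, unfolded flipped_simps]
lemmas A_subgroup = normal_imp_subgroup[OF A_normal]
lemmas B_subgroup = normal_imp_subgroup[OF B_normal]

lemma A_in_L [simp]: "a \<in> A \<Longrightarrow> a \<in> L" and B_in_L [simp]: "a \<in> B \<Longrightarrow> a \<in> L"
  and q_A [simp]: "a \<in> A \<Longrightarrow> q a = \<one>\<^bsub>G\<^esub>" and p_B [simp]: "a \<in> B \<Longrightarrow> p a = \<one>\<^bsub>G\<^esub>"
  and mu_L [simp]: "a \<in> L \<Longrightarrow> \<mu> a = \<one>\<^bsub>G\<^esub>"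
  by (auto simp: A_def B_def L_def simp del: carriers)

lemma W_iff: "w \<in> W \<longleftrightarrow> w \<in> L \<and> p w = \<one>\<^bsub>G\<^esub> \<and> q w = \<one>\<^bsub>G\<^esub>"
  unfolding W_def D_def using L_carrier by auto

lemma A_I: "\<lbrakk>x \<in> carrier H; \<mu> x = \<one>\<^bsub>G\<^esub>; q x = \<one>\<^bsub>G\<^esub>\<rbrakk> \<Longrightarrow> x \<in> A"
  and B_I: "\<lbrakk>x \<in> carrier H; \<mu> x = \<one>\<^bsub>G\<^esub>; p x = \<one>\<^bsub>G\<^esub>\<rbrakk> \<Longrightarrow> x \<in> B"
  and W_I: "\<lbrakk>x \<in> carrier H; \<mu> x = \<one>\<^bsub>G\<^esub>; p x = \<one>\<^bsub>G\<^esub>; q x = \<one>\<^bsub>G\<^esub>\<rbrakk> \<Longrightarrow> x \<in> W"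
  unfolding A_def B_def W_def L_def D_def by blast+

lemma p_A: "p ` A = G'"
proof
  show "p ` A \<subseteq> G'"
  proof clarify
    fix a assume "a \<in> A"
    then show "p a \<in> G'"
      using p_q_mu[of a] by simp
  qed
  show "G' \<subseteq> p ` A"
  proof
    fix c assume "c \<in> G'"
    then show "c \<in> p ` A"
      using G.normal_self
    proof (induction rule: G.derived_induct)
      case one
      then show ?case
        using subgroup.one_closed[OF A_subgroup] by force
    next
      case (commutator g h)
      \<comment> \<open>\<mu> kills \<open>ell g\<close> and q kills \<open>\<alpha> h\<close>, so
        this commutator lies in A; the inverse appears because \<open>p (ell g)\<close> is the
        inverse of g.\<close>
      have "com (inv (ell g)) (\<alpha> h) \<in> A"
        using commutator by (intro A_I) (simp_all add: commutator_elem_def ell_def)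
      moreover have "p (com (inv (ell g)) (\<alpha> h)) = commutator_elem G g h"
        using commutator by (simp add: commutator_elem_def ell_def)
      ultimately show ?case by force
    next
      case (mult g h)
      then obtain a b where "a \<in> A" "b \<in> A" "p a = g" "p b = h"
        by auto
      then show ?case
        using subgroup.m_closed[OF A_subgroup, of a b] by (force intro!: image_eqI[of _ _ "a \<otimes> b"])
    qed
  qed
qed

lemmas q_B = weakly_commuting.p_A[OF flipped, unfolded flipped_simps]

text \<open>\<mu> kills both entries, p kills b and q kills a.\<close>

lemma com_A_B_in_W: "a \<in> A \<Longrightarrow> b \<in> B \<Longrightarrow> com a b \<in> W"
  by (intro W_I) (simp_all add: commutator_elem_def)

definition "W\<^sub>0 = generate H {com a b | a b. a \<in> A \<and> b \<in> B}"

lemma com_A_B_in_W0: "a \<in> A \<Longrightarrow> b \<in> B \<Longrightarrow> com a b \<in> W\<^sub>0"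
  unfolding W\<^sub>0_def by (rule generate.incl) blast

lemma W0_subset_W: "W\<^sub>0 \<subseteq> W"
  unfolding W\<^sub>0_def using com_A_B_in_W by (intro H.generate_subgroup_incl[OF _ W_subgroup]) auto

lemma W0_normal: "W\<^sub>0 \<lhd> H"
  unfolding W\<^sub>0_def
proof (rule H.normal_generateI)
  fix h x assume "h \<in> {com a b | a b. a \<in> A \<and> b \<in> B}" and x: "x \<in> carrier H"
  then obtain a b where ab: "h = com a b" "a \<in> A" "b \<in> B"
    by blast
  have "x \<otimes> h \<otimes> inv x = com (x \<otimes> a \<otimes> inv x) (x \<otimes> b \<otimes> inv x)"
    using ab x by (simp add: H.commutator_conj)
  then show "x \<otimes> h \<otimes> inv x \<in> {com a b | a b. a \<in> A \<and> b \<in> B}"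
    using ab x H.subgroup_conj_closed A_normal B_normal by blast
qed auto

lemmas W0_subgroup = normal_imp_subgroup[OF W0_normal]

text \<open>The generators for the exchanged copies are the commutators [b, a], the inverses of the
  original ones.\<close>

lemma flipped_W0: "weakly_commuting.W\<^sub>0 H G q p \<mu> = W\<^sub>0"
proof -
  have *: "weakly_commuting.W\<^sub>0 H G q p \<mu> = generate H {com b a | a b. a \<in> A \<and> b \<in> B}"
    unfolding weakly_commuting.W\<^sub>0_def[OF flipped] flipped_simps
    by (rule arg_cong[of _ _ "generate H"]) blast
  have "com b a \<in> W\<^sub>0" if "a \<in> A" "b \<in> B" for a b
    using subgroup.m_inv_closed[OF W0_subgroup com_A_B_in_W0[OF that]] that
    by (simp add: H.inv_commutator)
  then have "weakly_commuting.W\<^sub>0 H G q p \<mu> \<subseteq> W\<^sub>0"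
    unfolding * by (intro H.generate_subgroup_incl[OF _ W0_subgroup]) auto
  moreover have "com a b \<in> weakly_commuting.W\<^sub>0 H G q p \<mu>" if "a \<in> A" "b \<in> B" for a b
  proof -
    have "com b a \<in> weakly_commuting.W\<^sub>0 H G q p \<mu>"
      unfolding * using that by (intro generate.incl) blast
    then show ?thesis
      using subgroup.m_inv_closed[OF weakly_commuting.W0_subgroup[OF flipped], of "com b a"] that
      by (simp add: H.inv_commutator)
  qed
  then have "W\<^sub>0 \<subseteq> weakly_commuting.W\<^sub>0 H G q p \<mu>"
    unfolding W\<^sub>0_def by (intro H.generate_subgroup_incl[OF _ weakly_commuting.W0_subgroup[OF flipped]]) auto
  ultimately show ?thesis by blast
qed

lemma W0_in_L [simp]: "w \<in> W\<^sub>0 \<Longrightarrow> w \<in> L"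
  and W0_in_A: "w \<in> W\<^sub>0 \<Longrightarrow> w \<in> A"
  and W0_in_W: "w \<in> W\<^sub>0 \<Longrightarrow> w \<in> W"
  unfolding A_def using W0_subset_W by (auto simp: W_iff)

section \<open>The commutator pairing\<close>

lemma conj_W_closed: "x \<in> carrier H \<Longrightarrow> w \<in> W \<Longrightarrow> x \<otimes> w \<otimes> inv x \<in> W"
  using H.subgroup_conj_closed[OF W_normal] .

lemma conj_W_alpha_beta:
  assumes "g \<in> carrier G" "w \<in> W"
  shows "\<alpha> g \<otimes> w \<otimes> inv (\<alpha> g) = \<beta> g \<otimes> w \<otimes> inv (\<beta> g)"
  using assms by (intro conj_W_cong) (auto simp: subgroup.one_closed[OF G'_subgroup])

lemma com_W_alpha_beta:
  assumes "g \<in> carrier G" "w \<in> W"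
  shows "com (\<alpha> g) w = com (\<beta> g) w"
  using conj_W_alpha_beta[OF assms] by (simp add: commutator_elem_def)

text \<open>The values lie in W and are central in L, so the conjugation in the product formula
  disappears and the two factors may be exchanged.\<close>

lemma com_A_mult:
  assumes "a \<in> A" "a' \<in> A" "b \<in> B"
  shows "com (a \<otimes> a') b = com a b \<otimes> com a' b"
proof -
  have "com (a \<otimes> a') b = com a' b \<otimes> com a b"
    using assms W_conj_L[OF com_A_B_in_W, of a' b a] by (simp add: H.commutator_mult_left)
  also have "\<dots> = com a b \<otimes> com a' b"
    using assms com_A_B_in_W W_L_commute by (simp add: W_iff)
  finally show ?thesis .
qed

lemma com_B_mult:
  assumes "a \<in> A" "b \<in> B" "b' \<in> B"
  shows "com a (b \<otimes> b') = com a b \<otimes> com a b'"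
  using assms W_conj_L[OF com_A_B_in_W, of a b' b] by (simp add: H.commutator_mult_right)

lemma A_eq_mult_W:
  assumes "a \<in> A" "a' \<in> A" "p a = p a'"
  obtains w where "w \<in> W" "a' = a \<otimes> w"
proof
  show "a' = a \<otimes> (inv a \<otimes> a')"
    using assms by simp
  show "inv a \<otimes> a' \<in> W"
    using assms by (intro W_I) auto
qed

lemma com_W_L: "w \<in> W \<Longrightarrow> l \<in> L \<Longrightarrow> com w l = \<one>"
  by (simp add: H.commutator_eq_one_iff W_L_commute)

text \<open>Elements of A with the same image under p differ by an element of W, which all of L
  centralises. That l ranges over L and not only over B matters for
  \<open>com_A_L_in_K\<close>.\<close>

lemma com_A_cong:
  assumes "a \<in> A" "a' \<in> A" "p a = p a'" "l \<in> L"
  shows "com a l = com a' l"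
proof -
  obtain w where "w \<in> W" "a' = a \<otimes> w"
    using A_eq_mult_W assms(1-3) .
  then show ?thesis
    using assms com_W_L by (simp add: H.commutator_mult_left)
qed

lemma com_B_cong:
  assumes "b \<in> B" "b' \<in> B" "q b = q b'" "l \<in> L"
  shows "com l b = com l b'"
proof -
  have "com b l = com b' l"
    using weakly_commuting.com_A_cong[OF flipped, unfolded flipped_simps] assms by blast
  then have "inv (com b l) = inv (com b' l)"
    by simp
  then show ?thesis
    using assms by (simp add: H.inv_commutator)
qed

text \<open>Any lifts to A and B serve, as \<open>com_A_cong\<close> and \<open>com_B_cong\<close>
  make the commutator independent of them. The arguments are still elements of G'; the passage to
  G'/G'' follows later from W being abelian.\<close>

definition "pairing c d = com (SOME a. a \<in> A \<and> p a = c) (SOME b. b \<in> B \<and> q b = d)"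

lemma pairing_eq:
  assumes "a \<in> A" "b \<in> B"
  shows "pairing (p a) (q b) = com a b"
proof -
  define a' b' where "a' = (SOME x. x \<in> A \<and> p x = p a)" and "b' = (SOME x. x \<in> B \<and> q x = q b)"
  have "a' \<in> A \<and> p a' = p a" "b' \<in> B \<and> q b' = q b"
    unfolding a'_def b'_def by (rule someI, use assms in blast)+
  then show ?thesis
    using com_A_cong[of a a' b'] com_B_cong[of b b' a] assms
    by (simp add: pairing_def flip: a'_def b'_def)
qed

lemma obtain_A:
  assumes "c \<in> G'" obtains a where "a \<in> A" "p a = c"
  using assms p_A by (metis imageE)

lemma obtain_B:
  assumes "c \<in> G'" obtains b where "b \<in> B" "q b = c"
  using assms q_B by (metis imageE)

lemma pairing_in_W: "c \<in> G' \<Longrightarrow> d \<in> G' \<Longrightarrow> pairing c d \<in> W"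
  by (metis obtain_A obtain_B pairing_eq com_A_B_in_W)

lemma pairing_mult_left:
  assumes "c \<in> G'" "c' \<in> G'" "d \<in> G'"
  shows "pairing (c \<otimes>\<^bsub>G\<^esub> c') d = pairing c d \<otimes> pairing c' d"
proof -
  obtain a a' b where ab: "a \<in> A" "p a = c" "a' \<in> A" "p a' = c'" "b \<in> B" "q b = d"
    using obtain_A obtain_B assms by metis
  have "a \<otimes> a' \<in> A" "p (a \<otimes> a') = c \<otimes>\<^bsub>G\<^esub> c'"
    using ab subgroup.m_closed[OF A_subgroup] by auto
  then show ?thesis
    using ab pairing_eq com_A_mult by metis
qed

lemma pairing_mult_right:
  assumes "c \<in> G'" "d \<in> G'" "d' \<in> G'"
  shows "pairing c (d \<otimes>\<^bsub>G\<^esub> d') = pairing c d \<otimes> pairing c d'"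
proof -
  obtain a b b' where ab: "a \<in> A" "p a = c" "b \<in> B" "q b = d" "b' \<in> B" "q b' = d'"
    using obtain_A obtain_B assms by metis
  have "b \<otimes> b' \<in> B" "q (b \<otimes> b') = d \<otimes>\<^bsub>G\<^esub> d'"
    using ab subgroup.m_closed[OF B_subgroup] by auto
  then show ?thesis
    using ab pairing_eq com_B_mult by metis
qed

text \<open>q kills \<open>\<alpha> g\<close>, so conjugating both lifts by
  \<open>\<alpha> g\<close> gives lifts of the conjugated first and of the unchanged second
  argument.\<close>

lemma pairing_conj_left:
  assumes "g \<in> carrier G" "c \<in> G'" "d \<in> G'"
  shows "pairing (g \<otimes>\<^bsub>G\<^esub> c \<otimes>\<^bsub>G\<^esub> inv\<^bsub>G\<^esub> g) d = \<alpha> g \<otimes> pairing c d \<otimes> inv (\<alpha> g)"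
proof -
  obtain a b where ab: "a \<in> A" "p a = c" "b \<in> B" "q b = d"
    using obtain_A obtain_B assms by metis
  have "\<alpha> g \<otimes> a \<otimes> inv (\<alpha> g) \<in> A" "\<alpha> g \<otimes> b \<otimes> inv (\<alpha> g) \<in> B"
    using H.subgroup_conj_closed[OF A_normal _ ab(1)] H.subgroup_conj_closed[OF B_normal _ ab(3)] assms
    by simp_all
  moreover have "p (\<alpha> g \<otimes> a \<otimes> inv (\<alpha> g)) = g \<otimes>\<^bsub>G\<^esub> c \<otimes>\<^bsub>G\<^esub> inv\<^bsub>G\<^esub> g" "q (\<alpha> g \<otimes> b \<otimes> inv (\<alpha> g)) = d"
    using assms ab by auto
  ultimately have "pairing (g \<otimes>\<^bsub>G\<^esub> c \<otimes>\<^bsub>G\<^esub> inv\<^bsub>G\<^esub> g) d = com (\<alpha> g \<otimes> a \<otimes> inv (\<alpha> g)) (\<alpha> g \<otimes> b \<otimes> inv (\<alpha> g))"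
    using pairing_eq by metis
  also have "\<dots> = \<alpha> g \<otimes> com a b \<otimes> inv (\<alpha> g)"
    using assms ab by (simp add: H.commutator_conj)
  finally show ?thesis
    using pairing_eq ab by metis
qed

text \<open>Here the lifts are conjugated by \<open>\<beta> g\<close>, which p kills. On W it acts
  like \<open>\<alpha> g\<close>, so both variables induce one and the same action.\<close>

lemma pairing_conj_right:
  assumes "g \<in> carrier G" "c \<in> G'" "d \<in> G'"
  shows "pairing c (g \<otimes>\<^bsub>G\<^esub> d \<otimes>\<^bsub>G\<^esub> inv\<^bsub>G\<^esub> g) = \<alpha> g \<otimes> pairing c d \<otimes> inv (\<alpha> g)"
proof -
  obtain a b where ab: "a \<in> A" "p a = c" "b \<in> B" "q b = d"
    using obtain_A obtain_B assms by metis
  have "\<beta> g \<otimes> a \<otimes> inv (\<beta> g) \<in> A" "\<beta> g \<otimes> b \<otimes> inv (\<beta> g) \<in> B"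
    using H.subgroup_conj_closed[OF A_normal _ ab(1)] H.subgroup_conj_closed[OF B_normal _ ab(3)] assms
    by simp_all
  moreover have "p (\<beta> g \<otimes> a \<otimes> inv (\<beta> g)) = c" "q (\<beta> g \<otimes> b \<otimes> inv (\<beta> g)) = g \<otimes>\<^bsub>G\<^esub> d \<otimes>\<^bsub>G\<^esub> inv\<^bsub>G\<^esub> g"
    using assms ab by auto
  ultimately have "pairing c (g \<otimes>\<^bsub>G\<^esub> d \<otimes>\<^bsub>G\<^esub> inv\<^bsub>G\<^esub> g) = com (\<beta> g \<otimes> a \<otimes> inv (\<beta> g)) (\<beta> g \<otimes> b \<otimes> inv (\<beta> g))"
    using pairing_eq by metis
  also have "\<dots> = \<beta> g \<otimes> com a b \<otimes> inv (\<beta> g)"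
    using assms ab by (simp add: H.commutator_conj)
  also have "\<dots> = \<alpha> g \<otimes> com a b \<otimes> inv (\<alpha> g)"
    using assms ab conj_W_alpha_beta com_A_B_in_W by simp
  finally show ?thesis
    using pairing_eq ab by metis
qed

lemma W0_eq_generate_pairing: "W\<^sub>0 = generate H {pairing c d | c d. c \<in> G' \<and> d \<in> G'}"
proof -
  have "{com a b | a b. a \<in> A \<and> b \<in> B} = {pairing c d | c d. c \<in> G' \<and> d \<in> G'}"
  proof safe
    fix a b assume "a \<in> A" "b \<in> B"
    then show "\<exists>c d. com a b = pairing c d \<and> c \<in> G' \<and> d \<in> G'"
      using pairing_eq[of a b, symmetric] p_A q_B by (intro exI[of _ "p a"] exI[of _ "q b"]) auto
  next
    fix c d assume "c \<in> G'" "d \<in> G'"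
    then obtain a b where "a \<in> A" "p a = c" "b \<in> B" "q b = d"
      using obtain_A obtain_B by metis
    then show "\<exists>a b. pairing c d = com a b \<and> a \<in> A \<and> b \<in> B"
      using pairing_eq[of a b] by (intro exI[of _ a] exI[of _ b]) simp
  qed
  then show ?thesis
    by (simp add: W\<^sub>0_def)
qed

section \<open>Nilpotency of the action on the quotient of \<open>W\<close>\<close>

definition "K = {a \<in> A. \<forall>g\<in>carrier G. com (\<beta> g) a \<in> W\<^sub>0}"

lemma K_I: "\<lbrakk>a \<in> A; \<And>g. g \<in> carrier G \<Longrightarrow> com (\<beta> g) a \<in> W\<^sub>0\<rbrakk> \<Longrightarrow> a \<in> K"
  and com_K: "\<lbrakk>k \<in> K; g \<in> carrier G\<rbrakk> \<Longrightarrow> com (\<beta> g) k \<in> W\<^sub>0"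
  and K_in_A [simp]: "k \<in> K \<Longrightarrow> k \<in> A"
  unfolding K_def by blast+

lemma W0_conj_L: "w \<in> W\<^sub>0 \<Longrightarrow> l \<in> L \<Longrightarrow> l \<otimes> w \<otimes> inv l = w"
  using W_conj_L W0_in_W by blast

lemma K_subgroup: "subgroup K H"
proof
  show "K \<subseteq> carrier H"
    by auto
  show "\<one> \<in> K"
    using subgroup.one_closed[OF A_subgroup] subgroup.one_closed[OF W0_subgroup]
    by (intro K_I) (simp_all add: commutator_elem_def)
next
  fix x y assume xy: "x \<in> K" "y \<in> K"
  have "com (\<beta> g) (x \<otimes> y) \<in> W\<^sub>0" if "g \<in> carrier G" for g
    using xy that W0_conj_L[OF com_K, of y g x] subgroup.m_closed[OF W0_subgroup com_K com_K, of x g y g]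
    by (simp add: H.commutator_mult_right)
  then show "x \<otimes> y \<in> K"
    using xy subgroup.m_closed[OF A_subgroup] by (intro K_I) simp_all
next
  fix x assume x: "x \<in> K"
  have "com (\<beta> g) (inv x) \<in> W\<^sub>0" if "g \<in> carrier G" for g
  proof -
    have "inv (com (\<beta> g) x) \<in> W\<^sub>0"
      by (rule subgroup.m_inv_closed[OF W0_subgroup com_K[OF x that]])
    then have "com x (\<beta> g) \<in> W\<^sub>0"
      using x that by (simp add: H.inv_commutator)
    then show ?thesis
      using W0_conj_L[of "com x (\<beta> g)" "inv x"] x that subgroup.m_inv_closed[OF L_subgroup]
      by (simp add: H.commutator_inv_right)
  qed
  then show "inv x \<in> K"
    using x subgroup.m_inv_closed[OF A_subgroup] by (intro K_I) simp_all
qed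

lemma W0_in_K: "w \<in> W\<^sub>0 \<Longrightarrow> w \<in> K"
  using W0_in_A H.commutator_normal_closed(1)[OF W0_normal] by (intro K_I) simp_all

text \<open>Conjugation by \<open>\<beta> g\<close> preserves p. Hence it changes a only by an
  element of W and l only by a right factor b in B, and [a, l] is merely multiplied by [a, b], an
  element of \<open>W\<^sub>0\<close>.\<close>

lemma com_A_L_in_K:
  assumes "a \<in> A" "l \<in> L"
  shows "com a l \<in> K"
proof -
  have com_A: "com a l \<in> A"
    using H.commutator_normal_closed(2)[OF A_normal] assms by simp
  have "com (\<beta> g) (com a l) \<in> W\<^sub>0" if g: "g \<in> carrier G" for g
  proof -
    define a' l' where "a' = \<beta> g \<otimes> a \<otimes> inv (\<beta> g)" and "l' = \<beta> g \<otimes> l \<otimes> inv (\<beta> g)"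
    have a': "a' \<in> A" "p a = p a'" and l': "l' \<in> L" "p l = p l'"
      unfolding a'_def l'_def using assms g H.subgroup_conj_closed A_normal L_normal by auto
    define b where "b = inv l \<otimes> l'"
    have b: "b \<in> B" "l' = l \<otimes> b"
      unfolding b_def using l' assms by (auto intro!: B_I)
    have "\<beta> g \<otimes> com a l \<otimes> inv (\<beta> g) = com a' l'"
      using assms g by (simp add: a'_def l'_def H.commutator_conj)
    also have "\<dots> = com a l'"
      using com_A_cong[OF a'(1) assms(1)] a' l' by simp
    also have "\<dots> = com a l \<otimes> com a b"
      using b assms W_conj_L[OF com_A_B_in_W, of a b l] by (simp add: H.commutator_mult_right)
    also have "\<dots> = com a b \<otimes> com a l"
      using b assms W_L_commute[OF com_A_B_in_W, of a b "com a l"] com_A by simp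
    finally have "com (\<beta> g) (com a l) = com a b \<otimes> com a l \<otimes> inv (com a l)"
      by (subst commutator_elem_def) simp
    also have "\<dots> = com a b"
      using assms b by (simp add: H.m_assoc)
    finally show ?thesis
      using com_A_B_in_W0 assms b by simp
  qed
  with com_A show ?thesis
    by (rule K_I)
qed

definition "K\<^sub>2 = weakly_commuting.K H G \<alpha> q p \<mu>"

lemma K2_iff: "k \<in> K\<^sub>2 \<longleftrightarrow> k \<in> B \<and> (\<forall>g\<in>carrier G. com (\<alpha> g) k \<in> W\<^sub>0)"
  unfolding K\<^sub>2_def weakly_commuting.K_def[OF flipped] flipped_simps flipped_W0 by blast

lemma com_K2: "\<lbrakk>k \<in> K\<^sub>2; g \<in> carrier G\<rbrakk> \<Longrightarrow> com (\<alpha> g) k \<in> W\<^sub>0"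
  and K2_in_B [simp]: "k \<in> K\<^sub>2 \<Longrightarrow> k \<in> B"
  unfolding K2_iff by blast+

lemmas K2_subgroup = weakly_commuting.K_subgroup[OF flipped, folded K\<^sub>2_def]
lemmas com_B_L_in_K2 = weakly_commuting.com_A_L_in_K[OF flipped, unfolded flipped_simps, folded K\<^sub>2_def]

definition "N = {k \<otimes> k' | k k'. k \<in> K \<and> k' \<in> K\<^sub>2}"

lemma N_I: "k \<in> K \<Longrightarrow> k' \<in> K\<^sub>2 \<Longrightarrow> k \<otimes> k' \<in> N"
  by (auto simp: N_def)

lemma K_in_N: "k \<in> K \<Longrightarrow> k \<in> N"
  using N_I[of k \<one>] subgroup.one_closed[OF K2_subgroup] by simp

lemma K2_in_N: "k \<in> K\<^sub>2 \<Longrightarrow> k \<in> N"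
  using N_I[of \<one> k] subgroup.one_closed[OF K_subgroup] by simp

lemma N_in_L [simp]: "n \<in> N \<Longrightarrow> n \<in> L"
  by (auto simp: N_def intro!: subgroup.m_closed[OF L_subgroup])

lemma N_subgroup: "subgroup N H"
proof
  show "N \<subseteq> carrier H"
    by auto
  show "\<one> \<in> N"
    using K_in_N subgroup.one_closed[OF K_subgroup] .
next
  fix x y assume "x \<in> N" "y \<in> N"
  then obtain k1 k1' k2 k2' where k: "x = k1 \<otimes> k1'" "y = k2 \<otimes> k2'"
      "k1 \<in> K" "k2 \<in> K" "k1' \<in> K\<^sub>2" "k2' \<in> K\<^sub>2"
    by (auto simp: N_def)
  \<comment> \<open>\<open>inv w\<close> is the cost of moving k1' past k2. It lies in
    \<open>W\<^sub>0\<close>, so it is central in L and can be absorbed into the factor from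
    K.\<close>
  define w where "w = com (inv k2) (inv k1')"
  have w: "w \<in> W\<^sub>0"
    unfolding w_def using k subgroup.m_inv_closed[OF A_subgroup] subgroup.m_inv_closed[OF B_subgroup]
    by (intro com_A_B_in_W0) auto
  have "inv w \<in> W\<^sub>0"
    using w by (rule subgroup.m_inv_closed[OF W0_subgroup])
  then have k2w: "k2 \<otimes> inv w \<in> K"
    using k subgroup.m_closed[OF K_subgroup] W0_in_K by blast
  have "k1' \<otimes> k2 = k2 \<otimes> k1' \<otimes> inv w"
    using k by (simp add: w_def commutator_elem_def H.m_assoc H.inv_mult_group)
  also have "\<dots> = k2 \<otimes> inv w \<otimes> k1'"
    using \<open>inv w \<in> W\<^sub>0\<close> W0_in_W W_L_commute[of "inv w" k1'] k by (simp add: H.m_assoc)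
  finally have "x \<otimes> y = (k1 \<otimes> (k2 \<otimes> inv w)) \<otimes> (k1' \<otimes> k2')"
    using k w by (simp add: H.m_assoc) (metis A_in_L B_in_L H.m_assoc H.m_closed H.inv_closed K2_in_B K_in_A L_carrier W0_in_L)
  then show "x \<otimes> y \<in> N"
    using k k2w subgroup.m_closed[OF K_subgroup] subgroup.m_closed[OF K2_subgroup] by (auto intro: N_I)
next
  fix x assume "x \<in> N"
  then obtain k k' where k: "x = k \<otimes> k'" "k \<in> K" "k' \<in> K\<^sub>2"
    by (auto simp: N_def)
  define w where "w = com k k'"
  have w: "inv w \<in> W\<^sub>0"
    unfolding w_def using k com_A_B_in_W0 subgroup.m_inv_closed[OF W0_subgroup] by simp
  have "inv x = inv k \<otimes> (inv k' \<otimes> inv w)"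
    using k by (simp add: w_def commutator_elem_def H.m_assoc H.inv_mult_group)
  also have "\<dots> = inv k \<otimes> inv w \<otimes> inv k'"
    using w W0_in_W W_L_commute[of "inv w" "inv k'"] k subgroup.m_inv_closed[OF L_subgroup]
    by (simp add: H.m_assoc)
  finally show "inv x \<in> N"
    using k w W0_in_K subgroup.m_closed[OF K_subgroup] subgroup.m_inv_closed[OF K_subgroup]
      subgroup.m_inv_closed[OF K2_subgroup] by (auto intro!: N_I)
qed

text \<open>[ab, l] is the product of [a, [b, l]], [b, l] and [a, l], which lie in
  \<open>W\<^sub>0\<close>, \<open>K\<^sub>2\<close> and K respectively.\<close>

lemma com_AB_L_in_N:
  assumes "a \<in> A" "b \<in> B" "l \<in> L"
  shows "com (a \<otimes> b) l \<in> N"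
proof -
  have com_B: "com b l \<in> B"
    using H.commutator_normal_closed(2)[OF B_normal] assms by simp
  have "com (a \<otimes> b) l = com a (com b l) \<otimes> com b l \<otimes> com a l"
    using assms by (simp add: H.commutator_mult_left H.conj_eq_commutator_mult)
  moreover have "com a (com b l) \<in> N" "com b l \<in> N" "com a l \<in> N"
    using com_A_B_in_W0[OF assms(1) com_B] W0_in_K K_in_N com_A_L_in_K com_B_L_in_K2 K2_in_N assms
    by auto
  ultimately show ?thesis
    using subgroup.m_closed[OF N_subgroup] by simp
qed

lemma conj_N_closed:
  assumes "n \<in> N" "l \<in> L"
  shows "l \<otimes> n \<otimes> inv l \<in> N"
proof -
  have "com n l \<in> N"
    using assms com_AB_L_in_N by (auto simp: N_def)
  then have "inv (com n l) \<in> N"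
    by (rule subgroup.m_inv_closed[OF N_subgroup])
  then have "com l n \<otimes> n \<in> N"
    using assms by (simp add: H.inv_commutator subgroup.m_closed[OF N_subgroup])
  then show ?thesis
    using assms by (simp add: H.conj_eq_commutator_mult)
qed

text \<open>The image of [x, l] under p is a commutator, so some a in A has the same image, and
  dividing by a leaves an element of B. Thus [x, l] lies in AB, and \<open>com_AB_L_in_N\<close>
  applies.\<close>

lemma com_com_L_in_N:
  assumes x: "x \<in> carrier H" and "l \<in> L" "m \<in> L"
  shows "com (com x l) m \<in> N"
proof -
  define y where "y = com x l"
  have y: "y \<in> L" and "p y \<in> G'"
    using H.commutator_normal_closed[OF L_normal] assms
      H.inv_commutator G.commutator_in_derived[of "p x" "carrier G" "p l"]
    by (auto simp: y_def) (simp add: commutator_elem_def)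
  then obtain a where a: "a \<in> A" "p a = p y"
    by (metis obtain_A)
  then have "inv a \<otimes> y \<in> B"
    using y by (auto intro!: B_I)
  then have "com (a \<otimes> (inv a \<otimes> y)) m \<in> N"
    using a assms com_AB_L_in_N by blast
  then show ?thesis
    using a y by (simp add: y_def)
qed

text \<open>Conjugation by x turns [l, m] into [c l, d m] with c = [x, l] and d = [x, m]. In the
  expansion every factor other than [l, m] is a commutator of c or d with an element of L, possibly
  inverted, and lies in N by \<open>com_com_L_in_N\<close>. Since L normalises N, these factors can
  be collected and [l, m] cancels.\<close>

lemma com_L'_in_N:
  assumes "y \<in> L'" "x \<in> carrier H"
  shows "com x y \<in> N"
  using assms(1) L_normal
proof (induction rule: H.derived_induct)
  case one
  then show ?case
    using assms(2) subgroup.one_closed[OF N_subgroup] by (simp add: commutator_elem_def)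
next
  case (commutator l m)
  define c d where "c = com x l" and "d = com x m"
  have cd: "c \<in> L" "d \<in> L"
    using H.commutator_normal_closed[OF L_normal] commutator assms by (auto simp: c_def d_def)
  define m' where "m' = d \<otimes> m"
  have m': "m' \<in> L"
    unfolding m'_def using cd commutator by (intro subgroup.m_closed[OF L_subgroup])
  define t z where "t = com l m" and "z = com l m'"
  have tz: "t \<in> L" "z \<in> L" "com m l \<in> L"
    unfolding t_def z_def
    using commutator m' H.commutator_normal_closed(1)[OF L_normal] by auto
  have N: "com c z \<in> N" "com c m' \<in> N" "inv (com d l) \<in> N" "inv (com d (com m l)) \<in> N"
    unfolding c_def d_def
    using com_com_L_in_N assms(2) commutator m' tz subgroup.m_inv_closed[OF N_subgroup] by blast+
  have "com m' l = com d (com m l) \<otimes> com m l \<otimes> com d l"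
    using cd commutator by (simp add: m'_def H.commutator_mult_left H.conj_eq_commutator_mult)
  then have "inv (com m' l) = inv (com d (com m l) \<otimes> com m l \<otimes> com d l)"
    by simp
  then have z: "z = inv (com d l) \<otimes> t \<otimes> inv (com d (com m l))"
    using cd commutator m' tz by (simp add: z_def t_def H.inv_commutator H.inv_mult_group H.m_assoc)
  have "x \<otimes> t \<otimes> inv x = com (c \<otimes> l) (d \<otimes> m)"
    using assms commutator by (simp add: c_def d_def t_def H.commutator_conj flip: H.conj_eq_commutator_mult)
  also have "\<dots> = com c z \<otimes> z \<otimes> com c m'"
    using cd commutator m' tz by (simp add: H.commutator_mult_left H.conj_eq_commutator_mult z_def flip: m'_def)
  finally have "com x t = com c z \<otimes> z \<otimes> com c m' \<otimes> inv t"
    by (subst commutator_elem_def) simp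
  also have "\<dots> = com c z \<otimes> (z \<otimes> com c m' \<otimes> inv t)"
    using cd m' tz by (simp add: H.m_assoc)
  also have "z \<otimes> com c m' \<otimes> inv t
      = inv (com d l) \<otimes> (t \<otimes> (inv (com d (com m l)) \<otimes> com c m') \<otimes> inv t)"
    unfolding z using cd commutator m' tz(1,3) by (simp add: H.m_assoc)
  finally show ?case
    using N conj_N_closed[OF _ tz(1)] subgroup.m_closed[OF N_subgroup] by (simp add: t_def)
next
  case (mult y z)
  then have yz: "y \<in> L" "z \<in> L"
    using L'_subset_L by auto
  have "y \<otimes> com x z \<otimes> inv y \<in> N"
    using mult yz conj_N_closed by blast
  then show ?case
    using assms(2) yz mult subgroup.m_closed[OF N_subgroup] by (simp add: H.commutator_mult_right)
qed

text \<open>Write w = k k'. As p kills w and k', and q kills w and k, both factors lie in W. There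
  \<open>\<alpha> g\<close> acts like \<open>\<beta> g\<close>, so k, centralised modulo
  \<open>W\<^sub>0\<close> by the second copy, is centralised by the first copy too.\<close>

lemma com_W_N:
  assumes "w \<in> W" "w \<in> N" and g: "g \<in> carrier G"
  shows "com (\<alpha> g) w \<in> W\<^sub>0"
proof -
  obtain k k' where k: "k \<in> K" "k' \<in> K\<^sub>2" "w = k \<otimes> k'"
    using assms(2) by (auto simp: N_def)
  have pq: "p w = \<one>\<^bsub>G\<^esub>" "q w = \<one>\<^bsub>G\<^esub>"
    using assms(1) by (simp_all add: W_iff)
  have kW: "k \<in> W" "k' \<in> W"
    using pq k by (intro W_I; simp)+
  have com_k: "com (\<alpha> g) k \<in> W\<^sub>0" "com (\<alpha> g) k' \<in> W\<^sub>0"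
    using com_K[OF k(1) g] com_K2[OF k(2) g] com_W_alpha_beta[OF g kW(1)] by simp_all
  then have "com (\<alpha> g) w = com (\<alpha> g) k \<otimes> com (\<alpha> g) k'"
    using k g W0_conj_L[OF com_k(2), of k] by (simp add: H.commutator_mult_right)
  then show ?thesis
    using com_k subgroup.m_closed[OF W0_subgroup] by simp
qed

lemma com_com_W_L':
  assumes "w \<in> W" "w \<in> L'" "g \<in> carrier G" "h \<in> carrier G"
  shows "com (\<alpha> h) (com (\<alpha> g) w) \<in> W\<^sub>0"
  using assms by (intro com_W_N com_L'_in_N H.commutator_normal_closed(1)[OF W_normal]) auto

text \<open>\<open>square_zero_aux\<close> settles the classes of the generators
  \<open>ell h\<close> of L; the resulting identity is additive in the class and so holds on all of
  L/L'.\<close>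

lemma com_com_L:
  assumes l: "l \<in> L" and g: "g \<in> carrier G"
  shows "com (\<alpha> g) (com (\<alpha> g) l) \<in> L'"
proof -
  define c where "c = (\<lambda>x. L' #> x)"
  interpret L': normal L' H
    by (rule L'_normal)
  interpret Y: group "H Mod L'"
    by (rule L'.factorgroup_is_group)
  interpret c: group_hom H "H Mod L'" c
    unfolding c_def by unfold_locales (rule L'.r_coset_hom_Mod)
  have c_one: "c x = \<one>\<^bsub>H Mod L'\<^esub> \<longleftrightarrow> x \<in> L'" if "x \<in> carrier H" for x
    using that H.coset_join1 H.coset_join2 L'_subgroup unfolding c_def
    by (metis L'.subset one_FactGroup)
  have c_eq: "c x = c y" if "x \<otimes> inv y \<in> L'" "x \<in> carrier H" "y \<in> carrier H" for x y
  proof -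
    have "c (x \<otimes> inv y) = \<one>\<^bsub>H Mod L'\<^esub>"
      using c_one[OF H.m_closed[OF that(2) H.inv_closed[OF that(3)]]] that(1) by blast
    moreover have "c x = c (x \<otimes> inv y) \<otimes>\<^bsub>H Mod L'\<^esub> c y"
    proof -
      have "c (x \<otimes> inv y) \<otimes>\<^bsub>H Mod L'\<^esub> c y = c (x \<otimes> inv y \<otimes> y)"
        using that by (intro c.hom_mult[symmetric]) auto
      then show ?thesis
        using that by (simp add: H.m_assoc del: mult_FactGroup c.hom_mult)
    qed
    ultimately show ?thesis
      using Y.l_one[OF c.hom_closed[OF that(3)]] by metis
  qed
  \<comment> \<open>L/L' is realised inside H/L', where conjugation by the class of
    \<open>\<alpha> k\<close> is available and yields the operators \<open>S k\<close>.\<close>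
  define V where "V = (H Mod L')\<lparr>carrier := c ` L\<rparr>"
  have subV: "subgroup (c ` L) (H Mod L')"
    using c.subgroup_img_is_subgroup L_subgroup by blast
  interpret V: comm_group V
  proof (rule group.group_comm_groupI)
    show "group V"
      unfolding V_def using subV by (rule Y.subgroup_imp_group)
    fix v w assume "v \<in> carrier V" "w \<in> carrier V"
    then obtain x y where xy: "x \<in> L" "y \<in> L" "v = c x" "w = c y"
      by (auto simp: V_def)
    have "(x \<otimes> y) \<otimes> inv (y \<otimes> x) = com x y"
      using xy by (simp add: commutator_elem_def H.inv_mult_group H.m_assoc)
    then have "c (x \<otimes> y) = c (y \<otimes> x)"
      using xy H.commutator_in_derived[of x L y] by (intro c_eq) auto
    then show "v \<otimes>\<^bsub>V\<^esub> w = w \<otimes>\<^bsub>V\<^esub> v"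
      using xy by (simp add: V_def del: mult_FactGroup)
  qed
  define S where "S k w = c (\<alpha> k) \<otimes>\<^bsub>H Mod L'\<^esub> w \<otimes>\<^bsub>H Mod L'\<^esub> inv\<^bsub>H Mod L'\<^esub> c (\<alpha> k)" for k w
  have S_c: "S k (c x) = c (\<alpha> k \<otimes> x \<otimes> inv (\<alpha> k))" if "x \<in> L" "k \<in> carrier G" for k x
    using that by (simp add: S_def del: mult_FactGroup)
  have conj_L: "\<alpha> k \<otimes> x \<otimes> inv (\<alpha> k) \<in> L" if "x \<in> L" "k \<in> carrier G" for k x
    using that H.subgroup_conj_closed[OF L_normal] by simp
  have V_mult: "c x \<otimes>\<^bsub>V\<^esub> c y = c (x \<otimes> y)" if "x \<in> L" "y \<in> L" for x y
    using that by (simp add: V_def del: mult_FactGroup)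
  have V_carrier: "c x \<in> carrier V" if "x \<in> L" for x
    using that by (simp add: V_def)
  have V_E: "\<exists>x\<in>L. v = c x" if "v \<in> carrier V" for v
    using that by (auto simp: V_def)
  have S_hom: "S k \<in> hom V V" if k: "k \<in> carrier G" for k
  proof (rule homI)
    fix v w assume "v \<in> carrier V" "w \<in> carrier V"
    then obtain x y where xy: "x \<in> L" "y \<in> L" "v = c x" "w = c y"
      using V_E by metis
    show "S k v \<in> carrier V"
      using xy k by (simp add: S_c V_carrier conj_L del: c.hom_mult)
    have "\<alpha> k \<otimes> (x \<otimes> y) \<otimes> inv (\<alpha> k)
        = (\<alpha> k \<otimes> x \<otimes> inv (\<alpha> k)) \<otimes> (\<alpha> k \<otimes> y \<otimes> inv (\<alpha> k))"
      using xy k by (simp add: H.m_assoc)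
    then show "S k (v \<otimes>\<^bsub>V\<^esub> w) = S k v \<otimes>\<^bsub>V\<^esub> S k w"
      using xy k by (simp add: S_c V_mult conj_L subgroup.m_closed[OF L_subgroup] del: c.hom_mult)
  qed
  have S_inj: "inj_on (S k) (carrier V)" if k: "k \<in> carrier G" for k
  proof (rule inj_onI)
    fix v w assume "v \<in> carrier V" "w \<in> carrier V" and eq: "S k v = S k w"
    then have "v \<in> carrier (H Mod L')" "w \<in> carrier (H Mod L')"
      using subgroup.mem_carrier[OF subV] by (auto simp: V_def)
    then show "v = w"
      using eq k by (simp add: S_def del: mult_FactGroup)
  qed
  have S_commute: "S k (S h v) = S h (S k v)" if hk: "h \<in> carrier G" "k \<in> carrier G" and "v \<in> carrier V" for h k v
  proof -
    obtain x where x: "x \<in> L" "v = c x"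
      using V_E \<open>v \<in> carrier V\<close> by blast
    define y where "y = \<alpha> h \<otimes> (\<alpha> k \<otimes> x \<otimes> inv (\<alpha> k)) \<otimes> inv (\<alpha> h)"
    have y: "y \<in> L"
      unfolding y_def using conj_L x hk by simp
    \<comment> \<open>\<mu> maps [\<alpha> k, \<alpha> h] into G', so this element acts trivially on
      L/L' and the operators commute.\<close>
    have "com (com (\<alpha> k) (\<alpha> h)) y \<in> L'"
      using y hk G.commutator_in_derived[of k "carrier G" h]
      by (intro com_L_in_L') (simp_all add: commutator_elem_def)
    moreover have "\<alpha> k \<otimes> (\<alpha> h \<otimes> x \<otimes> inv (\<alpha> h)) \<otimes> inv (\<alpha> k) \<otimes> inv y = com (com (\<alpha> k) (\<alpha> h)) y"
      using hk x by (simp add: y_def commutator_elem_def H.m_assoc H.inv_mult_group)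
    ultimately have "c (\<alpha> k \<otimes> (\<alpha> h \<otimes> x \<otimes> inv (\<alpha> h)) \<otimes> inv (\<alpha> k)) = c y"
      using hk x y by (intro c_eq) auto
    then show ?thesis
      using x hk by (simp add: S_c conj_L y_def del: c.hom_mult)
  qed
  have S_ell: "S k (c (ell k)) = c (ell k)" if k: "k \<in> carrier G" for k
  proof -
    have "\<alpha> k \<otimes> ell k \<otimes> inv (\<alpha> k) = ell k"
      using k alpha_beta_commute[OF k] by (simp add: ell_def flip: H.m_assoc) (simp add: H.m_assoc)
    then show ?thesis
      using k by (simp add: S_c ell_in_L)
  qed
  have ell_mult': "c (ell (k \<otimes>\<^bsub>G\<^esub> h)) = S k (c (ell h)) \<otimes>\<^bsub>V\<^esub> c (ell k)" if hk: "h \<in> carrier G" "k \<in> carrier G" for h k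
  proof -
    define y where "y = \<alpha> k \<otimes> ell h \<otimes> inv (\<alpha> k)"
    have y: "y \<in> L"
      using conj_L hk ell_in_L by (simp add: y_def)
    have "ell (k \<otimes>\<^bsub>G\<^esub> h) = ell k \<otimes> y"
      using hk by (simp add: ell_mult y_def ell_def H.m_assoc H.inv_mult_group)
    then have "c (ell (k \<otimes>\<^bsub>G\<^esub> h)) = c (ell k) \<otimes>\<^bsub>V\<^esub> c y"
      using hk y by (simp add: V_mult ell_in_L del: c.hom_mult)
    also have "\<dots> = c y \<otimes>\<^bsub>V\<^esub> c (ell k)"
      using hk y by (intro V.m_comm V_carrier ell_in_L)
    finally show ?thesis
      using hk by (simp add: S_c ell_in_L y_def del: c.hom_mult)
  qed
  \<comment> \<open>In additive notation (S - 1)^2 v = 0, written without inverses as S S v + v = S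
    v + S v.\<close>
  have key_ell: "S g (S g (c (ell h))) \<otimes>\<^bsub>V\<^esub> c (ell h) = S g (c (ell h)) \<otimes>\<^bsub>V\<^esub> S g (c (ell h))"
    if h: "h \<in> carrier G" for h
  proof (rule V.square_zero_aux[where T = "S h" and u = "c (ell g)"])
    show "S g (S h (S g (c (ell h)) \<otimes>\<^bsub>V\<^esub> c (ell g))) = S g (c (ell h)) \<otimes>\<^bsub>V\<^esub> c (ell g)"
    proof -
      have "S (g \<otimes>\<^bsub>G\<^esub> h) (c (ell (g \<otimes>\<^bsub>G\<^esub> h))) = S g (S h (c (ell (g \<otimes>\<^bsub>G\<^esub> h))))"
      proof -
        have "\<alpha> (g \<otimes>\<^bsub>G\<^esub> h) \<otimes> e \<otimes> inv (\<alpha> (g \<otimes>\<^bsub>G\<^esub> h)) = \<alpha> g \<otimes> (\<alpha> h \<otimes> e \<otimes> inv (\<alpha> h)) \<otimes> inv (\<alpha> g)"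
          if "e \<in> carrier H" for e
          using that g h by (simp add: H.m_assoc H.inv_mult_group)
        then show ?thesis
          using g h by (simp add: S_c ell_in_L conj_L del: c.hom_mult alpha.hom_mult)
      qed
      then show ?thesis
        using S_ell[of "g \<otimes>\<^bsub>G\<^esub> h"] ell_mult'[OF h g] g h by simp
    qed
  qed (use g h S_hom S_inj S_commute S_ell V_carrier ell_in_L in auto)
  have key: "S g (S g (c l)) \<otimes>\<^bsub>V\<^esub> c l = S g (c l) \<otimes>\<^bsub>V\<^esub> S g (c l)"
    using l[unfolded L_eq_generate]
  proof (induction rule: generate.induct)
    case one
    then show ?case
      using g S_hom[OF g] V_mult[of \<one> \<one>] subgroup.one_closed[OF L_subgroup] S_c[of \<one> g] by simp
  next
    case (incl x)
    then show ?case using key_ell by auto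
  next
    case (inv x)
    then obtain h where h: "h \<in> carrier G" "x = ell h"
      by blast
    \<comment> \<open>Since \<open>\<alpha> h\<close> and \<open>\<beta> h\<close> commute, the
      inverse of a generator is itself a generator.\<close>
    have "inv (ell h) = ell (inv\<^bsub>G\<^esub> h)"
    proof -
      have "inv (\<beta> h) \<otimes> \<alpha> h = \<alpha> h \<otimes> inv (\<beta> h)"
        using alpha_beta_commute[OF h(1)] h(1)
        by (metis H.inv_solve_left H.inv_solve_right H.m_assoc H.inv_closed H.m_closed alpha.hom_closed beta.hom_closed)
      then show ?thesis
        using h by (simp add: ell_def H.inv_mult_group)
    qed
    then show ?case
      using key_ell[of "inv\<^bsub>G\<^esub> h"] h by simp
  next
    case (eng x y)
    then have xy: "x \<in> L" "y \<in> L"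
      unfolding L_eq_generate by auto
    note Sc = hom_in_carrier[OF S_hom[OF g]] V_carrier
    have "S g (S g (c (x \<otimes> y))) \<otimes>\<^bsub>V\<^esub> c (x \<otimes> y)
        = (S g (S g (c x)) \<otimes>\<^bsub>V\<^esub> c x) \<otimes>\<^bsub>V\<^esub> (S g (S g (c y)) \<otimes>\<^bsub>V\<^esub> c y)"
      using xy by (simp add: hom_mult[OF S_hom[OF g]] Sc V.m_ac flip: V_mult del: c.hom_mult)
    also have "\<dots> = S g (c (x \<otimes> y)) \<otimes>\<^bsub>V\<^esub> S g (c (x \<otimes> y))"
      unfolding eng using xy by (simp add: hom_mult[OF S_hom[OF g]] Sc V.m_ac flip: V_mult del: c.hom_mult)
    finally show ?case .
  qed
  \<comment> \<open>With x and y the first and second conjugates of l, the class of the double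
    commutator is y - 2x + l, which is what \<open>key\<close> shows to vanish.\<close>
  define x y z where "x = \<alpha> g \<otimes> l \<otimes> inv (\<alpha> g)" and "y = \<alpha> g \<otimes> x \<otimes> inv (\<alpha> g)"
    and "z = com (\<alpha> g) (com (\<alpha> g) l)"
  have xyz: "x \<in> L" "y \<in> L" "inv x \<in> L"
    using conj_L l g subgroup.m_inv_closed[OF L_subgroup] by (simp_all add: x_def y_def)
  have z: "z = y \<otimes> inv x \<otimes> (l \<otimes> inv x)" "z \<in> L"
    unfolding z_def using l g H.commutator_normal_closed(1)[OF L_normal]
    by (simp_all, simp add: x_def y_def commutator_elem_def H.m_assoc H.inv_mult_group)
  have yl: "c y \<otimes>\<^bsub>V\<^esub> c l = c x \<otimes>\<^bsub>V\<^esub> c x"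
    using key l g by (simp add: S_c x_def y_def conj_L del: c.hom_mult)
  have "c z = (c y \<otimes>\<^bsub>V\<^esub> c l) \<otimes>\<^bsub>V\<^esub> (c (inv x) \<otimes>\<^bsub>V\<^esub> c (inv x))"
    using xyz l unfolding z(1)
    by (simp add: V.m_ac V_carrier subgroup.m_closed[OF L_subgroup] flip: V_mult
        del: c.hom_mult c.hom_inv)
  also have "\<dots> = c x \<otimes>\<^bsub>V\<^esub> c (inv x) \<otimes>\<^bsub>V\<^esub> (c x \<otimes>\<^bsub>V\<^esub> c (inv x))"
    unfolding yl using xyz by (simp add: V.m_ac V_carrier del: c.hom_inv)
  also have "c x \<otimes>\<^bsub>V\<^esub> c (inv x) = c (x \<otimes> inv x)"
    using xyz by (intro V_mult)
  also have "c (x \<otimes> inv x) = \<one>\<^bsub>V\<^esub>"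
    using xyz c.hom_one by (simp add: V_def del: c.hom_mult c.hom_inv)
  also have "\<one>\<^bsub>V\<^esub> \<otimes>\<^bsub>V\<^esub> \<one>\<^bsub>V\<^esub> = \<one>\<^bsub>H Mod L'\<^esub>"
    using V.l_one[OF V.one_closed] by (simp add: V_def)
  finally show ?thesis
    using c_one z by (simp add: z_def)
qed

text \<open>\<open>F\<close> is the set of generators that may still act non-trivially on \<open>U/U'\<close>. Since
  \<open>(s - 1)\<^sup>2 = 0\<close> there, inserting the kernel \<open>U1\<close> of \<open>s - 1\<close> between \<open>U'\<close> and \<open>U\<close> removes \<open>s\<close> from \<open>F\<close> at
  the price of doubling the length.\<close>

lemma nilpotent_on_filtration:
  assumes "finite F" and S: "S \<subseteq> carrier G" "generate G S = carrier G"
    and "U \<lhd> H" "U' \<lhd> H" "L' \<subseteq> U'" "U' \<subseteq> U" "U \<subseteq> L"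
    and "\<And>s u. s \<in> S - F \<Longrightarrow> u \<in> U \<Longrightarrow> com (\<alpha> s) u \<in> U'"
    and "u \<in> U" "gs \<in> lists (carrier G)" "length gs = 2 ^ card F"
  shows "foldl (\<lambda>x g. com (\<alpha> g) x) u gs \<in> U'"
  using assms(1,4-)
proof (induction F arbitrary: U U' u gs rule: finite_induct)
  case empty
  note U' = normal_imp_subgroup[OF empty(2)]
  have U_carrier: "u \<in> carrier H" if "u \<in> U" for u
    using that empty by auto
  have "\<forall>u\<in>U. com (\<alpha> g) u \<in> U'" if "g \<in> generate G S" for g
    using that
  proof (induction rule: generate.induct)
    case one
    then show ?case
      using U_carrier subgroup.one_closed[OF U'] by (simp add: commutator_elem_def)
  next
    case (incl g)
    then show ?case using empty by blast
  next
    case (inv g)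
    then have g: "g \<in> carrier G"
      using S by auto
    show ?case
    proof
      fix u assume u: "u \<in> U"
      have "inv (com (\<alpha> g) u) \<in> U'"
        using empty u inv by (intro subgroup.m_inv_closed[OF U']) auto
      then have "inv (\<alpha> g) \<otimes> com u (\<alpha> g) \<otimes> inv (inv (\<alpha> g)) \<in> U'"
        using u U_carrier g H.subgroup_conj_closed[OF empty(2), of "inv (\<alpha> g)" "com u (\<alpha> g)"]
        by (simp add: H.inv_commutator)
      then show "com (\<alpha> (inv\<^bsub>G\<^esub> g)) u \<in> U'"
        using u U_carrier g by (simp add: H.commutator_inv_left)
    qed
  next
    case (eng g h)
    then have gh: "g \<in> carrier G" "h \<in> carrier G"
      using S by auto
    show ?case
    proof
      fix u assume u: "u \<in> U"
      have "\<alpha> g \<otimes> com (\<alpha> h) u \<otimes> inv (\<alpha> g) \<in> U'"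
        using u eng gh H.subgroup_conj_closed[OF empty(2)] by simp
      then show "com (\<alpha> (g \<otimes>\<^bsub>G\<^esub> h)) u \<in> U'"
        using u eng gh U_carrier subgroup.m_closed[OF U'] by (simp add: H.commutator_mult_left)
    qed
  qed
  moreover obtain g where "gs = [g]" "g \<in> carrier G"
    using empty by (auto simp: length_Suc_conv)
  ultimately show ?case
    using S empty by simp
next
  case (insert s F)
  note U = normal_imp_subgroup[OF insert(4)] and U' = normal_imp_subgroup[OF insert(5)]
  have U_carrier: "u \<in> carrier H" if "u \<in> U" for u
    using that insert by auto
  define gs1 gs2 where "gs1 = take (2 ^ card F) gs" and "gs2 = drop (2 ^ card F) gs"
  have gs: "gs = gs1 @ gs2" "gs1 \<in> lists (carrier G)" "gs2 \<in> lists (carrier G)"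
      "length gs1 = 2 ^ card F" "length gs2 = 2 ^ card F"
    using insert by (auto simp: gs1_def gs2_def dest: in_set_takeD in_set_dropD)
  show ?case
  proof (cases "s \<in> S")
    case False
    then have S_F: "S - F = S - insert s F"
      by blast
    have 1: "foldl (\<lambda>x g. com (\<alpha> g) x) u gs1 \<in> U'"
      by (rule insert.IH[OF insert(4,5)]) (use insert gs S_F in auto)
    then have "foldl (\<lambda>x g. com (\<alpha> g) x) u gs1 \<in> U"
      using insert by blast
    then show ?thesis
      unfolding gs(1) foldl_append
      by (rule insert.IH[OF insert(4,5), rotated 4]) (use insert gs S_F in auto)
  next
    case True
    then have s: "s \<in> carrier G"
      using S by auto
    define U1 where "U1 = {u \<in> U. com (\<alpha> s) u \<in> U'}"
    have U1_subset: "u \<in> U" and U1_com: "com (\<alpha> s) u \<in> U'" if "u \<in> U1" for u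
      using that by (simp_all add: U1_def)
    have U1_I: "u \<in> U1" if "u \<in> U" "com (\<alpha> s) u \<in> U'" for u
      using that by (simp add: U1_def)
    have U1: "subgroup U1 H"
    proof
      show "U1 \<subseteq> carrier H"
        using U_carrier U1_subset by auto
      show "\<one> \<in> U1"
        using s subgroup.one_closed[OF U] subgroup.one_closed[OF U']
        by (intro U1_I) (simp_all add: commutator_elem_def)
    next
      fix x y assume xy: "x \<in> U1" "y \<in> U1"
      then have xyU: "x \<in> U" "y \<in> U" "com (\<alpha> s) x \<in> U'" "com (\<alpha> s) y \<in> U'"
        using U1_subset U1_com by blast+
      then have "x \<otimes> com (\<alpha> s) y \<otimes> inv x \<in> U'"
        using U_carrier H.subgroup_conj_closed[OF insert(5)] by blast
      then have "com (\<alpha> s) (x \<otimes> y) \<in> U'"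
        using xyU s U_carrier subgroup.m_closed[OF U']
        by (simp add: H.commutator_mult_right)
      then show "x \<otimes> y \<in> U1"
        using xyU subgroup.m_closed[OF U] by (intro U1_I)
    next
      fix x assume x: "x \<in> U1"
      then have xc: "x \<in> carrier H"
        using U_carrier U1_subset by auto
      have "inv (com (\<alpha> s) x) \<in> U'"
        using x by (intro subgroup.m_inv_closed[OF U'] U1_com)
      then have "inv x \<otimes> com x (\<alpha> s) \<otimes> inv (inv x) \<in> U'"
        using xc s H.subgroup_conj_closed[OF insert(5), of "inv x" "com x (\<alpha> s)"]
        by (simp add: H.inv_commutator)
      then show "inv x \<in> U1"
        using xc s subgroup.m_inv_closed[OF U U1_subset[OF x]]
        by (intro U1_I) (simp_all add: H.commutator_inv_right)
    qed
    have U1_normal: "U1 \<lhd> H"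
      unfolding H.normal_inv_iff
    proof (intro conjI ballI U1)
      fix x u assume x: "x \<in> carrier H" and u: "u \<in> U1"
      then have uU: "u \<in> U" "u \<in> L"
        using U1_subset insert by auto
      \<comment> \<open>\<open>\<alpha> s \<otimes> y\<close> is the conjugate of
        \<open>\<alpha> s\<close> by \<open>inv x\<close>. Since \<mu> y is a commutator, y acts
        trivially on L/L', and so conjugation by x preserves the kernel of s - 1 on U/U'.\<close>
      define y where "y = com (inv (\<alpha> s)) (inv x)"
      have y: "y \<in> carrier H" "\<mu> y \<in> G'"
        using x s G.commutator_in_derived[of "inv\<^bsub>G\<^esub> s" "carrier G" "inv\<^bsub>G\<^esub> (\<mu> x)"]
        by (auto simp: y_def commutator_elem_def)
      have "com y u \<in> U'"
        using com_L_in_L'[OF y uU(2)] insert by blast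
      then have "\<alpha> s \<otimes> com y u \<otimes> inv (\<alpha> s) \<otimes> com (\<alpha> s) u \<in> U'"
        using s by (intro subgroup.m_closed[OF U' H.subgroup_conj_closed[OF insert(5)] U1_com[OF u]]) simp_all
      then have "com (\<alpha> s \<otimes> y) u \<in> U'"
        using s y uU by (simp add: H.commutator_mult_left)
      then have "x \<otimes> com (\<alpha> s \<otimes> y) u \<otimes> inv x \<in> U'"
        using x H.subgroup_conj_closed[OF insert(5)] by simp
      moreover have "x \<otimes> com (\<alpha> s \<otimes> y) u \<otimes> inv x = com (\<alpha> s) (x \<otimes> u \<otimes> inv x)"
        using x s uU by (simp add: y_def commutator_elem_def H.m_assoc H.inv_mult_group)
      ultimately show "x \<otimes> u \<otimes> inv x \<in> U1"
        using x uU H.subgroup_conj_closed[OF insert(4)] by (intro U1_I) simp_all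
    qed
    have U'_U1: "U' \<subseteq> U1"
      using insert(7) H.commutator_normal_closed(1)[OF insert(5)] s by (auto intro!: U1_I)
    have com_U: "com (\<alpha> t) u \<in> U" if "t \<in> carrier G" "u \<in> U" for t u
      using that H.commutator_normal_closed(1)[OF insert(4)] by simp
    have 1: "foldl (\<lambda>x g. com (\<alpha> g) x) u gs1 \<in> U1"
    proof (rule insert.IH[OF insert(4) U1_normal])
      fix t u assume t: "t \<in> S - F" and u: "u \<in> U"
      show "com (\<alpha> t) u \<in> U1"
      proof (cases "t = s")
        case True
        \<comment> \<open>The vanishing square says that s - 1 maps U into its own kernel U1 modulo
          U'; the other generators outside F map U into U' already.\<close>
        have "com (\<alpha> s) (com (\<alpha> s) u) \<in> U'"
          using com_com_L[of u s] s u insert by blast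
        then show ?thesis
          using True s u com_U by (intro U1_I) simp_all
      next
        case False
        then show ?thesis
          using t u insert U'_U1 by blast
      qed
    qed (use insert gs U'_U1 U1_subset in auto)
    show ?thesis
      unfolding gs(1) foldl_append
    proof (rule insert.IH[OF U1_normal insert(5)])
      fix t u assume t: "t \<in> S - F" and u: "u \<in> U1"
      show "com (\<alpha> t) u \<in> U'"
      proof (cases "t = s")
        case False
        then show ?thesis
          using t u insert U1_subset by blast
      qed (use U1_com[OF u] in simp)
    qed (use insert gs U'_U1 U1_subset 1 in auto)
  qed
qed

theorem nilpotent_W_mod_W0:
  assumes "finitely_generated G"
  obtains d where "\<And>w gs. \<lbrakk>w \<in> W; gs \<in> lists (carrier G); length gs = d\<rbrakk>
    \<Longrightarrow> foldl (\<lambda>x g. com (\<alpha> g) x) w gs \<in> W\<^sub>0"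
proof -
  obtain S where S: "finite S" "S \<subseteq> carrier G" "generate G S = carrier G"
    using assms by (auto simp: finitely_generated_def)
  show thesis
  proof
    \<comment> \<open>The first \<open>2 ^ card S\<close> letters lead from W into L', with all of S
      taken as the set F; the last two lead from W \<inter> L' through W \<inter> N into
      \<open>W\<^sub>0\<close>.\<close>
    fix w gs
    assume w: "w \<in> W" and gs: "gs \<in> lists (carrier G)" "length gs = 2 ^ card S + 2"
    define us where "us = take (2 ^ card S) gs"
    have us: "us \<in> lists (carrier G)" "length us = 2 ^ card S"
      using gs by (auto simp: us_def dest: in_set_takeD)
    obtain g h where gh: "drop (2 ^ card S) gs = [g, h]"
    proof -
      have "length (drop (2 ^ card S) gs) = Suc (Suc 0)"
        using gs(2) by simp
      then show ?thesis
        using that by (auto simp only: length_Suc_conv length_0_conv)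
    qed
    then have gs_eq: "gs = us @ [g, h]"
      by (metis append_take_drop_id us_def)
    then have gh': "g \<in> carrier G" "h \<in> carrier G"
      using gs by auto
    define v where "v = foldl (\<lambda>x g. com (\<alpha> g) x) w us"
    have "v \<in> L'"
      unfolding v_def
      by (rule nilpotent_on_filtration[OF S L_normal L'_normal])
        (use L'_subset_L w us in \<open>simp_all add: W_iff\<close>)
    moreover have "v \<in> W"
      unfolding v_def using us(1) w
    proof (induction us arbitrary: w)
      case (Cons u us)
      then show ?case
        using H.commutator_normal_closed(1)[OF W_normal, of "\<alpha> u" w] by simp
    qed simp
    ultimately have "com (\<alpha> h) (com (\<alpha> g) v) \<in> W\<^sub>0"
      using com_com_W_L' gh' by blast
    then show "foldl (\<lambda>x g. com (\<alpha> g) x) w gs \<in> W\<^sub>0"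
      by (simp add: gs_eq v_def)
  qed
qed

end

section \<open>Free products and the weak commutativity construction\<close>

locale group_pair = A: group A + B: group B
  for A :: "('a, 'm) monoid_scheme" and B :: "('b, 'n) monoid_scheme"
begin

abbreviation "words \<equiv> free_product_words A B"
abbreviation "rel \<equiv> free_product_rel A B"
abbreviation "cls \<equiv> free_product_class A B"
abbreviation "P \<equiv> free_product A B"

lemma words_Nil [simp]: "[] \<in> words"
  and words_append [simp]: "u @ v \<in> words \<longleftrightarrow> u \<in> words \<and> v \<in> words"
  and words_Cons_Inl [simp]: "Inl x # u \<in> words \<longleftrightarrow> x \<in> carrier A \<and> u \<in> words"
  and words_Cons_Inr [simp]: "Inr y # u \<in> words \<longleftrightarrow> y \<in> carrier B \<and> u \<in> words"
  by (auto simp: free_product_words_def)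

lemma rel_words: "(u, v) \<in> rel \<Longrightarrow> u \<in> words \<and> v \<in> words"
  by (induction rule: free_product_rel.induct) auto

lemma rel_append_context:
  "(u, v) \<in> rel \<Longrightarrow> s \<in> words \<Longrightarrow> t \<in> words \<Longrightarrow> (s @ u @ t, s @ v @ t) \<in> rel"
proof (induction rule: free_product_rel.induct)
  case (one_left u v)
  then show ?case
    using free_product_rel.one_left[of "s @ u" A B "v @ t"] by simp
next
  case (one_right u v)
  then show ?case
    using free_product_rel.one_right[of "s @ u" A B "v @ t"] by simp
next
  case (mult_left u v x y)
  then show ?case
    using free_product_rel.mult_left[of "s @ u" A B "v @ t" x y] by simp
next
  case (mult_right u v x y)
  then show ?case
    using free_product_rel.mult_right[of "s @ u" A B "v @ t" x y] by simp
next
  case (trans u v w)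
  then show ?case using free_product_rel.trans by blast
qed (auto intro: free_product_rel.refl free_product_rel.sym)

lemma rel_append:
  assumes "(u, u') \<in> rel" "(v, v') \<in> rel"
  shows "(u @ v, u' @ v') \<in> rel"
proof -
  have "(u @ v, u' @ v) \<in> rel" "(u' @ v, u' @ v') \<in> rel"
    using rel_append_context[OF assms(1), of "[]" v] rel_append_context[OF assms(2), of u' "[]"]
      rel_words assms by auto
  then show ?thesis by (rule free_product_rel.trans)
qed

lemma equiv_rel: "equiv words rel"
proof (rule equivI)
  show "rel \<subseteq> words \<times> words" "sym rel" "trans rel"
    using rel_words by (auto intro: symI transI free_product_rel.sym free_product_rel.trans)
  show "refl_on words rel"
    by (auto intro: refl_onI free_product_rel.refl)
qed

lemma cls_eq_iff: "u \<in> words \<Longrightarrow> v \<in> words \<Longrightarrow> cls u = cls v \<longleftrightarrow> (u, v) \<in> rel"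
  unfolding free_product_class_def using eq_equiv_class_iff[OF equiv_rel] by blast

lemma carrier_P: "carrier P = cls ` words"
  by (auto simp: free_product_def free_product_class_def quotient_def)

lemma cls_in_carrier [simp]: "u \<in> words \<Longrightarrow> cls u \<in> carrier P"
  by (auto simp: carrier_P)

lemma one_P: "\<one>\<^bsub>P\<^esub> = cls []"
  by (simp add: free_product_def)

text \<open>The product is defined as the element of a set of classes; \<open>rel_append\<close>
  makes that set a singleton.\<close>

lemma mult_P:
  assumes "u \<in> words" "v \<in> words"
  shows "cls u \<otimes>\<^bsub>P\<^esub> cls v = cls (u @ v)"
proof -
  have "(\<lambda>(u, v). cls (u @ v)) ` (cls u \<times> cls v) = {cls (u @ v)}"
  proof -
    have "cls (x @ y) = cls (u @ v)" if "x \<in> cls u" "y \<in> cls v" for x y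
    proof -
      have "(u, x) \<in> rel" "(v, y) \<in> rel"
        using that by (auto simp: free_product_class_def)
      then have *: "(u @ v, x @ y) \<in> rel"
        by (rule rel_append)
      have "u @ v \<in> words" "x @ y \<in> words"
        using rel_words[OF *] by blast+
      with * show ?thesis
        using cls_eq_iff by blast
    qed
    then have "(\<lambda>(u, v). cls (u @ v)) ` (cls u \<times> cls v) \<subseteq> {cls (u @ v)}"
      by (rule_tac image_subsetI) auto
    moreover have "u \<in> cls u" "v \<in> cls v"
      using assms by (auto simp: free_product_class_def free_product_rel.refl)
    then have "cls (u @ v) \<in> (\<lambda>(u, v). cls (u @ v)) ` (cls u \<times> cls v)"
      by (intro image_eqI[of _ _ "(u, v)"]) simp_all
    ultimately show ?thesis
      by blast
  qed
  then show ?thesis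
    by (simp add: free_product_def)
qed

text \<open>Each new inverse letter goes to the end of v, next to the letter that it
  cancels.\<close>

lemma rel_inverse_exists: "u \<in> words \<Longrightarrow> \<exists>v\<in>words. (v @ u, []) \<in> rel"
proof (induction u)
  case Nil
  then show ?case
    by (intro bexI[of _ "[]"]) (auto intro: free_product_rel.refl)
next
  case (Cons l u)
  obtain v where v: "v \<in> words" "(v @ u, []) \<in> rel"
    using Cons by (cases l) auto
  have "\<exists>l'\<in>words. (l' @ [l], []) \<in> rel"
  proof (cases l)
    case (Inl x)
    then have x: "x \<in> carrier A"
      using Cons by simp
    then have "([Inl (inv\<^bsub>A\<^esub> x), Inl x], [Inl \<one>\<^bsub>A\<^esub>]) \<in> rel"
      using free_product_rel.mult_left[of "[]" A B "[]" "inv\<^bsub>A\<^esub> x" x] by simp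
    moreover have "([Inl \<one>\<^bsub>A\<^esub>], []) \<in> rel"
      using free_product_rel.one_left[of "[]" A B "[]"] by simp
    ultimately show ?thesis
      using Inl x by (intro bexI[of _ "[Inl (inv\<^bsub>A\<^esub> x)]"]) (auto intro: free_product_rel.trans)
  next
    case (Inr x)
    then have x: "x \<in> carrier B"
      using Cons by simp
    then have "([Inr (inv\<^bsub>B\<^esub> x), Inr x], [Inr \<one>\<^bsub>B\<^esub>]) \<in> rel"
      using free_product_rel.mult_right[of "[]" A B "[]" "inv\<^bsub>B\<^esub> x" x] by simp
    moreover have "([Inr \<one>\<^bsub>B\<^esub>], []) \<in> rel"
      using free_product_rel.one_right[of "[]" A B "[]"] by simp
    ultimately show ?thesis
      using Inr x by (intro bexI[of _ "[Inr (inv\<^bsub>B\<^esub> x)]"]) (auto intro: free_product_rel.trans)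
  qed
  then obtain l' where l': "l' \<in> words" "(l' @ [l], []) \<in> rel"
    by blast
  have "u \<in> words"
    using Cons by (cases l) auto
  then have "(v @ (l' @ [l]) @ u, v @ [] @ u) \<in> rel"
    by (intro rel_append_context l' v)
  then have "((v @ l') @ (l # u), []) \<in> rel"
    using v(2) by (auto intro: free_product_rel.trans)
  then show ?case
    using v l' by (intro bexI[of _ "v @ l'"]) auto
qed

lemma group_free_product: "group P"
proof (rule groupI)
  fix x y assume "x \<in> carrier P" "y \<in> carrier P"
  then show "x \<otimes>\<^bsub>P\<^esub> y \<in> carrier P"
    by (auto simp: carrier_P mult_P)
next
  show "\<one>\<^bsub>P\<^esub> \<in> carrier P"
    by (simp add: one_P)
next
  fix x y z assume "x \<in> carrier P" "y \<in> carrier P" "z \<in> carrier P"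
  then show "x \<otimes>\<^bsub>P\<^esub> y \<otimes>\<^bsub>P\<^esub> z = x \<otimes>\<^bsub>P\<^esub> (y \<otimes>\<^bsub>P\<^esub> z)"
    by (auto simp: carrier_P mult_P)
next
  fix x assume "x \<in> carrier P"
  then show "\<one>\<^bsub>P\<^esub> \<otimes>\<^bsub>P\<^esub> x = x"
    by (auto simp: carrier_P mult_P one_P)
next
  fix x assume "x \<in> carrier P"
  then obtain u where u: "u \<in> words" "x = cls u"
    by (auto simp: carrier_P)
  then obtain v where v: "v \<in> words" "(v @ u, []) \<in> rel"
    using rel_inverse_exists by blast
  then show "\<exists>y\<in>carrier P. y \<otimes>\<^bsub>P\<^esub> x = \<one>\<^bsub>P\<^esub>"
    using u by (intro bexI[of _ "cls v"]) (auto simp: mult_P one_P cls_eq_iff)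
qed

lemma Inl_hom: "(\<lambda>x. cls [Inl x]) \<in> hom A P"
proof (rule homI)
  fix x y assume "x \<in> carrier A" "y \<in> carrier A"
  then show "cls [Inl (x \<otimes>\<^bsub>A\<^esub> y)] = cls [Inl x] \<otimes>\<^bsub>P\<^esub> cls [Inl y]"
    using free_product_rel.mult_left[of "[]" A B "[]" x y, THEN free_product_rel.sym]
    by (simp add: mult_P cls_eq_iff)
qed simp

lemma Inr_hom: "(\<lambda>x. cls [Inr x]) \<in> hom B P"
proof (rule homI)
  fix x y assume "x \<in> carrier B" "y \<in> carrier B"
  then show "cls [Inr (x \<otimes>\<^bsub>B\<^esub> y)] = cls [Inr x] \<otimes>\<^bsub>P\<^esub> cls [Inr y]"
    using free_product_rel.mult_right[of "[]" A B "[]" x y, THEN free_product_rel.sym]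
    by (simp add: mult_P cls_eq_iff)
qed simp

lemma generate_P: "generate P ((\<lambda>x. cls [Inl x]) ` carrier A \<union> (\<lambda>x. cls [Inr x]) ` carrier B) = carrier P"
  (is "generate P ?S = _")
proof
  show "generate P ?S \<subseteq> carrier P"
    by (rule group.generate_incl[OF group_free_product]) auto
  have "cls u \<in> generate P ?S" if "u \<in> words" for u
    using that
  proof (induction u)
    case Nil
    then show ?case using generate.one[of P] by (simp add: one_P)
  next
    case (Cons l u)
    have l: "[l] \<in> words" "u \<in> words"
      using Cons by (cases l; simp)+
    have "cls [l] \<in> generate P ?S"
      using Cons by (cases l) (auto intro!: generate.incl)
    then have "cls [l] \<otimes>\<^bsub>P\<^esub> cls u \<in> generate P ?S"
      using Cons l by (intro generate.eng) auto
    then show ?case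
      using l by (simp add: mult_P)
  qed
  then show "carrier P \<subseteq> generate P ?S"
    by (auto simp: carrier_P)
qed

context
  fixes K :: "('c, 'k) monoid_scheme" and f h
  assumes K: "group K" and f: "f \<in> hom A K" and h: "h \<in> hom B K"
begin

interpretation K: group K by (rule K)
interpretation f: group_hom A K f by unfold_locales (rule f)
interpretation h: group_hom B K h by unfold_locales (rule h)

lemma eval_word_closed [simp]: "u \<in> words \<Longrightarrow> eval_word K f h u \<in> carrier K"
proof (induction u)
  case (Cons l u)
  then show ?case by (cases l) (auto simp: eval_word_def)
qed (simp add: eval_word_def)

lemma eval_word_append:
  "u \<in> words \<Longrightarrow> v \<in> words \<Longrightarrow> eval_word K f h (u @ v) = eval_word K f h u \<otimes>\<^bsub>K\<^esub> eval_word K f h v"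
proof (induction u)
  case Nil
  then show ?case using eval_word_closed[of v] by (simp add: eval_word_def)
next
  case (Cons l u)
  then show ?case
    using eval_word_closed[of v] eval_word_closed[of u]
    by (cases l) (auto simp: eval_word_def K.m_assoc)
qed

lemma eval_word_rel: "(u, v) \<in> rel \<Longrightarrow> eval_word K f h u = eval_word K f h v"
proof (induction rule: free_product_rel.induct)
  case (mult_left u v x y)
  then have "eval_word K f h [Inl x, Inl y] = eval_word K f h [Inl (x \<otimes>\<^bsub>A\<^esub> y)]"
    by (simp add: eval_word_def)
  then show ?case using mult_left by (simp add: eval_word_append del: append_Cons)
next
  case (mult_right u v x y)
  then have "eval_word K f h [Inr x, Inr y] = eval_word K f h [Inr (x \<otimes>\<^bsub>B\<^esub> y)]"
    by (simp add: eval_word_def)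
  then show ?case using mult_right by (simp add: eval_word_append del: append_Cons)
next
  case (one_left u v)
  have "eval_word K f h [Inl \<one>\<^bsub>A\<^esub>] = \<one>\<^bsub>K\<^esub>"
    by (simp add: eval_word_def)
  then show ?case using one_left by (simp add: eval_word_append del: append_Cons)
next
  case (one_right u v)
  have "eval_word K f h [Inr \<one>\<^bsub>B\<^esub>] = \<one>\<^bsub>K\<^esub>"
    by (simp add: eval_word_def)
  then show ?case using one_right by (simp add: eval_word_append del: append_Cons)
qed auto

lemma free_product_lift_cls:
  assumes "u \<in> words"
  shows "free_product_lift K f h (cls u) = eval_word K f h u"
proof -
  have "eval_word K f h ` cls u = {eval_word K f h u}"
    using assms eval_word_rel free_product_rel.refl by (fastforce simp: free_product_class_def)
  then show ?thesis
    by (simp add: free_product_lift_def)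
qed

lemma free_product_lift_hom: "free_product_lift K f h \<in> hom P K"
proof (rule homI)
  fix x y assume "x \<in> carrier P" "y \<in> carrier P"
  then show "free_product_lift K f h (x \<otimes>\<^bsub>P\<^esub> y)
      = free_product_lift K f h x \<otimes>\<^bsub>K\<^esub> free_product_lift K f h y"
    by (auto simp: carrier_P mult_P free_product_lift_cls eval_word_append)
qed (auto simp: carrier_P free_product_lift_cls)

lemma free_product_lift_Inl: "x \<in> carrier A \<Longrightarrow> free_product_lift K f h (cls [Inl x]) = f x"
  by (subst free_product_lift_cls) (auto simp: eval_word_def)

lemma free_product_lift_Inr: "x \<in> carrier B \<Longrightarrow> free_product_lift K f h (cls [Inr x]) = h x"
  by (subst free_product_lift_cls) (auto simp: eval_word_def)

end

end

section \<open>Normal closures and maps induced on quotient groups\<close>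

lemma (in group) normal_closure_normal:
  assumes S: "S \<subseteq> carrier G"
  shows "normal_closure G S \<lhd> G"
  unfolding normal_closure_def
proof (rule normal_generateI)
  show "(\<Union>g\<in>carrier G. (\<lambda>s. g \<otimes> s \<otimes> inv g) ` S) \<subseteq> carrier G"
    using S by auto
  fix h g assume "h \<in> (\<Union>g\<in>carrier G. (\<lambda>s. g \<otimes> s \<otimes> inv g) ` S)" and g: "g \<in> carrier G"
  then obtain k s where ks: "k \<in> carrier G" "s \<in> S" "h = k \<otimes> s \<otimes> inv k"
    by blast
  then have "g \<otimes> h \<otimes> inv g = (g \<otimes> k) \<otimes> s \<otimes> inv (g \<otimes> k)"
    using S g by (auto simp: m_assoc inv_mult_group subset_iff)
  then show "g \<otimes> h \<otimes> inv g \<in> (\<Union>g\<in>carrier G. (\<lambda>s. g \<otimes> s \<otimes> inv g) ` S)"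
    using ks g by blast
qed

lemma (in group) subset_normal_closure:
  assumes "S \<subseteq> carrier G"
  shows "S \<subseteq> normal_closure G S"
proof
  fix s assume "s \<in> S"
  then have "s = \<one> \<otimes> s \<otimes> inv \<one>"
    using assms by auto
  then show "s \<in> normal_closure G S"
    unfolding normal_closure_def using \<open>s \<in> S\<close> by (intro generate.incl) blast
qed

lemma (in group_hom) normal_closure_subset_kernel:
  assumes "S \<subseteq> kernel G H h"
  shows "normal_closure G S \<subseteq> kernel G H h"
  unfolding normal_closure_def
proof (rule G.generate_subgroup_incl[OF _ subgroup_kernel])
  show "(\<Union>g\<in>carrier G. (\<lambda>s. g \<otimes> s \<otimes> inv g) ` S) \<subseteq> kernel G H h"
    using assms G.subgroup_conj_closed[OF normal_kernel] by blast
qed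

text \<open>A homomorphism that kills N is constant on the cosets of N, so maps defined through
  \<open>the_elem\<close> take the expected values.\<close>

lemma (in group_hom) the_elem_image_coset:
  assumes N: "N \<lhd> G" "N \<subseteq> kernel G H h" and x: "x \<in> carrier G"
  shows "the_elem (h ` (N #> x)) = h x"
proof -
  have "h ` (N #> x) = {h x}"
  proof -
    have "h (n \<otimes> x) = h x" if "n \<in> N" for n
      using that N x by (auto simp: kernel_def subset_iff)
    moreover have "\<one> \<in> N"
      using normal_imp_subgroup[OF N(1)] by (rule subgroup.one_closed)
    ultimately show ?thesis
      by (auto simp: r_coset_def intro!: image_eqI[of _ h "\<one> \<otimes> x"] bexI[of _ \<one>])
  qed
  then show ?thesis by simp
qed

lemma (in group_hom) the_elem_image_coset_hom:
  assumes N: "N \<lhd> G" "N \<subseteq> kernel G H h"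
  shows "(\<lambda>C. the_elem (h ` C)) \<in> hom (G Mod N) H"
proof (rule homI)
  fix C D assume "C \<in> carrier (G Mod N)" "D \<in> carrier (G Mod N)"
  then obtain x y where "x \<in> carrier G" "y \<in> carrier G" "C = N #> x" "D = N #> y"
    by (auto simp: carrier_FactGroup)
  then show "the_elem (h ` (C \<otimes>\<^bsub>G Mod N\<^esub> D)) = the_elem (h ` C) \<otimes>\<^bsub>H\<^esub> the_elem (h ` D)"
    using the_elem_image_coset[OF N] by (simp add: normal.rcos_sum[OF N(1)])
qed (auto simp: carrier_FactGroup the_elem_image_coset[OF N])

section \<open>The group X(G) and its universal property\<close>

locale weak_comm_group = group G for G :: "('a, 'm) monoid_scheme" (structure)
begin

sublocale group_pair G G
  by unfold_locales

definition "\<alpha> g = normal_closure P (weak_comm_relators G) #>\<^bsub>P\<^esub> cls [Inl g]"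
definition "\<beta> g = normal_closure P (weak_comm_relators G) #>\<^bsub>P\<^esub> cls [Inr g]"

sublocale P: group P
  by (rule group_free_product)

lemma relators_carrier: "weak_comm_relators G \<subseteq> carrier P"
  by (auto simp: weak_comm_relators_def)

sublocale R: normal "normal_closure P (weak_comm_relators G)" P
  using relators_carrier by (rule P.normal_closure_normal)

lemma weak_comm_eq: "\<XX> G = P Mod normal_closure P (weak_comm_relators G)"
  by (simp add: weak_comm_def)

lemma proj_hom: "(\<lambda>x. normal_closure P (weak_comm_relators G) #>\<^bsub>P\<^esub> x) \<in> hom P (\<XX> G)"
  unfolding weak_comm_eq by (rule R.r_coset_hom_Mod)

sublocale X: group "\<XX> G"
  unfolding weak_comm_eq by (rule R.factorgroup_is_group)

lemma alpha_hom: "\<alpha> \<in> hom G (\<XX> G)"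
  using Group.hom_compose[OF Inl_hom proj_hom] by (simp add: \<alpha>_def[abs_def] comp_def)

lemma beta_hom: "\<beta> \<in> hom G (\<XX> G)"
  using Group.hom_compose[OF Inr_hom proj_hom] by (simp add: \<beta>_def[abs_def] comp_def)

lemma alpha_beta_commute:
  assumes "g \<in> carrier G"
  shows "\<alpha> g \<otimes>\<^bsub>\<XX> G\<^esub> \<beta> g = \<beta> g \<otimes>\<^bsub>\<XX> G\<^esub> \<alpha> g"
proof -
  let ?a = "cls [Inl g]" and ?b = "cls [Inr g]"
  interpret pr: group_hom P "\<XX> G" "\<lambda>x. normal_closure P (weak_comm_relators G) #>\<^bsub>P\<^esub> x"
    by unfold_locales (rule proj_hom)
  have "commutator_elem P ?a ?b \<in> normal_closure P (weak_comm_relators G)"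
    using assms P.subset_normal_closure[OF relators_carrier] by (auto simp: weak_comm_relators_def)
  then have "normal_closure P (weak_comm_relators G) #>\<^bsub>P\<^esub> commutator_elem P ?a ?b = \<one>\<^bsub>\<XX> G\<^esub>"
    by (simp add: weak_comm_eq R.rcos_const[OF P.is_group])
  then have "commutator_elem (\<XX> G) (\<alpha> g) (\<beta> g) = \<one>\<^bsub>\<XX> G\<^esub>"
    using assms by (simp add: commutator_elem_def \<alpha>_def \<beta>_def)
  moreover have "\<alpha> g \<in> carrier (\<XX> G)" "\<beta> g \<in> carrier (\<XX> G)"
    using alpha_hom beta_hom assms by (auto simp: hom_in_carrier)
  ultimately show ?thesis
    using X.commutator_eq_one_iff by blast
qed

lemma generate_alpha_beta: "generate (\<XX> G) (\<alpha> ` carrier G \<union> \<beta> ` carrier G) = carrier (\<XX> G)"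
proof -
  let ?pr = "\<lambda>x. normal_closure P (weak_comm_relators G) #>\<^bsub>P\<^esub> x"
  let ?S = "(\<lambda>x. cls [Inl x]) ` carrier G \<union> (\<lambda>x. cls [Inr x]) ` carrier G"
  interpret pr: group_hom P "\<XX> G" ?pr
    by unfold_locales (rule proj_hom)
  have "generate (\<XX> G) (?pr ` ?S) = ?pr ` generate P ?S"
    by (rule pr.generate_img) auto
  also have "\<dots> = carrier (\<XX> G)"
    unfolding generate_P by (simp add: weak_comm_eq carrier_FactGroup)
  finally show ?thesis
    by (simp add: image_Un image_image \<alpha>_def[abs_def] \<beta>_def[abs_def])
qed

text \<open>The universal property of X(G): \<open>commute\<close> ensures that the lift from the
  free product kills the relators, hence their normal closure.\<close>

lemma weak_comm_lift:
  assumes K: "group K" and f: "f \<in> hom G K" and h: "h \<in> hom G K"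
    and commute: "\<And>g. g \<in> carrier G \<Longrightarrow> f g \<otimes>\<^bsub>K\<^esub> h g = h g \<otimes>\<^bsub>K\<^esub> f g"
  shows weak_comm_lift_hom: "weak_comm_lift K f h \<in> hom (\<XX> G) K"
    and weak_comm_lift_alpha: "\<And>g. g \<in> carrier G \<Longrightarrow> weak_comm_lift K f h (\<alpha> g) = f g"
    and weak_comm_lift_beta: "\<And>g. g \<in> carrier G \<Longrightarrow> weak_comm_lift K f h (\<beta> g) = h g"
proof -
  interpret K: group K by fact
  interpret lift: group_hom P K "free_product_lift K f h"
    by unfold_locales (rule free_product_lift_hom[OF K f h])
  have "weak_comm_relators G \<subseteq> kernel P K (free_product_lift K f h)"
  proof
    fix x assume "x \<in> weak_comm_relators G"
    then obtain g where g: "g \<in> carrier G" "x = commutator_elem P (cls [Inl g]) (cls [Inr g])"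
      by (auto simp: weak_comm_relators_def)
    then have "free_product_lift K f h x = commutator_elem K (f g) (h g)"
      by (simp add: commutator_elem_def free_product_lift_Inl[OF K f h] free_product_lift_Inr[OF K f h])
    also have "\<dots> = \<one>\<^bsub>K\<^esub>"
      using g commute f h by (intro K.commutator_eq_one) (auto simp: hom_in_carrier)
    finally show "x \<in> kernel P K (free_product_lift K f h)"
      using g by (simp add: kernel_def)
  qed
  then have sub: "normal_closure P (weak_comm_relators G) \<subseteq> kernel P K (free_product_lift K f h)"
    by (rule lift.normal_closure_subset_kernel)
  show "weak_comm_lift K f h \<in> hom (\<XX> G) K"
    unfolding weak_comm_eq weak_comm_lift_def[abs_def]
    using R.normal_axioms sub by (rule lift.the_elem_image_coset_hom)
  fix g assume g: "g \<in> carrier G"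
  show "weak_comm_lift K f h (\<alpha> g) = f g"
    unfolding \<alpha>_def weak_comm_lift_def
    using lift.the_elem_image_coset[OF R.normal_axioms sub, of "cls [Inl g]"] g
    by (simp add: free_product_lift_Inl[OF K f h])
  show "weak_comm_lift K f h (\<beta> g) = h g"
    unfolding \<beta>_def weak_comm_lift_def
    using lift.the_elem_image_coset[OF R.normal_axioms sub, of "cls [Inr g]"] g
    by (simp add: free_product_lift_Inr[OF K f h])
qed

lemma to_prod:
  shows to_prod_hom: "weak_comm_to_prod G \<in> hom (\<XX> G) (G \<times>\<times> G)"
    and to_prod_alpha: "\<And>g. g \<in> carrier G \<Longrightarrow> weak_comm_to_prod G (\<alpha> g) = (g, \<one>)"
    and to_prod_beta: "\<And>g. g \<in> carrier G \<Longrightarrow> weak_comm_to_prod G (\<beta> g) = (\<one>, g)"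
proof -
  have *: "group (G \<times>\<times> G)" "(\<lambda>g. (g, \<one>)) \<in> hom G (G \<times>\<times> G)" "(\<lambda>g. (\<one>, g)) \<in> hom G (G \<times>\<times> G)"
    by (auto intro: DirProd_group is_group simp: hom_def)
  show "weak_comm_to_prod G \<in> hom (\<XX> G) (G \<times>\<times> G)"
    unfolding weak_comm_to_prod_def by (rule weak_comm_lift_hom[OF *]) auto
  show "weak_comm_to_prod G (\<alpha> g) = (g, \<one>)" if "g \<in> carrier G" for g
    unfolding weak_comm_to_prod_def by (rule weak_comm_lift_alpha[OF *]) (use that in auto)
  show "weak_comm_to_prod G (\<beta> g) = (\<one>, g)" if "g \<in> carrier G" for g
    unfolding weak_comm_to_prod_def by (rule weak_comm_lift_beta[OF *]) (use that in auto)
qed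

lemma fold_hom: "weak_comm_fold G \<in> hom (\<XX> G) G"
  and fold_alpha: "g \<in> carrier G \<Longrightarrow> weak_comm_fold G (\<alpha> g) = g"
  and fold_beta: "g \<in> carrier G \<Longrightarrow> weak_comm_fold G (\<beta> g) = g"
  unfolding weak_comm_fold_def
  by (rule weak_comm_lift_hom weak_comm_lift_alpha weak_comm_lift_beta; auto simp: hom_def)+

text \<open>Taking for p and q the coordinates of the map to G \<times> G makes the abstract D, L
  and W coincide with the kernels in the definitions.\<close>

sublocale weakly_commuting "\<XX> G" G \<alpha> \<beta> "fst \<circ> weak_comm_to_prod G" "snd \<circ> weak_comm_to_prod G" "weak_comm_fold G"
proof unfold_locales
  have "fst \<in> hom (G \<times>\<times> G) G" "snd \<in> hom (G \<times>\<times> G) G"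
    by (auto simp: hom_def DirProd_def)
  then show "fst \<circ> weak_comm_to_prod G \<in> hom (\<XX> G) G" "snd \<circ> weak_comm_to_prod G \<in> hom (\<XX> G) G"
    using Group.hom_compose[OF to_prod_hom] by blast+
qed (simp_all add: alpha_hom beta_hom fold_hom fold_alpha fold_beta to_prod_alpha to_prod_beta
    alpha_beta_commute generate_alpha_beta)

lemma weak_comm_L_eq: "weak_comm_L G = L"
  unfolding weak_comm_L_def L_def kernel_def ..

lemma weak_comm_D_eq: "weak_comm_D G = D"
  unfolding weak_comm_D_def D_def kernel_def DirProd_def by (simp add: prod_eq_iff)

lemma weak_comm_W_eq: "weak_comm_W G = W"
  unfolding weak_comm_W_def W_def weak_comm_L_eq weak_comm_D_eq ..

end

section \<open>Tensor products, coinvariants and modules\<close>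

context group
begin

lemma induced_on_cosets:
  assumes N: "N \<lhd> G" and f: "f \<in> hom G G" "f ` N \<subseteq> N"
  shows induced_on_cosets_coset: "\<And>x. x \<in> carrier G \<Longrightarrow> induced_on_cosets G N f (N #> x) = N #> f x"
    and induced_on_cosets_hom: "induced_on_cosets G N f \<in> hom (G Mod N) (G Mod N)"
proof -
  interpret N: normal N G by fact
  interpret h: group_hom G "G Mod N" "\<lambda>x. N #> f x"
    using Group.hom_compose[OF f(1) N.r_coset_hom_Mod] N.factorgroup_is_group
    by (auto simp: group_hom_def group_hom_axioms_def comp_def)
  have "N \<subseteq> kernel G (G Mod N) (\<lambda>x. N #> f x)"
    using f(2) by (auto simp: kernel_def intro!: N.rcos_const)
  note * = h.the_elem_image_coset[OF N this] h.the_elem_image_coset_hom[OF N this]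
  show "induced_on_cosets G N f (N #> x) = N #> f x" if "x \<in> carrier G" for x
    unfolding induced_on_cosets_def using that by (rule *)
  show "induced_on_cosets G N f \<in> hom (G Mod N) (G Mod N)"
    using *(2) by (simp add: induced_on_cosets_def[abs_def])
qed

end

lemma (in group_hom) hom_generate_subset:
  assumes "S \<subseteq> carrier G" "h ` S \<subseteq> T" "T \<subseteq> carrier H"
  shows "h ` generate G S \<subseteq> generate H T"
  using generate_img[OF assms(1)] H.mono_generate[OF assms(2)] by simp

lemma hom_eq_on_generate:
  assumes "group_hom G H f" "group_hom G H h" "S \<subseteq> carrier G"
    and eq: "\<And>s. s \<in> S \<Longrightarrow> f s = h s" and x: "x \<in> generate G S"
  shows "f x = h x"
proof -
  interpret f: group_hom G H f by fact
  interpret h: group_hom G H h by fact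
  note S = subsetD[OF assms(3)] f.G.generate_in_carrier[OF assms(3)]
  show ?thesis
    using x by (induction rule: generate.induct) (simp_all add: eq S)
qed

lemma generate_free_Abelian_group:
  "generate (free_Abelian_group S) (frag_of ` S) = carrier (free_Abelian_group S)"
proof -
  interpret F: group "free_Abelian_group S" by simp
  have sub: "subgroup (generate (free_Abelian_group S) (frag_of ` S)) (free_Abelian_group S)"
    by (rule F.generate_is_subgroup) auto
  have "x \<in> generate (free_Abelian_group S) (frag_of ` S)" if "Poly_Mapping.keys x \<subseteq> S" for x
  proof (rule free_Abelian_group_induct[OF that])
    let ?N = "generate (free_Abelian_group S) (frag_of ` S)"
    show "0 \<in> ?N"
      using subgroup.one_closed[OF sub] by simp
    show "x - y \<in> ?N" if "Poly_Mapping.keys y \<subseteq> S" "x \<in> ?N" "y \<in> ?N" for x y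
      using that subgroup.m_closed[OF sub _ subgroup.m_inv_closed[OF sub], of x y] by simp
    show "frag_of a \<in> ?N" if "a \<in> S" for a
      using that by (auto intro: generate.incl)
  qed
  then show ?thesis
    using subgroup.subset[OF sub] by auto
qed

section \<open>Tensor products of abelian groups\<close>

locale tensor = A: comm_group A + B: comm_group B
  for A :: "('a, 'm) monoid_scheme" and B :: "('b, 'n) monoid_scheme"
begin

abbreviation "F \<equiv> free_Abelian_group (carrier A \<times> carrier B)"
abbreviation "Rel \<equiv> tensor_relations A B"
abbreviation "T \<equiv> tensor_product A B"

sublocale F: comm_group F
  by (rule abelian_free_Abelian_group)

definition "relators =
  {frag_of (a \<otimes>\<^bsub>A\<^esub> a', b) - frag_of (a, b) - frag_of (a', b) | a a' b.
     a \<in> carrier A \<and> a' \<in> carrier A \<and> b \<in> carrier B} \<union>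
  {frag_of (a, b \<otimes>\<^bsub>B\<^esub> b') - frag_of (a, b) - frag_of (a, b') | a b b'.
     a \<in> carrier A \<and> b \<in> carrier B \<and> b' \<in> carrier B}"

lemma Rel_eq: "Rel = generate F relators"
  by (simp add: tensor_relations_def relators_def)

lemma diff_closed: "x \<in> carrier F \<Longrightarrow> y \<in> carrier F \<Longrightarrow> x - y \<in> carrier F"
  using F.m_closed[OF _ F.inv_closed, of x y] by simp

lemma relators_carrier: "relators \<subseteq> carrier F"
  unfolding relators_def by (auto simp del: carrier_free_Abelian_group_iff intro!: diff_closed)

sublocale Rel: normal Rel F
  using F.generate_is_subgroup[OF relators_carrier] by (simp add: Rel_eq F.normal_iff_subgroup)

lemma T_eq: "T = F Mod Rel"
  by (simp add: tensor_product_def)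

sublocale T: comm_group T
  unfolding T_eq by (rule F.abelian_FactGroup) (rule Rel.subgroup_axioms)

definition "pure a b = Rel #>\<^bsub>F\<^esub> frag_of (a, b)"

lemma pure_closed [simp]: "a \<in> carrier A \<Longrightarrow> b \<in> carrier B \<Longrightarrow> pure a b \<in> carrier T"
  by (auto simp: T_eq carrier_FactGroup pure_def)

lemma generate_T: "generate T ((\<lambda>(a, b). pure a b) ` (carrier A \<times> carrier B)) = carrier T"
proof -
  interpret pr: group_hom F T "\<lambda>x. Rel #>\<^bsub>F\<^esub> x"
    using Rel.r_coset_hom_Mod by unfold_locales (simp add: T_eq)
  have "generate T ((\<lambda>x. Rel #>\<^bsub>F\<^esub> x) ` (frag_of ` (carrier A \<times> carrier B)))
      = (\<lambda>x. Rel #>\<^bsub>F\<^esub> x) ` generate F (frag_of ` (carrier A \<times> carrier B))"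
    by (rule pr.generate_img) auto
  also have "\<dots> = carrier T"
    by (simp add: generate_free_Abelian_group T_eq carrier_FactGroup)
  finally show ?thesis
    by (simp add: image_image pure_def case_prod_unfold)
qed

lemma hom_T_eqI:
  assumes "group V" "f \<in> hom T V" "h \<in> hom T V"
    and "\<And>a b. a \<in> carrier A \<Longrightarrow> b \<in> carrier B \<Longrightarrow> f (pure a b) = h (pure a b)"
    and "t \<in> carrier T"
  shows "f t = h t"
proof (rule hom_eq_on_generate[where G = T and H = V and f = f and h = h])
  show "group_hom T V f" "group_hom T V h"
    using assms T.is_group by (auto simp: group_hom_def group_hom_axioms_def)
  show "t \<in> generate T ((\<lambda>(a, b). pure a b) ` (carrier A \<times> carrier B))"
    unfolding generate_T by fact
qed (use assms in auto)

text \<open>f extends to the free abelian group on pairs, and bilinearity says precisely that the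
  extension kills \<open>relators\<close>.\<close>

lemma universal:
  assumes V: "comm_group V"
    and closed: "\<And>a b. a \<in> carrier A \<Longrightarrow> b \<in> carrier B \<Longrightarrow> f a b \<in> carrier V"
    and left: "\<And>a a' b. a \<in> carrier A \<Longrightarrow> a' \<in> carrier A \<Longrightarrow> b \<in> carrier B \<Longrightarrow>
      f (a \<otimes>\<^bsub>A\<^esub> a') b = f a b \<otimes>\<^bsub>V\<^esub> f a' b"
    and right: "\<And>a b b'. a \<in> carrier A \<Longrightarrow> b \<in> carrier B \<Longrightarrow> b' \<in> carrier B \<Longrightarrow>
      f a (b \<otimes>\<^bsub>B\<^esub> b') = f a b \<otimes>\<^bsub>V\<^esub> f a b'"
  obtains \<phi> where "\<phi> \<in> hom T V"
    "\<And>a b. a \<in> carrier A \<Longrightarrow> b \<in> carrier B \<Longrightarrow> \<phi> (pure a b) = f a b"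
proof -
  interpret V: comm_group V by fact
  obtain h where h: "h \<in> hom F V" "\<And>x. x \<in> carrier A \<times> carrier B \<Longrightarrow> h (frag_of x) = (\<lambda>(a, b). f a b) x"
    by (rule V.free_Abelian_group_universal[of "\<lambda>(a, b). f a b" "carrier A \<times> carrier B"])
      (use closed in auto)
  interpret h: group_hom F V h
    using h(1) by unfold_locales
  have h_diff: "h (x - y - z) = h x \<otimes>\<^bsub>V\<^esub> inv\<^bsub>V\<^esub> h y \<otimes>\<^bsub>V\<^esub> inv\<^bsub>V\<^esub> h z"
    if xyz: "x \<in> carrier F" "y \<in> carrier F" "z \<in> carrier F" for x y z
  proof -
    have "x - y - z = x \<otimes>\<^bsub>F\<^esub> inv\<^bsub>F\<^esub> y \<otimes>\<^bsub>F\<^esub> inv\<^bsub>F\<^esub> z"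
      using xyz by simp
    then show ?thesis
      using xyz by (simp del: carrier_free_Abelian_group_iff mult_free_Abelian_group inv_free_Abelian_group)
  qed
  have "relators \<subseteq> kernel F V h"
  proof
    fix x assume x: "x \<in> relators"
    have "h x = \<one>\<^bsub>V\<^esub>"
      using x unfolding relators_def
    proof (elim UnE CollectE exE conjE)
      fix a a' b assume *: "x = frag_of (a \<otimes>\<^bsub>A\<^esub> a', b) - frag_of (a, b) - frag_of (a', b)"
        "a \<in> carrier A" "a' \<in> carrier A" "b \<in> carrier B"
      then have "h x = f (a \<otimes>\<^bsub>A\<^esub> a') b \<otimes>\<^bsub>V\<^esub> inv\<^bsub>V\<^esub> f a b \<otimes>\<^bsub>V\<^esub> inv\<^bsub>V\<^esub> f a' b"
        by (simp add: h_diff h(2))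
      then show ?thesis
        using * closed by (simp add: left V.m_ac)
    next
      fix a b b' assume *: "x = frag_of (a, b \<otimes>\<^bsub>B\<^esub> b') - frag_of (a, b) - frag_of (a, b')"
        "a \<in> carrier A" "b \<in> carrier B" "b' \<in> carrier B"
      then have "h x = f a (b \<otimes>\<^bsub>B\<^esub> b') \<otimes>\<^bsub>V\<^esub> inv\<^bsub>V\<^esub> f a b \<otimes>\<^bsub>V\<^esub> inv\<^bsub>V\<^esub> f a b'"
        by (simp add: h_diff h(2))
      then show ?thesis
        using * closed by (simp add: right V.m_ac)
    qed
    then show "x \<in> kernel F V h"
      using x relators_carrier unfolding kernel_def by blast
  qed
  then have "Rel \<subseteq> kernel F V h"
    unfolding Rel_eq using F.generate_subgroup_incl h.subgroup_kernel by blast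
  then obtain \<phi> where \<phi>: "\<phi> \<in> hom T V" "\<And>x. x \<in> carrier F \<Longrightarrow> \<phi> (Rel #>\<^bsub>F\<^esub> x) = h x"
    unfolding T_eq using h.FactGroup_universal_kernel[OF Rel.normal_axioms] by metis
  show thesis
    by (rule that[OF \<phi>(1)]) (simp add: pure_def \<phi>(2) h(2))
qed

text \<open>As f and g are homomorphisms, the map on pairs sends relators to relators and so passes
  to cosets of \<open>Rel\<close>.\<close>

lemma tensor_map:
  assumes f: "f \<in> hom A A" and g: "g \<in> hom B B"
  shows tensor_map_hom: "tensor_map A B f g \<in> hom T T"
    and tensor_map_pure: "\<And>a b. a \<in> carrier A \<Longrightarrow> b \<in> carrier B \<Longrightarrow>
      tensor_map A B f g (pure a b) = pure (f a) (g b)"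
proof -
  define h where "h = frag_extend (\<lambda>(a, b). frag_of (f a, g b))"
  have h_of: "h (frag_of (a, b)) = frag_of (f a, g b)" for a b
    by (simp add: h_def)
  have [simp]: "f a \<in> carrier A" if "a \<in> carrier A" for a
    using that f by (simp add: hom_in_carrier)
  have [simp]: "g b \<in> carrier B" if "b \<in> carrier B" for b
    using that g by (simp add: hom_in_carrier)
  have "h \<in> hom F F"
  proof (rule homI)
    fix x assume "x \<in> carrier F"
    then show "h x \<in> carrier F"
      unfolding h_def using keys_frag_extend[of "\<lambda>(a, b). frag_of (f a, g b)" x]
      by (fastforce split: prod.splits)
  qed (simp add: h_def frag_extend_add)
  then interpret h: group_hom F F h
    by unfold_locales
  have "h ` relators \<subseteq> relators"
  proof
    fix x assume "x \<in> h ` relators"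
    then obtain y where y: "y \<in> relators" "x = h y"
      by blast
    have h_diff: "h (u - v) = h u - h v" for u v
      by (simp add: h_def frag_extend_diff)
    show "x \<in> relators"
      using y(1) unfolding relators_def
    proof (elim UnE CollectE exE conjE)
      fix a a' b assume "y = frag_of (a \<otimes>\<^bsub>A\<^esub> a', b) - frag_of (a, b) - frag_of (a', b)"
        and *: "a \<in> carrier A" "a' \<in> carrier A" "b \<in> carrier B"
      then have "x = frag_of (f a \<otimes>\<^bsub>A\<^esub> f a', g b) - frag_of (f a, g b) - frag_of (f a', g b)"
        using y(2) hom_mult[OF f] by (simp add: h_diff h_of)
      moreover have "f a \<in> carrier A" "f a' \<in> carrier A" "g b \<in> carrier B"
        using * by simp_all
      ultimately show "x \<in> {frag_of (a \<otimes>\<^bsub>A\<^esub> a', b) - frag_of (a, b) - frag_of (a', b) | a a' b.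
          a \<in> carrier A \<and> a' \<in> carrier A \<and> b \<in> carrier B} \<union>
          {frag_of (a, b \<otimes>\<^bsub>B\<^esub> b') - frag_of (a, b) - frag_of (a, b') | a b b'.
          a \<in> carrier A \<and> b \<in> carrier B \<and> b' \<in> carrier B}"
        by blast
    next
      fix a b b' assume "y = frag_of (a, b \<otimes>\<^bsub>B\<^esub> b') - frag_of (a, b) - frag_of (a, b')"
        and *: "a \<in> carrier A" "b \<in> carrier B" "b' \<in> carrier B"
      then have "x = frag_of (f a, g b \<otimes>\<^bsub>B\<^esub> g b') - frag_of (f a, g b) - frag_of (f a, g b')"
        using y(2) hom_mult[OF g] by (simp add: h_diff h_of)
      moreover have "f a \<in> carrier A" "g b \<in> carrier B" "g b' \<in> carrier B"
        using * by simp_all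
      ultimately show "x \<in> {frag_of (a \<otimes>\<^bsub>A\<^esub> a', b) - frag_of (a, b) - frag_of (a', b) | a a' b.
          a \<in> carrier A \<and> a' \<in> carrier A \<and> b \<in> carrier B} \<union>
          {frag_of (a, b \<otimes>\<^bsub>B\<^esub> b') - frag_of (a, b) - frag_of (a, b') | a b b'.
          a \<in> carrier A \<and> b \<in> carrier B \<and> b' \<in> carrier B}"
        by blast
    qed
  qed
  then have hRel: "h ` Rel \<subseteq> Rel"
    unfolding Rel_eq using relators_carrier by (rule_tac h.hom_generate_subset)
  note * = F.induced_on_cosets[OF Rel.normal_axioms h.homh hRel]
  have map_eq: "tensor_map A B f g = induced_on_cosets F Rel h"
    by (simp add: tensor_map_def h_def)
  show "tensor_map A B f g \<in> hom T T"
    unfolding map_eq T_eq by (rule *(2))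
  show "tensor_map A B f g (pure a b) = pure (f a) (g b)" if "a \<in> carrier A" "b \<in> carrier B" for a b
    unfolding map_eq pure_def using that by (subst *(1)) (auto simp: h_of)
qed

end

section \<open>Coinvariants\<close>

context comm_group
begin

lemma coinvariant_relations_subgroup:
  assumes "\<And>p. p \<in> Q \<Longrightarrow> act p \<in> hom G G"
  shows "subgroup (coinvariant_relations Q G act) G"
  unfolding coinvariant_relations_def
  by (rule generate_is_subgroup) (use hom_in_carrier[OF assms] in auto)

lemma coinvariants_comm_group:
  assumes "\<And>p. p \<in> Q \<Longrightarrow> act p \<in> hom G G"
  shows "comm_group (coinvariants Q G act)"
  unfolding coinvariants_def by (rule abelian_FactGroup[OF coinvariant_relations_subgroup[OF assms]])

text \<open>f sends the relator of p and a to the relator of p and \<open>f a\<close>. This is what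
  lets Q act on M.\<close>

lemma coinvariant_relations_invariant:
  assumes act: "\<And>p. p \<in> Q \<Longrightarrow> act p \<in> hom G G" and f: "f \<in> hom G G"
    and commute: "\<And>p a. p \<in> Q \<Longrightarrow> a \<in> carrier G \<Longrightarrow> f (act p a) = act p (f a)"
  shows "f ` coinvariant_relations Q G act \<subseteq> coinvariant_relations Q G act"
proof -
  interpret f: group_hom G G f
    using f by unfold_locales
  show ?thesis
    unfolding coinvariant_relations_def
  proof (rule f.hom_generate_subset)
    show "f ` {act p a \<otimes> inv a | p a. p \<in> Q \<and> a \<in> carrier G}
        \<subseteq> {act p a \<otimes> inv a | p a. p \<in> Q \<and> a \<in> carrier G}"
    proof clarify
      fix p a assume "p \<in> Q" "a \<in> carrier G"
      then show "\<exists>p' a'. f (act p a \<otimes> inv a) = act p' a' \<otimes> inv a' \<and> p' \<in> Q \<and> a' \<in> carrier G"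
        using hom_in_carrier[OF act, of p] by (intro exI[of _ p] exI[of _ "f a"]) (auto simp: commute)
    qed
  qed (use hom_in_carrier[OF act] in auto)
qed

lemma hom_from_coinvariants:
  assumes act: "\<And>p. p \<in> Q \<Longrightarrow> act p \<in> hom G G" and V: "group V" and f: "f \<in> hom G V"
    and inv: "\<And>p a. p \<in> Q \<Longrightarrow> a \<in> carrier G \<Longrightarrow> f (act p a) = f a"
  obtains \<phi> where "\<phi> \<in> hom (coinvariants Q G act) V"
    "\<And>a. a \<in> carrier G \<Longrightarrow> \<phi> (coinvariant_relations Q G act #> a) = f a"
proof -
  interpret V: group V by fact
  interpret f: group_hom G V f
    using f by unfold_locales
  have normal: "coinvariant_relations Q G act \<lhd> G"
    by (rule subgroup_imp_normal[OF coinvariant_relations_subgroup[OF act]])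
  have "coinvariant_relations Q G act \<subseteq> kernel G V f"
    unfolding coinvariant_relations_def
  proof (rule generate_subgroup_incl[OF _ f.subgroup_kernel], clarify)
    fix p a assume "p \<in> Q" "a \<in> carrier G"
    then show "act p a \<otimes> inv a \<in> kernel G V f"
      using hom_in_carrier[OF act, of p a] inv[of p a] by (simp add: kernel_def)
  qed
  from f.FactGroup_universal_kernel[OF normal this] show thesis
    using that[unfolded coinvariants_def] by metis
qed

end

text \<open>Inverses are determined by carrier, product and unit. This links the additive monoid of
  a module record with the multiplicative group that it comes from.\<close>

lemma subgroup_cong_record:
  assumes "carrier G = carrier K" "monoid.mult G = monoid.mult K" "one G = one K"
  shows "subgroup N G \<longleftrightarrow> subgroup N K"
  unfolding subgroup_def m_inv_def using assms by simp

lemma hom_finprod_comm_group: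
  assumes "comm_group A" "comm_group B" "h \<in> hom A B" "finite I" "\<And>i. i \<in> I \<Longrightarrow> f i \<in> carrier A"
  shows "h (finprod A f I) = finprod B (\<lambda>i. h (f i)) I"
proof -
  interpret A: comm_group A by fact
  interpret B: comm_group B by fact
  interpret h: group_hom A B h
    using assms by unfold_locales
  show ?thesis
    using assms(4,5)
  proof (induction I rule: finite_induct)
    case (insert i I)
    then have f: "f i \<in> carrier A" "f \<in> I \<rightarrow> carrier A" "(\<lambda>i. h (f i)) \<in> I \<rightarrow> carrier B"
      by auto
    have IH: "h (finprod A f I) = finprod B (\<lambda>i. h (f i)) I"
      using insert by blast
    show ?case
      using f insert(1,2) by (simp add: IH)
  qed simp
qed

section \<open>Modules over the integral group ring\<close>

locale hom_action = comm_group A for A :: "('a, 'm) monoid_scheme" (structure) +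
  fixes Q :: "('q, 'n) monoid_scheme" and act :: "'q \<Rightarrow> 'a \<Rightarrow> 'a"
  assumes act_hom: "\<And>q. q \<in> carrier Q \<Longrightarrow> act q \<in> hom A A"
begin

abbreviation "M \<equiv> module_of_action A act"
abbreviation "R \<equiv> group_ring Q"

lemma act_closed [simp]: "q \<in> carrier Q \<Longrightarrow> x \<in> carrier A \<Longrightarrow> act q x \<in> carrier A"
  by (rule hom_in_carrier[OF act_hom])

lemma smult_def: "r \<odot>\<^bsub>M\<^esub> x = (\<Otimes>q\<in>Poly_Mapping.keys r. act q x [^] Poly_Mapping.lookup r q)"
  by (simp add: module_of_action_def)

lemma carrier_R: "r \<in> carrier R \<longleftrightarrow> Poly_Mapping.keys r \<subseteq> carrier Q"
  by (simp add: group_ring_def)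

lemma smult_in_subgroup:
  assumes N: "subgroup N A" "\<And>q x. q \<in> carrier Q \<Longrightarrow> x \<in> N \<Longrightarrow> act q x \<in> N"
    and r: "r \<in> carrier R" "x \<in> N"
  shows "r \<odot>\<^bsub>M\<^esub> x \<in> N"
proof -
  have "(\<Otimes>q\<in>I. act q x [^] Poly_Mapping.lookup r q) \<in> N" if "finite I" "I \<subseteq> carrier Q" for I
    using that
  proof (induction I rule: finite_induct)
    case empty
    then show ?case using subgroup.one_closed[OF N(1)] by simp
  next
    case (insert q I)
    then have "act q x [^] Poly_Mapping.lookup r q \<in> N"
      using N r subgroup_int_pow_closed by simp
    moreover have "x \<in> carrier A"
      using N(1) r(2) by (rule subgroup.mem_carrier)
    ultimately show ?case
      using insert N(1) by (subst finprod_insert) (auto simp: subgroup.m_closed)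
  qed
  then show ?thesis
    using r(1) by (simp add: smult_def carrier_R)
qed

lemma smult_closed [simp]: "r \<in> carrier R \<Longrightarrow> x \<in> carrier A \<Longrightarrow> r \<odot>\<^bsub>M\<^esub> x \<in> carrier A"
  by (rule smult_in_subgroup[OF subgroup_self]) auto

lemma smult_hom:
  assumes r: "r \<in> carrier R"
  shows "(\<lambda>x. r \<odot>\<^bsub>M\<^esub> x) \<in> hom A A"
proof (rule homI)
  fix x y assume xy: "x \<in> carrier A" "y \<in> carrier A"
  have q: "q \<in> carrier Q" if "q \<in> Poly_Mapping.keys r" for q
    using that r by (auto simp: carrier_R)
  have "r \<odot>\<^bsub>M\<^esub> (x \<otimes> y) = (\<Otimes>q\<in>Poly_Mapping.keys r.
      act q x [^] Poly_Mapping.lookup r q \<otimes> act q y [^] Poly_Mapping.lookup r q)"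
    unfolding smult_def using xy q hom_mult[OF act_hom]
    by (intro finprod_cong') (auto simp: int_pow_distrib)
  also have "\<dots> = (r \<odot>\<^bsub>M\<^esub> x) \<otimes> (r \<odot>\<^bsub>M\<^esub> y)"
    unfolding smult_def using xy q by (intro finprod_multf) auto
  finally show "r \<odot>\<^bsub>M\<^esub> (x \<otimes> y) = (r \<odot>\<^bsub>M\<^esub> x) \<otimes> (r \<odot>\<^bsub>M\<^esub> y)" .
qed (use r in simp)

lemma submoduleI:
  assumes N: "subgroup N A" "\<And>q x. q \<in> carrier Q \<Longrightarrow> x \<in> N \<Longrightarrow> act q x \<in> N"
  shows "submodule N R M"
proof
  have "subgroup N (add_monoid M)"
    using N(1) by (subst subgroup_cong_record[where K = A]) (auto simp: module_of_action_def)
  then show "N \<subseteq> carrier (add_monoid M)" "\<one>\<^bsub>add_monoid M\<^esub> \<in> N"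
    "\<And>x y. x \<in> N \<Longrightarrow> y \<in> N \<Longrightarrow> x \<otimes>\<^bsub>add_monoid M\<^esub> y \<in> N"
    "\<And>x. x \<in> N \<Longrightarrow> inv\<^bsub>add_monoid M\<^esub> x \<in> N"
    using subgroup.subset subgroup.one_closed subgroup.m_closed subgroup.m_inv_closed by metis+
qed (rule smult_in_subgroup[OF N])

lemma cosets_eq: "N #>\<^bsub>add_monoid M\<^esub> x = N #> x"
  by (simp add: r_coset_def module_of_action_def)

lemma carrier_M: "carrier M = carrier A"
  by (simp add: module_of_action_def)

lemma carrier_quotient: "carrier (quotient_module M N) = carrier (A Mod N)"
proof -
  have "a_rcosets\<^bsub>M\<^esub> N = (\<Union>x\<in>carrier (add_monoid M). {N #> x})"
    unfolding A_RCOSETS_def RCOSETS_def cosets_eq ..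
  then show ?thesis
    by (auto simp: quotient_module_def carrier_FactGroup carrier_M)
qed

lemma add_quotient: "ring.add (quotient_module M N) = set_mult A"
  by (intro ext) (simp add: quotient_module_def set_add_def set_mult_def module_of_action_def)

lemma zero_quotient: "\<zero>\<^bsub>quotient_module M N\<^esub> = N"
  by (simp add: quotient_module_def)

lemma smult_quotient:
  assumes N: "subgroup N A" "\<And>x. x \<in> N \<Longrightarrow> r \<odot>\<^bsub>M\<^esub> x \<in> N"
    and r: "r \<in> carrier R" "x \<in> carrier A"
  shows "r \<odot>\<^bsub>quotient_module M N\<^esub> (N #> x) = N #> (r \<odot>\<^bsub>M\<^esub> x)"
proof -
  have "r \<odot>\<^bsub>quotient_module M N\<^esub> (N #> x) = induced_on_cosets A N (\<lambda>x. r \<odot>\<^bsub>M\<^esub> x) (N #> x)"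
    by (simp add: quotient_module_def induced_on_cosets_def cosets_eq)
  then show ?thesis
    using induced_on_cosets_coset[OF subgroup_imp_normal[OF N(1)] smult_hom[OF r(1)]] N(2) r(2)
    by auto
qed

lemma frag_of_minus_one:
  assumes "q \<in> carrier Q" "\<one>\<^bsub>Q\<^esub> \<in> carrier Q"
  shows "frag_of q \<ominus>\<^bsub>R\<^esub> \<one>\<^bsub>R\<^esub> = frag_of q - frag_of \<one>\<^bsub>Q\<^esub>"
proof -
  have "inv\<^bsub>add_monoid R\<^esub> frag_of \<one>\<^bsub>Q\<^esub> = inv\<^bsub>free_Abelian_group (carrier Q)\<^esub> frag_of \<one>\<^bsub>Q\<^esub>"
    by (simp add: m_inv_def group_ring_def free_Abelian_group_def)
  also have "\<dots> = - frag_of \<one>\<^bsub>Q\<^esub>"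
    using assms by simp
  finally show ?thesis
    by (simp add: a_minus_def a_inv_def) (simp add: group_ring_def)
qed

lemma smult_frag_of_minus_one:
  assumes q: "q \<in> carrier Q" "\<one>\<^bsub>Q\<^esub> \<in> carrier Q" and one: "act \<one>\<^bsub>Q\<^esub> x = x" and x: "x \<in> carrier A"
  shows "(frag_of q \<ominus>\<^bsub>R\<^esub> \<one>\<^bsub>R\<^esub>) \<odot>\<^bsub>M\<^esub> x = act q x \<otimes> inv x"
\<comment> \<open>For the unit q the ring element is 0 and its support is empty; otherwise the
  support has exactly two elements, with coefficients 1 and -1.\<close>
proof (cases "q = \<one>\<^bsub>Q\<^esub>")
  case True
  then show ?thesis
    using q one x by (simp add: frag_of_minus_one smult_def)
next
  case False
  have lookup: "Poly_Mapping.lookup (frag_of q - frag_of \<one>\<^bsub>Q\<^esub>) k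
      = (if k = q then 1 else if k = \<one>\<^bsub>Q\<^esub> then -1 else 0)" for k
    using False by (simp add: lookup_minus lookup_single when_def)
  then have keys: "Poly_Mapping.keys (frag_of q - frag_of \<one>\<^bsub>Q\<^esub>) = {q, \<one>\<^bsub>Q\<^esub>}"
    by (auto simp: in_keys_iff split: if_splits)
  show ?thesis
    unfolding frag_of_minus_one[OF q] smult_def keys
    using False q x one by (subst finprod_insert) (auto simp: lookup int_pow_neg)
qed

text \<open>On cosets q - 1 acts through representatives as \<open>act q x \<otimes> inv x\<close>.
  A product of such operators can thus be evaluated in A itself, and only the final value is
  compared with N.\<close>

lemma nilpotent_actionI:
  assumes N: "subgroup N A" "\<And>q x. q \<in> carrier Q \<Longrightarrow> x \<in> N \<Longrightarrow> act q x \<in> N"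
    and Q: "\<one>\<^bsub>Q\<^esub> \<in> carrier Q" "\<And>x. x \<in> carrier A \<Longrightarrow> act \<one>\<^bsub>Q\<^esub> x = x"
    and nil: "\<And>x qs. x \<in> carrier A \<Longrightarrow> qs \<in> lists (carrier Q) \<Longrightarrow> length qs = d \<Longrightarrow>
      foldl (\<lambda>x q. act q x \<otimes> inv x) x qs \<in> N"
  shows "nilpotent_action Q (quotient_module M N)"
  unfolding nilpotent_action_def
proof (intro exI[of _ d] ballI impI)
  have R: "frag_of q \<ominus>\<^bsub>R\<^esub> \<one>\<^bsub>R\<^esub> \<in> carrier R" if "q \<in> carrier Q" for q
    using that Q keys_diff[of "frag_of q" "frag_of \<one>\<^bsub>Q\<^esub>"]
    by (auto simp: frag_of_minus_one carrier_R split: if_splits)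
  have fold: "foldl (\<lambda>x q. (frag_of q \<ominus>\<^bsub>R\<^esub> \<one>\<^bsub>R\<^esub>) \<odot>\<^bsub>quotient_module M N\<^esub> x) (N #> x) qs
      = N #> foldl (\<lambda>x q. act q x \<otimes> inv x) x qs"
    if "qs \<in> lists (carrier Q)" "x \<in> carrier A" for qs x
    using that
  proof (induction qs arbitrary: x)
    case (Cons q qs)
    have "(frag_of q \<ominus>\<^bsub>R\<^esub> \<one>\<^bsub>R\<^esub>) \<odot>\<^bsub>quotient_module M N\<^esub> (N #> x) = N #> (act q x \<otimes> inv x)"
      using Cons Q R smult_in_subgroup[OF N] by (simp add: smult_quotient N(1) smult_frag_of_minus_one)
    then show ?case
      using Cons by simp
  qed simp
  fix C qs assume C: "C \<in> carrier (quotient_module M N)" and qs: "qs \<in> lists (carrier Q)" "length qs = d"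
  then obtain x where x: "x \<in> carrier A" "C = N #> x"
    by (auto simp: carrier_quotient carrier_FactGroup)
  then show "foldl (\<lambda>x q. (frag_of q \<ominus>\<^bsub>R\<^esub> \<one>\<^bsub>R\<^esub>) \<odot>\<^bsub>quotient_module M N\<^esub> x) C qs
      = \<zero>\<^bsub>quotient_module M N\<^esub>"
    using fold[OF qs(1) x(1)] nil[OF x(1) qs] subgroup.rcos_const[OF N(1) is_group]
    by (simp add: zero_quotient)
qed

end

text \<open>The first isomorphism theorem: the submodule is the whole source, and the kernel of h is
  divided out.\<close>

lemma is_subquotient_of_image:
  fixes A :: "('a, 'm) monoid_scheme" and V :: "('b, 'n) monoid_scheme" and Q :: "('q, 'k) monoid_scheme"
  assumes A: "hom_action A Q actA" and V: "hom_action V Q actV"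
    and h: "h \<in> hom A V"
    and equivariant: "\<And>q x. q \<in> carrier Q \<Longrightarrow> x \<in> carrier A \<Longrightarrow> h (actA q x) = actV q (h x)"
  shows "is_subquotient (group_ring Q) ((module_of_action V actV)\<lparr>carrier := h ` carrier A\<rparr>)
    (module_of_action A actA)"
proof -
  interpret A: hom_action A Q actA by fact
  interpret V: hom_action V Q actV by fact
  interpret h: group_hom A V h
    using h by unfold_locales
  define N where "N = kernel A V h"
  have N: "subgroup N A" "N \<lhd> A"
    unfolding N_def by (rule h.subgroup_kernel h.normal_kernel)+
  have N_act: "actA q x \<in> N" if "q \<in> carrier Q" "x \<in> N" for q x
    using that equivariant[of q x] group_hom.hom_one[of V V "actV q"] V.act_hom[of q] V.is_group
    by (auto simp: N_def kernel_def group_hom_def group_hom_axioms_def)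
  have carrier_M: "carrier A.M = carrier A" "A.M\<lparr>carrier := carrier A\<rparr> = A.M"
    by (simp_all add: module_of_action_def)
  have h_smult: "h (r \<odot>\<^bsub>A.M\<^esub> x) = r \<odot>\<^bsub>V.M\<^esub> h x" if r: "r \<in> carrier A.R" and x: "x \<in> carrier A" for r x
  proof -
    have q: "q \<in> carrier Q" if "q \<in> Poly_Mapping.keys r" for q
      using that r by (auto simp: A.carrier_R)
    have "h (r \<odot>\<^bsub>A.M\<^esub> x) = (\<Otimes>\<^bsub>V\<^esub>q\<in>Poly_Mapping.keys r. h (actA q x [^]\<^bsub>A\<^esub> Poly_Mapping.lookup r q))"
      unfolding A.smult_def using q x
      by (intro hom_finprod_comm_group[OF A.comm_group_axioms V.comm_group_axioms h]) auto
    also have "\<dots> = r \<odot>\<^bsub>V.M\<^esub> h x"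
      unfolding V.smult_def using q x
      by (intro V.finprod_cong') (auto simp: equivariant h.hom_int_pow)
    finally show ?thesis .
  qed
  \<comment> \<open>The isomorphism has to run from the image to the quotient, so v is sent to its
    fibre, which is a coset of the kernel.\<close>
  define f where "f v = {x \<in> carrier A. h x = v}" for v
  have f_h: "f (h x) = N #>\<^bsub>A\<^esub> x" if x: "x \<in> carrier A" for x
  proof
    show "f (h x) \<subseteq> N #>\<^bsub>A\<^esub> x"
    proof
      fix y assume y: "y \<in> f (h x)"
      then have "y \<otimes>\<^bsub>A\<^esub> inv\<^bsub>A\<^esub> x \<in> N" "y = (y \<otimes>\<^bsub>A\<^esub> inv\<^bsub>A\<^esub> x) \<otimes>\<^bsub>A\<^esub> x"
        using x by (auto simp: f_def N_def kernel_def A.m_assoc)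
      then show "y \<in> N #>\<^bsub>A\<^esub> x"
        unfolding r_coset_def by blast
    qed
    show "N #>\<^bsub>A\<^esub> x \<subseteq> f (h x)"
      using x by (auto simp: f_def N_def kernel_def r_coset_def)
  qed
  have "f \<in> module_iso A.R (V.M\<lparr>carrier := h ` carrier A\<rparr>) (quotient_module A.M N)"
    unfolding module_iso_def
  proof (intro CollectI conjI ballI)
    show "f \<in> iso (add_monoid (V.M\<lparr>carrier := h ` carrier A\<rparr>)) (add_monoid (quotient_module A.M N))"
    proof (rule isoI)
      show "f \<in> hom (add_monoid (V.M\<lparr>carrier := h ` carrier A\<rparr>)) (add_monoid (quotient_module A.M N))"
      proof (rule homI)
        fix v assume "v \<in> carrier (add_monoid (V.M\<lparr>carrier := h ` carrier A\<rparr>))"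
        then show "f v \<in> carrier (add_monoid (quotient_module A.M N))"
          by (auto simp: f_h A.carrier_quotient carrier_FactGroup)
      next
        fix v w assume "v \<in> carrier (add_monoid (V.M\<lparr>carrier := h ` carrier A\<rparr>))"
          "w \<in> carrier (add_monoid (V.M\<lparr>carrier := h ` carrier A\<rparr>))"
        then obtain x y where xy: "x \<in> carrier A" "y \<in> carrier A" "v = h x" "w = h y"
          by auto
        have "f (v \<otimes>\<^bsub>V\<^esub> w) = N #>\<^bsub>A\<^esub> (x \<otimes>\<^bsub>A\<^esub> y)"
          using xy f_h[of "x \<otimes>\<^bsub>A\<^esub> y"] by simp
        also have "\<dots> = f v <#>\<^bsub>A\<^esub> f w"
          using xy normal.rcos_sum[OF N(2)] by (simp add: f_h)
        finally show "f (v \<otimes>\<^bsub>add_monoid (V.M\<lparr>carrier := h ` carrier A\<rparr>)\<^esub> w)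
            = f v \<otimes>\<^bsub>add_monoid (quotient_module A.M N)\<^esub> f w"
          by (simp add: A.add_quotient) (simp add: module_of_action_def)
      qed
      have "inj_on f (h ` carrier A)"
        by (rule inj_onI) (auto simp: f_def set_eq_iff)
      moreover have "f ` h ` carrier A = carrier (A Mod N)"
        by (auto simp: f_h carrier_FactGroup image_image)
      ultimately show "bij_betw f (carrier (add_monoid (V.M\<lparr>carrier := h ` carrier A\<rparr>)))
          (carrier (add_monoid (quotient_module A.M N)))"
        by (simp add: bij_betw_def A.carrier_quotient)
    qed
  next
    fix r v assume r: "r \<in> carrier A.R" and "v \<in> carrier (V.M\<lparr>carrier := h ` carrier A\<rparr>)"
    then obtain x where x: "x \<in> carrier A" "v = h x"
      by auto
    have "f (r \<odot>\<^bsub>V.M\<^esub> v) = N #>\<^bsub>A\<^esub> (r \<odot>\<^bsub>A.M\<^esub> x)"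
      using r x f_h[of "r \<odot>\<^bsub>A.M\<^esub> x"] by (simp add: h_smult)
    also have "\<dots> = r \<odot>\<^bsub>quotient_module A.M N\<^esub> f v"
      using r x by (simp add: f_h A.smult_quotient[OF N(1) A.smult_in_subgroup[OF N(1) N_act]])
    finally show "f (r \<odot>\<^bsub>V.M\<lparr>carrier := h ` carrier A\<rparr>\<^esub> v) = r \<odot>\<^bsub>quotient_module A.M N\<^esub> f v"
      by (simp add: module_of_action_def)
  qed
  moreover have "submodule (carrier A) A.R A.M" "submodule N A.R (A.M\<lparr>carrier := carrier A\<rparr>)"
    unfolding carrier_M using A.submoduleI N(1) N_act A.subgroup_self by simp_all
  ultimately show ?thesis
    unfolding is_subquotient_def
    by (rule_tac exI[of _ "carrier A"], rule_tac exI[of _ N]) (auto simp: carrier_M)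
qed

section \<open>The submodule of commutators\<close>

lemma (in group) rcos_absorb:
  assumes "subgroup N G" "n \<in> N" "x \<in> carrier G"
  shows "N #> (n \<otimes> x) = N #> x"
proof -
  have "N #> (n \<otimes> x) = (N #> n) #> x"
    using assms subgroup.mem_carrier[OF assms(1)] subgroup.subset[OF assms(1)]
    by (simp add: coset_mult_assoc)
  then show ?thesis
    using subgroup.rcos_const[OF assms(1) is_group assms(2)] by simp
qed

context weak_comm_group
begin

abbreviation "G'' \<equiv> derived G G'"
abbreviation "Q \<equiv> abelianization G"
abbreviation "DQ \<equiv> derived_quotient G"
abbreviation "V \<equiv> \<XX> G\<lparr>carrier := W\<rparr>"

lemma G''_normal: "G'' \<lhd> G"
  using G'_normal by (rule derived_is_normal)

lemmas G''_subgroup = normal_imp_subgroup[OF G''_normal]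

lemma G''_subset_G': "G'' \<subseteq> G'"
  by (rule derived_incl[OF order_refl G'_subgroup])

sublocale DQ: comm_group DQ
  unfolding derived_quotient_def by (rule derived_quot_of_subgroup_is_comm_group[OF G'_subgroup])

sublocale Q: comm_group Q
  by (rule derived_quot_is_comm_group)

lemma DQ_coset: "c \<in> G' \<Longrightarrow> G'' #> c \<in> carrier DQ"
  by (auto simp: derived_quotient_def carrier_FactGroup)

lemma DQ_cases:
  assumes "C \<in> carrier DQ" obtains c where "c \<in> G'" "C = G'' #> c"
  using assms by (auto simp: derived_quotient_def carrier_FactGroup)

lemma DQ_mult:
  assumes "c \<in> G'" "d \<in> G'"
  shows "(G'' #> c) \<otimes>\<^bsub>DQ\<^esub> (G'' #> d) = G'' #> (c \<otimes> d)"
  using normal.rcos_sum[OF derived_subgroup_is_normal[OF G'_subgroup], of c d] assms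
  by (simp add: derived_quotient_def set_mult_def)

lemma Q_coset: "g \<in> carrier G \<Longrightarrow> G' #> g \<in> carrier Q"
  by (auto simp: carrier_FactGroup)

lemma Q_cases:
  assumes "q \<in> carrier Q" obtains g where "g \<in> carrier G" "q = G' #> g"
  using assms by (auto simp: carrier_FactGroup)

text \<open>Independence of representatives: replacing g by h g with h in G' multiplies the result y
  by [h, y], a commutator of elements of G', and replacing c by n c with n in G'' contributes a
  conjugate of n. Both factors lie in G''.\<close>

lemma derived_quotient_action_coset:
  assumes g: "g \<in> carrier G" and c: "c \<in> G'"
  shows "derived_quotient_action G (G' #> g) (G'' #> c) = G'' #> (g \<otimes> c \<otimes> inv g)"
proof -
  define y where "y = g \<otimes> c \<otimes> inv g"
  have y: "y \<in> G'"
    unfolding y_def using subgroup_conj_closed[OF G'_normal] g c by simp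
  have "G'' #> (g' \<otimes> x \<otimes> inv g') = G'' #> y" if g': "g' \<in> G' #> g" and x: "x \<in> G'' #> c" for g' x
  proof -
    obtain h n where hn: "h \<in> G'" "g' = h \<otimes> g" "n \<in> G''" "x = n \<otimes> c"
      using g' x by (auto simp: r_coset_def)
    have n: "n \<in> carrier G"
      using hn G''_subset_G' by auto
    have "h \<otimes> (g \<otimes> n \<otimes> inv g) \<otimes> inv h \<in> G''"
      using hn g subgroup_conj_closed[OF G''_normal] by simp
    then have "h \<otimes> (g \<otimes> n \<otimes> inv g) \<otimes> inv h \<otimes> commutator_elem G h y \<in> G''"
      using commutator_in_derived[OF hn(1) y] by (rule subgroup.m_closed[OF G''_subgroup])
    moreover have "g' \<otimes> x \<otimes> inv g'
        = (h \<otimes> (g \<otimes> n \<otimes> inv g) \<otimes> inv h \<otimes> commutator_elem G h y) \<otimes> y"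
      using hn n g c by (simp add: y_def commutator_elem_def m_assoc inv_mult_group)
    ultimately show ?thesis
      using rcos_absorb[OF G''_subgroup] y by simp
  qed
  moreover have "g \<in> G' #> g" "c \<in> G'' #> c"
    using g c G'_subgroup G''_subgroup by (auto intro: rcos_self)
  ultimately have "{G'' #> (g' \<otimes> x \<otimes> inv g') | g' x. g' \<in> G' #> g \<and> x \<in> G'' #> c} = {G'' #> y}"
    by blast
  then show ?thesis
    by (simp add: derived_quotient_action_def y_def)
qed

lemma derived_quotient_action_hom:
  assumes "q \<in> carrier Q"
  shows "derived_quotient_action G q \<in> hom DQ DQ"
proof -
  obtain g where g: "g \<in> carrier G" "q = G' #> g"
    using assms by (rule Q_cases)
  have conj: "g \<otimes> c \<otimes> inv g \<in> G'" if "c \<in> G'" for c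
    using subgroup_conj_closed[OF G'_normal] g that by simp
  show ?thesis
  proof (rule homI)
    fix C assume "C \<in> carrier DQ"
    then show "derived_quotient_action G q C \<in> carrier DQ"
      using g conj by (elim DQ_cases) (simp add: derived_quotient_action_coset DQ_coset)
  next
    fix C E assume "C \<in> carrier DQ" "E \<in> carrier DQ"
    then obtain c d where cd: "c \<in> G'" "C = G'' #> c" "d \<in> G'" "E = G'' #> d"
      using DQ_cases by metis
    have "g \<otimes> (c \<otimes> d) \<otimes> inv g = (g \<otimes> c \<otimes> inv g) \<otimes> (g \<otimes> d \<otimes> inv g)"
      using g cd by (simp add: m_assoc)
    then show "derived_quotient_action G q (C \<otimes>\<^bsub>DQ\<^esub> E)
        = derived_quotient_action G q C \<otimes>\<^bsub>DQ\<^esub> derived_quotient_action G q E"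
      using g cd conj by (simp add: DQ_mult derived_quotient_action_coset subgroup.m_closed[OF G'_subgroup])
  qed
qed

lemma derived_quotient_action_mult:
  assumes "p \<in> carrier Q" "q \<in> carrier Q" "C \<in> carrier DQ"
  shows "derived_quotient_action G (p \<otimes>\<^bsub>Q\<^esub> q) C
    = derived_quotient_action G p (derived_quotient_action G q C)"
proof -
  obtain g h c where *: "g \<in> carrier G" "p = G' #> g" "h \<in> carrier G" "q = G' #> h" "c \<in> G'" "C = G'' #> c"
    using Q_cases[OF assms(1)] Q_cases[OF assms(2)] DQ_cases[OF assms(3)] by metis
  have "p \<otimes>\<^bsub>Q\<^esub> q = G' #> (g \<otimes> h)"
    using * normal.rcos_sum[OF G'_normal] by simp
  moreover have "h \<otimes> c \<otimes> inv h \<in> G'"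
    using * subgroup_conj_closed[OF G'_normal] by simp
  moreover have "g \<otimes> h \<otimes> c \<otimes> inv (g \<otimes> h) = g \<otimes> (h \<otimes> c \<otimes> inv h) \<otimes> inv g"
    using * by (simp add: m_assoc inv_mult_group)
  ultimately show ?thesis
    using * by (simp add: derived_quotient_action_coset)
qed

lemma derived_quotient_action_commute:
  assumes "p \<in> carrier Q" "q \<in> carrier Q" "C \<in> carrier DQ"
  shows "derived_quotient_action G p (derived_quotient_action G q C)
    = derived_quotient_action G q (derived_quotient_action G p C)"
  using derived_quotient_action_mult assms Q.m_comm[OF assms(1,2)] by metis

sublocale V: comm_group V
proof (rule group.group_comm_groupI)
  show "group V"
    using W_subgroup by (rule X.subgroup_imp_group)
  fix v w assume "v \<in> carrier V" "w \<in> carrier V"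
  then show "v \<otimes>\<^bsub>V\<^esub> w = w \<otimes>\<^bsub>V\<^esub> v"
    using W_L_commute W_iff by simp
qed

text \<open>All admissible x act alike by \<open>conj_W_cong\<close>, and \<open>\<alpha> g\<close>
  is one of them.\<close>

lemma W_action_coset:
  assumes g: "g \<in> carrier G" and w: "w \<in> W"
  shows "W_action G (G' #> g) w = \<alpha> g \<otimes>\<^bsub>\<XX> G\<^esub> w \<otimes>\<^bsub>\<XX> G\<^esub> inv\<^bsub>\<XX> G\<^esub> \<alpha> g"
proof -
  have "x \<otimes>\<^bsub>\<XX> G\<^esub> w \<otimes>\<^bsub>\<XX> G\<^esub> inv\<^bsub>\<XX> G\<^esub> x = \<alpha> g \<otimes>\<^bsub>\<XX> G\<^esub> w \<otimes>\<^bsub>\<XX> G\<^esub> inv\<^bsub>\<XX> G\<^esub> \<alpha> g"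
    if x: "x \<in> carrier (\<XX> G)" "weak_comm_fold G x \<in> G' #> g" for x
  proof (rule conj_W_cong)
    obtain h where "h \<in> G'" "weak_comm_fold G x = h \<otimes> g"
      using x(2) by (auto simp: r_coset_def)
    then show "weak_comm_fold G x \<otimes> inv weak_comm_fold G (\<alpha> g) \<in> G'"
      using g by (simp add: m_assoc)
  qed (use x g w in auto)
  moreover have "\<alpha> g \<in> carrier (\<XX> G)" "weak_comm_fold G (\<alpha> g) \<in> G' #> g"
    using g rcos_self[OF g G'_subgroup] by simp_all
  ultimately have "{x \<otimes>\<^bsub>\<XX> G\<^esub> w \<otimes>\<^bsub>\<XX> G\<^esub> inv\<^bsub>\<XX> G\<^esub> x | x. x \<in> carrier (\<XX> G) \<and> weak_comm_fold G x \<in> G' #> g}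
      = {\<alpha> g \<otimes>\<^bsub>\<XX> G\<^esub> w \<otimes>\<^bsub>\<XX> G\<^esub> inv\<^bsub>\<XX> G\<^esub> \<alpha> g}"
    by blast
  then show ?thesis
    by (simp add: W_action_def)
qed

sublocale WQ: hom_action V Q "W_action G"
proof unfold_locales
  fix q assume "q \<in> carrier Q"
  then obtain g where g: "g \<in> carrier G" "q = G' #> g"
    by (rule Q_cases)
  show "W_action G q \<in> hom V V"
  proof (rule homI)
    fix w assume "w \<in> carrier V"
    then show "W_action G q w \<in> carrier V"
      using g conj_W_closed by (simp add: W_action_coset)
  next
    fix v w assume vw: "v \<in> carrier V" "w \<in> carrier V"
    then have "v \<otimes>\<^bsub>\<XX> G\<^esub> w \<in> W"
      using subgroup.m_closed[OF W_subgroup] by simp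
    then show "W_action G q (v \<otimes>\<^bsub>V\<^esub> w) = W_action G q v \<otimes>\<^bsub>V\<^esub> W_action G q w"
      using g vw by (simp add: W_action_coset X.m_assoc)
  qed
qed

text \<open>In each variable the pairing is a homomorphism from G' to the abelian group W, so it
  kills commutators of elements of G'.\<close>

lemma pairing_G''_left: "n \<in> G'' \<Longrightarrow> d \<in> G' \<Longrightarrow> pairing n d = \<one>\<^bsub>\<XX> G\<^esub>"
  and pairing_G''_right: "n \<in> G'' \<Longrightarrow> d \<in> G' \<Longrightarrow> pairing d n = \<one>\<^bsub>\<XX> G\<^esub>"
proof -
  assume d: "d \<in> G'"
  have trivial: "f n = \<one>\<^bsub>V\<^esub>" if f: "f \<in> hom (G\<lparr>carrier := G'\<rparr>) V" and n: "n \<in> G''" for f n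
  proof -
    interpret f: group_hom "G\<lparr>carrier := G'\<rparr>" V f
      using f subgroup_imp_group[OF G'_subgroup] V.is_group
      by (auto simp: group_hom_def group_hom_axioms_def)
    have "derived_set G G' \<subseteq> kernel (G\<lparr>carrier := G'\<rparr>) V f"
    proof clarify
      fix x y assume xy: "x \<in> G'" "y \<in> G'"
      let ?c = "x \<otimes> y \<otimes> inv x \<otimes> inv y"
      have c: "?c \<in> G'"
        using xy commutator_in_derived[of x "carrier G" y] by (simp add: commutator_elem_def)
      have yx: "y \<otimes> x \<in> G'"
        using xy subgroup.m_closed[OF G'_subgroup] by simp
      have "f ?c \<otimes>\<^bsub>V\<^esub> f (y \<otimes> x) = f (?c \<otimes> (y \<otimes> x))"
        using f.hom_mult[of ?c "y \<otimes> x"] c yx by simp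
      also have "?c \<otimes> (y \<otimes> x) = x \<otimes> y"
        using xy by (simp add: m_assoc)
      also have "f (x \<otimes> y) = f (y \<otimes> x)"
        using f.hom_mult[of x y] f.hom_mult[of y x] V.m_comm[of "f x" "f y"] f.hom_closed xy by simp
      finally have "f ?c = \<one>\<^bsub>V\<^esub>"
        using V.right_cancel[of "f (y \<otimes> x)" "f ?c" "\<one>\<^bsub>V\<^esub>"] V.l_one[of "f (y \<otimes> x)"]
          f.hom_closed[of ?c] f.hom_closed[of "y \<otimes> x"] c yx by simp
      then show "?c \<in> kernel (G\<lparr>carrier := G'\<rparr>) V f"
        using c by (simp add: kernel_def)
    qed
    moreover have "subgroup (kernel (G\<lparr>carrier := G'\<rparr>) V f) G"
      using f.subgroup_kernel G'_subgroup incl_subgroup by blast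
    ultimately have "G'' \<subseteq> kernel (G\<lparr>carrier := G'\<rparr>) V f"
      unfolding derived_def[of _ G'] by (rule generate_subgroup_incl)
    then show ?thesis
      using n by (auto simp: kernel_def)
  qed
  have "(\<lambda>c. pairing c d) \<in> hom (G\<lparr>carrier := G'\<rparr>) V" "(\<lambda>c. pairing d c) \<in> hom (G\<lparr>carrier := G'\<rparr>) V"
    using d by (auto intro!: homI pairing_in_W simp: pairing_mult_left pairing_mult_right)
  from this[THEN trivial] show "n \<in> G'' \<Longrightarrow> pairing n d = \<one>\<^bsub>\<XX> G\<^esub>" "n \<in> G'' \<Longrightarrow> pairing d n = \<one>\<^bsub>\<XX> G\<^esub>"
    by simp_all
qed

definition "coset_pairing C E = pairing (SOME c. c \<in> C) (SOME d. d \<in> E)"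

lemma coset_pairing_coset:
  assumes c: "c \<in> G'" and d: "d \<in> G'"
  shows "coset_pairing (G'' #> c) (G'' #> d) = pairing c d"
proof -
  have "\<exists>n\<in>G''. (SOME x. x \<in> G'' #> c) = n \<otimes> c" if "c \<in> G'" for c
  proof -
    have "(SOME x. x \<in> G'' #> c) \<in> G'' #> c"
      using rcos_self[OF _ G''_subgroup, of c] that by (auto intro: someI)
    then show ?thesis
      by (auto simp: r_coset_def)
  qed
  then obtain n m where nm: "n \<in> G''" "(SOME x. x \<in> G'' #> c) = n \<otimes> c"
    "m \<in> G''" "(SOME x. x \<in> G'' #> d) = m \<otimes> d"
    using c d by meson
  have G': "n \<in> G'" "m \<in> G'" "m \<otimes> d \<in> G'"
    using nm d G''_subset_G' subgroup.m_closed[OF G'_subgroup] by auto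
  show ?thesis
    unfolding coset_pairing_def nm
    using c d G' nm pairing_in_W by (simp add: pairing_mult_left pairing_mult_right pairing_G''_left pairing_G''_right)
qed

sublocale T: tensor DQ DQ
  by unfold_locales

lemma tensor_action_hom:
  assumes "pq \<in> antidiagonal Q"
  shows "derived_tensor_action G pq \<in> hom T.T T.T"
proof -
  obtain p where "p \<in> carrier Q" "pq = (p, inv\<^bsub>Q\<^esub> p)"
    using assms by (auto simp: antidiagonal_def)
  then show ?thesis
    by (simp add: derived_tensor_action_def T.tensor_map_hom derived_quotient_action_hom)
qed

lemma left_action_hom: "q \<in> carrier Q \<Longrightarrow> tensor_map DQ DQ (derived_quotient_action G q) (\<lambda>C. C) \<in> hom T.T T.T"
  by (rule T.tensor_map_hom[OF derived_quotient_action_hom]) (auto simp: hom_def)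

lemma left_action_pure:
  "\<lbrakk>q \<in> carrier Q; C \<in> carrier DQ; E \<in> carrier DQ\<rbrakk> \<Longrightarrow>
    tensor_map DQ DQ (derived_quotient_action G q) (\<lambda>C. C) (T.pure C E) = T.pure (derived_quotient_action G q C) E"
  by (rule T.tensor_map_pure[OF derived_quotient_action_hom]) (auto simp: hom_def)

abbreviation "CR \<equiv> coinvariant_relations (antidiagonal Q) T.T (derived_tensor_action G)"

lemma CR_subgroup: "subgroup CR T.T"
  by (rule T.T.coinvariant_relations_subgroup) (rule tensor_action_hom)

text \<open>Since Q is abelian, the action on the first factor commutes with the antidiagonal
  one.\<close>

lemma left_action_CR:
  assumes q: "q \<in> carrier Q"
  shows "tensor_map DQ DQ (derived_quotient_action G q) (\<lambda>C. C) ` CR \<subseteq> CR"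
proof (rule T.T.coinvariant_relations_invariant[where act = "derived_tensor_action G"
      and f = "tensor_map DQ DQ (derived_quotient_action G q) (\<lambda>C. C)"])
  let ?f = "tensor_map DQ DQ (derived_quotient_action G q) (\<lambda>C. C)"
  fix pq t assume pq: "pq \<in> antidiagonal Q" and t: "t \<in> carrier T.T"
  then obtain p where p: "p \<in> carrier Q" "pq = (p, inv\<^bsub>Q\<^esub> p)"
    by (auto simp: antidiagonal_def)
  have "(?f \<circ> derived_tensor_action G pq) t = (derived_tensor_action G pq \<circ> ?f) t"
  proof (rule T.hom_T_eqI[where V = T.T and f = "?f \<circ> derived_tensor_action G pq"
        and h = "derived_tensor_action G pq \<circ> ?f", OF T.T.is_group])
    fix C E assume CD: "C \<in> carrier DQ" "E \<in> carrier DQ"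
    have closed: "derived_quotient_action G r E \<in> carrier DQ" if "r \<in> carrier Q" "E \<in> carrier DQ" for r E
      using that hom_in_carrier[OF derived_quotient_action_hom] by blast
    show "(?f \<circ> derived_tensor_action G pq) (T.pure C E) = (derived_tensor_action G pq \<circ> ?f) (T.pure C E)"
      using p q CD closed derived_quotient_action_commute[OF p(1) q CD(1)]
      by (simp add: derived_tensor_action_def T.tensor_map_pure derived_quotient_action_hom left_action_pure)
  qed (rule Group.hom_compose[OF tensor_action_hom[OF pq] left_action_hom[OF q]],
      rule Group.hom_compose[OF left_action_hom[OF q] tensor_action_hom[OF pq]], rule t)
  then show "?f (derived_tensor_action G pq t) = derived_tensor_action G pq (?f t)"
    by simp
qed (use left_action_hom q tensor_action_hom in auto)

lemma M_group_eq: "M_group G = T.T Mod CR"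
  by (simp add: M_group_def coinvariants_def)

sublocale MQ: hom_action "M_group G" Q "M_action G"
proof -
  interpret M: comm_group "M_group G"
    unfolding M_group_def by (rule T.T.coinvariants_comm_group) (rule tensor_action_hom)
  show "hom_action (M_group G) Q (M_action G)"
  proof unfold_locales
    fix q assume q: "q \<in> carrier Q"
    show "M_action G q \<in> hom (M_group G) (M_group G)"
      unfolding M_action_def M_group_eq
      using T.T.subgroup_imp_normal[OF CR_subgroup] left_action_hom[OF q] left_action_CR[OF q]
      by (rule T.T.induced_on_cosets_hom)
  qed
qed

lemma M_action_coset:
  assumes "q \<in> carrier Q" "t \<in> carrier T.T"
  shows "M_action G q (CR #>\<^bsub>T.T\<^esub> t)
    = CR #>\<^bsub>T.T\<^esub> tensor_map DQ DQ (derived_quotient_action G q) (\<lambda>C. C) t"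
  unfolding M_action_def
  using T.T.subgroup_imp_normal[OF CR_subgroup] left_action_hom[OF assms(1)] left_action_CR[OF assms(1)] assms(2)
  by (rule T.T.induced_on_cosets_coset)

lemma coset_pairing_action_left:
  assumes "q \<in> carrier Q" "C \<in> carrier DQ" "E \<in> carrier DQ"
  shows "coset_pairing (derived_quotient_action G q C) E = W_action G q (coset_pairing C E)"
proof -
  obtain g c d where *: "g \<in> carrier G" "q = G' #> g" "c \<in> G'" "C = G'' #> c" "d \<in> G'" "E = G'' #> d"
    using Q_cases[OF assms(1)] DQ_cases[OF assms(2)] DQ_cases[OF assms(3)] by metis
  then have "g \<otimes> c \<otimes> inv g \<in> G'"
    using subgroup_conj_closed[OF G'_normal] by simp
  then show ?thesis
    using * pairing_in_W
    by (simp add: derived_quotient_action_coset coset_pairing_coset pairing_conj_left W_action_coset)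
qed

lemma coset_pairing_action_right:
  assumes "q \<in> carrier Q" "C \<in> carrier DQ" "E \<in> carrier DQ"
  shows "coset_pairing C (derived_quotient_action G q E) = W_action G q (coset_pairing C E)"
proof -
  obtain g c d where *: "g \<in> carrier G" "q = G' #> g" "c \<in> G'" "C = G'' #> c" "d \<in> G'" "E = G'' #> d"
    using Q_cases[OF assms(1)] DQ_cases[OF assms(2)] DQ_cases[OF assms(3)] by metis
  then have "g \<otimes> d \<otimes> inv g \<in> G'"
    using subgroup_conj_closed[OF G'_normal] by simp
  then show ?thesis
    using * pairing_in_W
    by (simp add: derived_quotient_action_coset coset_pairing_coset pairing_conj_right W_action_coset)
qed

lemma coset_pairing_closed: "C \<in> carrier DQ \<Longrightarrow> E \<in> carrier DQ \<Longrightarrow> coset_pairing C E \<in> carrier V"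
  by (elim DQ_cases) (simp add: coset_pairing_coset pairing_in_W)

lemma W_action_one: "w \<in> W \<Longrightarrow> W_action G \<one>\<^bsub>Q\<^esub> w = w"
proof -
  assume w: "w \<in> W"
  have "\<one>\<^bsub>Q\<^esub> = G' #> \<one>"
    using coset_mult_one[OF subgroup.subset[OF G'_subgroup]] by simp
  then show ?thesis
    using w by (simp add: W_action_coset del: one_FactGroup)
qed

text \<open>Both variables induce the same action on W, so q can be moved to the second argument,
  where it cancels its inverse. This invariance is the reason for coinvariants under the
  antidiagonal.\<close>

lemma coset_pairing_action_antidiagonal:
  assumes q: "q \<in> carrier Q" and CD: "C \<in> carrier DQ" "E \<in> carrier DQ"
  shows "coset_pairing (derived_quotient_action G q C) (derived_quotient_action G (inv\<^bsub>Q\<^esub> q) E)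
    = coset_pairing C E"
proof -
  have closed: "derived_quotient_action G r E \<in> carrier DQ" if "r \<in> carrier Q" "E \<in> carrier DQ" for r E
    using that hom_in_carrier[OF derived_quotient_action_hom] by blast
  have "coset_pairing (derived_quotient_action G q C) (derived_quotient_action G (inv\<^bsub>Q\<^esub> q) E)
      = coset_pairing C (derived_quotient_action G q (derived_quotient_action G (inv\<^bsub>Q\<^esub> q) E))"
    using coset_pairing_action_left[OF q CD(1)] coset_pairing_action_right[OF q CD(1)] q CD closed
    by (metis Q.inv_closed)
  also have "\<dots> = W_action G \<one>\<^bsub>Q\<^esub> (coset_pairing C E)"
    using q CD coset_pairing_action_right[OF Q.one_closed CD] Q.r_inv[OF q]
    by (simp flip: derived_quotient_action_mult)
  also have "\<dots> = coset_pairing C E"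
    using W_action_one coset_pairing_closed[OF CD] by simp
  finally show ?thesis .
qed

text \<open>\<open>\<psi>\<close> is the pairing, extended to the tensor product and then descended
  to coinvariants. Pure tensors generate, so its image and its equivariance can be read off from
  values of the pairing.\<close>

lemma W0_subquotient:
  obtains \<psi> where "\<psi> \<in> hom (M_group G) V" "\<psi> ` carrier (M_group G) = W\<^sub>0"
    "\<And>q m. q \<in> carrier Q \<Longrightarrow> m \<in> carrier (M_group G) \<Longrightarrow> \<psi> (M_action G q m) = W_action G q (\<psi> m)"
proof -
  have bilinear:
    "coset_pairing (C \<otimes>\<^bsub>DQ\<^esub> C') E = coset_pairing C E \<otimes>\<^bsub>V\<^esub> coset_pairing C' E"
    "coset_pairing E (C \<otimes>\<^bsub>DQ\<^esub> C') = coset_pairing E C \<otimes>\<^bsub>V\<^esub> coset_pairing E C'"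
    if CD: "C \<in> carrier DQ" "C' \<in> carrier DQ" "E \<in> carrier DQ" for C C' E
  proof -
    obtain c c' d where "c \<in> G'" "C = G'' #> c" "c' \<in> G'" "C' = G'' #> c'" "d \<in> G'" "E = G'' #> d"
      using CD DQ_cases by metis
    then show "coset_pairing (C \<otimes>\<^bsub>DQ\<^esub> C') E = coset_pairing C E \<otimes>\<^bsub>V\<^esub> coset_pairing C' E"
      "coset_pairing E (C \<otimes>\<^bsub>DQ\<^esub> C') = coset_pairing E C \<otimes>\<^bsub>V\<^esub> coset_pairing E C'"
      by (simp_all add: DQ_mult coset_pairing_coset subgroup.m_closed[OF G'_subgroup]
          pairing_mult_left pairing_mult_right)
  qed
  obtain \<phi> where \<phi>: "\<phi> \<in> hom T.T V"
    and \<phi>_pure: "\<And>C E. C \<in> carrier DQ \<Longrightarrow> E \<in> carrier DQ \<Longrightarrow> \<phi> (T.pure C E) = coset_pairing C E"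
  proof (rule T.universal[OF V.comm_group_axioms coset_pairing_closed bilinear(1)])
    fix \<phi> assume "\<phi> \<in> hom T.T V"
      "\<And>C E. C \<in> carrier DQ \<Longrightarrow> E \<in> carrier DQ \<Longrightarrow> \<phi> (T.pure C E) = coset_pairing C E"
    then show thesis
      by (rule that)
  qed (use bilinear(2) in blast)+
  interpret \<phi>: group_hom T.T V \<phi>
    using \<phi> by unfold_locales
  have closed: "derived_quotient_action G r E \<in> carrier DQ" if "r \<in> carrier Q" "E \<in> carrier DQ" for r E
    using that hom_in_carrier[OF derived_quotient_action_hom] by blast
  have invariant: "\<phi> (derived_tensor_action G pq t) = \<phi> t"
    if pq: "pq \<in> antidiagonal Q" and t: "t \<in> carrier T.T" for pq t
  proof -
    obtain p where p: "p \<in> carrier Q" "pq = (p, inv\<^bsub>Q\<^esub> p)"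
      using pq by (auto simp: antidiagonal_def)
    have "(\<phi> \<circ> derived_tensor_action G pq) t = \<phi> t"
    proof (rule T.hom_T_eqI[OF V.is_group _ \<phi>])
      fix C E assume CD: "C \<in> carrier DQ" "E \<in> carrier DQ"
      then show "(\<phi> \<circ> derived_tensor_action G pq) (T.pure C E) = \<phi> (T.pure C E)"
        using p closed
        by (simp add: derived_tensor_action_def T.tensor_map_pure derived_quotient_action_hom \<phi>_pure
            coset_pairing_action_antidiagonal)
    qed (rule Group.hom_compose[OF tensor_action_hom[OF pq] \<phi>], rule t)
    then show ?thesis by simp
  qed
  obtain \<psi> where \<psi>: "\<psi> \<in> hom (M_group G) V" "\<And>t. t \<in> carrier T.T \<Longrightarrow> \<psi> (CR #>\<^bsub>T.T\<^esub> t) = \<phi> t"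
    unfolding M_group_def
  proof (rule T.T.hom_from_coinvariants[where Q = "antidiagonal Q" and act = "derived_tensor_action G"
        and V = V and f = \<phi>])
    fix \<psi> assume "\<psi> \<in> hom (coinvariants (antidiagonal Q) T.T (derived_tensor_action G)) V"
      "\<And>t. t \<in> carrier T.T \<Longrightarrow> \<psi> (CR #>\<^bsub>T.T\<^esub> t) = \<phi> t"
    then show thesis
      by (rule that[unfolded M_group_def])
  qed (rule tensor_action_hom V.is_group \<phi> invariant; assumption?)+
  show thesis
  proof (rule that[OF \<psi>(1)])
    have "\<psi> ` carrier (M_group G) = \<phi> ` carrier T.T"
      by (auto simp: M_group_eq carrier_FactGroup image_image \<psi>(2))
    also have "\<dots> = generate V (\<phi> ` (\<lambda>(C, E). T.pure C E) ` (carrier DQ \<times> carrier DQ))"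
      unfolding T.generate_T[symmetric] by (rule \<phi>.generate_img[symmetric]) auto
    also have "\<phi> ` (\<lambda>(C, E). T.pure C E) ` (carrier DQ \<times> carrier DQ) = {pairing c d | c d. c \<in> G' \<and> d \<in> G'}"
      (is "?L = ?R")
    proof
      show "?L \<subseteq> ?R"
      proof clarify
        fix C E assume CD: "C \<in> carrier DQ" "E \<in> carrier DQ"
        then obtain c d where "c \<in> G'" "C = G'' #> c" "d \<in> G'" "E = G'' #> d"
          using DQ_cases by metis
        then show "\<exists>c d. \<phi> (T.pure C E) = pairing c d \<and> c \<in> G' \<and> d \<in> G'"
          using CD \<phi>_pure coset_pairing_coset by metis
      qed
      show "?R \<subseteq> ?L"
      proof clarify
        fix c d assume cd: "c \<in> G'" "d \<in> G'"
        then have "pairing c d = \<phi> (T.pure (G'' #> c) (G'' #> d))"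
          using \<phi>_pure coset_pairing_coset DQ_coset by metis
        moreover have "\<phi> ((\<lambda>(C, E). T.pure C E) (G'' #> c, G'' #> d)) \<in> ?L"
          using cd DQ_coset by (intro imageI) simp
        ultimately show "pairing c d \<in> ?L"
          by simp
      qed
    qed
    also have "generate V {pairing c d | c d. c \<in> G' \<and> d \<in> G'}
        = generate (\<XX> G) {pairing c d | c d. c \<in> G' \<and> d \<in> G'}"
      using pairing_in_W by (intro X.generate_consistent[OF _ W_subgroup]) auto
    also have "\<dots> = W\<^sub>0"
      by (rule W0_eq_generate_pairing[symmetric])
    finally show "\<psi> ` carrier (M_group G) = W\<^sub>0" .
  next
    fix q m assume q: "q \<in> carrier Q" and "m \<in> carrier (M_group G)"
    then obtain t where t: "t \<in> carrier T.T" "m = CR #>\<^bsub>T.T\<^esub> t"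
      by (auto simp: M_group_eq carrier_FactGroup)
    let ?f = "tensor_map DQ DQ (derived_quotient_action G q) (\<lambda>C. C)"
    have "(\<phi> \<circ> ?f) t = (W_action G q \<circ> \<phi>) t"
    proof (rule T.hom_T_eqI[OF V.is_group])
      fix C E assume CD: "C \<in> carrier DQ" "E \<in> carrier DQ"
      then show "(\<phi> \<circ> ?f) (T.pure C E) = (W_action G q \<circ> \<phi>) (T.pure C E)"
        using q closed by (simp add: left_action_pure \<phi>_pure coset_pairing_action_left)
    qed (rule Group.hom_compose[OF left_action_hom[OF q] \<phi>],
        rule Group.hom_compose[OF \<phi> WQ.act_hom[OF q]], rule t(1))
    moreover have "?f t \<in> carrier T.T"
      using hom_in_carrier[OF left_action_hom[OF q] t(1)] .
    ultimately show "\<psi> (M_action G q m) = W_action G q (\<psi> m)"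
      using t q by (simp add: M_action_coset \<psi>(2))
  qed
qed

lemma W_module_eq: "W_module G = module_of_action V (W_action G)"
  by (simp add: W_module_def weak_comm_W_eq)

lemma W0_act:
  assumes "q \<in> carrier Q" "w \<in> W\<^sub>0"
  shows "W_action G q w \<in> W\<^sub>0"
proof -
  obtain g where "g \<in> carrier G" "q = G' #> g"
    using assms(1) by (rule Q_cases)
  then show ?thesis
    using assms(2) X.subgroup_conj_closed[OF W0_normal] W0_in_W by (simp add: W_action_coset)
qed

lemma W0_subgroup_V: "subgroup W\<^sub>0 V"
  using W0_subgroup W_subgroup W0_subset_W by (rule X.subgroup_incl)

lemma W0_properties:
  assumes "finitely_generated G"
  shows "submodule W\<^sub>0 (group_ring Q) (W_module G)"
    and "is_subquotient (group_ring Q) ((W_module G)\<lparr>carrier := W\<^sub>0\<rparr>) (M_module G)"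
    and "nilpotent_action Q (quotient_module (W_module G) W\<^sub>0)"
proof -
  show "submodule W\<^sub>0 (group_ring Q) (W_module G)"
    unfolding W_module_eq by (rule WQ.submoduleI[OF W0_subgroup_V W0_act])
  obtain \<psi> where \<psi>: "\<psi> \<in> hom (M_group G) V" "\<psi> ` carrier (M_group G) = W\<^sub>0"
    "\<And>q m. q \<in> carrier Q \<Longrightarrow> m \<in> carrier (M_group G) \<Longrightarrow> \<psi> (M_action G q m) = W_action G q (\<psi> m)"
  proof (rule W0_subquotient)
    fix \<psi> assume "\<psi> \<in> hom (M_group G) V" "\<psi> ` carrier (M_group G) = W\<^sub>0"
      "\<And>q m. q \<in> carrier Q \<Longrightarrow> m \<in> carrier (M_group G) \<Longrightarrow> \<psi> (M_action G q m) = W_action G q (\<psi> m)"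
    then show thesis
      by (rule that)
  qed
  show "is_subquotient (group_ring Q) ((W_module G)\<lparr>carrier := W\<^sub>0\<rparr>) (M_module G)"
    unfolding W_module_eq M_module_def
    unfolding \<psi>(2)[symmetric]
    by (rule is_subquotient_of_image[OF MQ.hom_action_axioms WQ.hom_action_axioms \<psi>(1)]) (rule \<psi>(3))
  obtain d where d: "\<And>w gs. \<lbrakk>w \<in> W; gs \<in> lists (carrier G); length gs = d\<rbrakk>
    \<Longrightarrow> foldl (\<lambda>x g. com (\<alpha> g) x) w gs \<in> W\<^sub>0"
    using nilpotent_W_mod_W0[OF assms] by blast
  have com_W: "com (\<alpha> g) w \<in> W" if "g \<in> carrier G" "w \<in> W" for g w
    using that X.commutator_normal_closed(1)[OF W_normal] by simp
  \<comment> \<open>Multiplicatively, q - 1 sends w to its conjugate times its inverse, that is to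
    [\<alpha> g, w]. The condition in the group ring thus becomes the commutator bound of
    \<open>nilpotent_W_mod_W0\<close>.\<close>
  have foldl_eq: "foldl (\<lambda>x q. W_action G q x \<otimes>\<^bsub>V\<^esub> inv\<^bsub>V\<^esub> x) w (map (\<lambda>g. G' #> g) gs)
      = foldl (\<lambda>x g. com (\<alpha> g) x) w gs"
    if "w \<in> W" "gs \<in> lists (carrier G)" for w gs
    using that
  proof (induction gs arbitrary: w)
    case (Cons g gs)
    then have g: "g \<in> carrier G"
      by simp
    have "W_action G (G' #> g) w \<otimes>\<^bsub>V\<^esub> inv\<^bsub>V\<^esub> w = com (\<alpha> g) w"
      unfolding X.m_inv_consistent[OF W_subgroup Cons(2)] commutator_elem_def
        W_action_coset[OF g Cons(2)] by simp
    moreover have "gs \<in> lists (carrier G)"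
      using Cons(3) by simp
    ultimately show ?case
      unfolding list.map foldl_Cons using Cons.IH[OF com_W[OF g Cons(2)]] by metis
  qed simp
  show "nilpotent_action Q (quotient_module (W_module G) W\<^sub>0)"
    unfolding W_module_eq
  proof (rule WQ.nilpotent_actionI[OF W0_subgroup_V W0_act, where d = d])
    fix w qs assume w: "w \<in> carrier V" and qs: "qs \<in> lists (carrier Q)" "length qs = d"
    have "\<exists>gs\<in>lists (carrier G). qs = map (\<lambda>g. G' #> g) gs"
      using qs(1)
    proof (induction qs)
      case (Cons q qs)
      obtain g where "g \<in> carrier G" "q = G' #> g"
        using Q_cases[OF Cons(1)] .
      moreover obtain gs where "gs \<in> lists (carrier G)" "qs = map (\<lambda>g. G' #> g) gs"
        using Cons(3) by blast
      ultimately show ?case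
        by (intro bexI[of _ "g # gs"]) auto
    qed simp
    then obtain gs where "gs \<in> lists (carrier G)" "qs = map (\<lambda>g. G' #> g) gs"
      by blast
    then show "foldl (\<lambda>x q. W_action G q x \<otimes>\<^bsub>V\<^esub> inv\<^bsub>V\<^esub> x) w qs \<in> W\<^sub>0"
      using d[of w gs] foldl_eq w qs(2) by simp
  qed (use W_action_one Q.one_closed in auto)
qed

end

theorem theoremC:
  fixes G :: "('a, 'm) monoid_scheme"
  assumes "group G" and "finitely_generated G"
  shows "\<exists>W\<^sub>0. submodule W\<^sub>0 (group_ring (abelianization G)) (W_module G) \<and>
    is_subquotient (group_ring (abelianization G)) ((W_module G)\<lparr>carrier := W\<^sub>0\<rparr>) (M_module G) \<and>
    nilpotent_action (abelianization G) (quotient_module (W_module G) W\<^sub>0)"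
proof -
  interpret weak_comm_group G
    using assms(1) by (simp add: weak_comm_group_def)
  show ?thesis
    using W0_properties[OF assms(2)] by blast
qed

end
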